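(* Let $\alpha$ be a peak composition of $n$. The expansion of the quasisymmetric Schur $Q$-function $\tilde{Q}_\alpha$ in the peak Young quasisymmetric Schur functions is given by \[\tilde{Q}_\alpha = \sum_{\beta} c_{\alpha,\beta}\,\tilde{S}_\beta,\] where the sum is over peak compositions $\beta$ of $n$, and $c_{\alpha,\beta}$ is the number of dual immaculate recording tableaux of shape $\beta$ with row strip shape $\alpha^{\mathrm{rev}}$.
   Context: Let $n$ be a positive integer, $[n]=\{1,\dots,n\}$. A composition $\alpha=(\alpha_1,\dots,\alpha_k)$ of $n$ (written $\alpha\vDash n$) is a finite sequence of positive integers summing to $n$; $\alpha^{\mathrm{rev}}=(\alpha_k,\dots,\alpha_1)$. It is a peak composition if all parts except possibly the last are greater than $1$. Put $\mathrm{set}(\alpha)=\{\alpha_1,\alpha_1+\alpha_2,\dots,\alpha_1+\cdots+\alpha_{k-1}\}\subseteq[n-1]$. For $X=\{x_1<\dots<x_r\}\subseteq[n-1]$, $\mathrm{comp}_n(X)=(x_1,x_2-x_1,\dots,x_r-x_{r-1},n-x_r)$. A composition $\beta$ refines $\alpha$ if $\alpha$ can be obtained by summing consecutive entries of $\beta$. For $X\subseteq[n]$, $\mathrm{Peak}(X)=\{i\in X: i-1\notin X,\ i\neq 1\}$, and $\mathrm{Peak}(\alpha)=\mathrm{Peak}(\mathrm{set}(\alpha))$. Functions: formal power series in $x_1,x_2,\dots$. $M_\alpha=\sum_{1\le i_1<\cdots<i_k}x_{i_1}^{\alpha_1}\cdots x_{i_k}^{\alpha_k}$; $F_\alpha=\sum_{\beta\text{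 refines }\alpha}M_\beta$. For a peak composition $\alpha$ of $n$, the peak function is $K_\alpha=2^{|\mathrm{Peak}(\alpha)|+1}\sum F_\beta$, the sum over $\beta\vDash n$ with $\mathrm{Peak}(\alpha)\subseteq \mathrm{set}(\beta)\,\triangle\,(\mathrm{set}(\beta)+1)$, where $\mathrm{set}(\beta)+1=\{i+1:i\in\mathrm{set}(\beta)\}$ and $\triangle$ is symmetric difference. Diagrams: the diagram $D_\alpha$ is the left-justified array of boxes whose $i$th row from the bottom has $\alpha_i$ boxes; $(c,r)$ denotes the box in column $c$ (leftmost is 1) and row $r$ (bottom is 1). A filling $T$ of $D_\alpha$ assigns an entry $T(c,r)$ to each box; $\alpha$ is its shape. Marked peak composition tableaux: for a peak composition $\alpha$ of $n$, a marked peak composition tableau of shape $\alpha$ is a filling $T$ of $D_\alpha$ with entries from the ordered alphabet $1'<1<2'<2<\cdots$ (primed entries are called marked) such that: (1) entries in each row weakly increase left to right, with no repeated marked entries in a row; (2) entries in the first column strictly increase from bottom to top; (3) for any $k\le n$, the boxes with entries in $\{1',1,\dots,k',k\}$ form the diagram of a peak composition; (4) if an unmarked entry $i$ is in box $(2,r)$ for some row $r$, then neither $i$ nor $i'$ is in box $(1,r+1)$. The weight $\mathrm{wt}(T)$ has $i$th entry equal to the number of occurrences of $i$ or $i'$. $\mathrm{MPCT}(\alpha)$ is the set of such tableaux of shape $\alpha$ whose weight has no zero entry to the left of a nonzero entry (so $\mathrm{wt}(T)$, omitting trailing zeros, is a composition of $n$). The quasisymmetric Schur $Q$-function is $\tilde{Q}_\alpha=\sum_{T\in\mathrm{MPCT}(\alpha)}M_{\mathrm{wt}(T)}$.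 Standard peak Young composition tableaux: for a peak composition $\alpha$ of $n$, $\mathrm{SPYCT}(\alpha)$ is the set of fillings $T$ of $D_\alpha$ with entries from $[n]$, each used once, such that: (1) entries in each row increase left to right; (2) entries in the first column increase from bottom to top; (3) for all $k\le n$, the boxes with entries at most $k$ form the diagram of a peak composition; (4) if $T(c,r)<T(c+1,r')$ for some $c$ and some $r'<r$, then box $(c+1,r)$ is in $T$ and $T(c+1,r)<T(c+1,r')$. For such $T$, $\mathrm{Des}_{\leftarrow}(T)=\{i\in[n-1]: i+1\text{ is weakly left of } i\text{ in }T\}$ and $\mathrm{Peak}_{\leftarrow}(T)=\mathrm{Peak}(\mathrm{Des}_{\leftarrow}(T))$. The peak Young quasisymmetric Schur function is $\tilde{S}_\alpha=\sum_{T\in\mathrm{SPYCT}(\alpha)}K_{\mathrm{comp}_n(\mathrm{Peak}_{\leftarrow}(T))}$. Dual immaculate recording tableaux: for a filling $Q$ of a composition diagram with entries from $[n]$, each used once, a row strip of length $j$ is a maximal sequence $a_1,\dots,a_j$ of consecutive increasing integers such that for all $1\le i<j$, $a_{i+1}$ is in a column strictly right of that of $a_i$. For a composition $\beta$ of $n$, a filling $Q$ of $D_\beta$ with entries from $[n]$, each used once, is a dual immaculate recording tableau (DIRT) if: (1) entries in each row increase left to right; (2) the row strips start in the first column; (3) entries in the first column increase from top to bottom; (4) if $Q(c,r)>Q(c,r')$ for some $c$ and some $r'<r$, then $Q$ has an entry in box $(c+1,r')$ and $Q(c,r)>Q(c+1,r')$. Its row strip shape is the composition $(\gamma_1,\dots,\gamma_k)$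 where $\gamma_i$ is the length of the row strip starting with $\gamma_1+\cdots+\gamma_{i-1}+1$. *)

theory Defs
  imports
    "HOL-Library.FuncSet"
    "HOL-Library.More_List"
    "HOL-Library.Poly_Mapping"
    "HOL-Library.Product_Lexorder"
begin

section \<open>Compositions\<close>

text \<open>For \<open>n = 0\<close> this contains exactly the empty sequence.\<close>

definition compositions :: "nat \<Rightarrow> nat list set" where
  "compositions n = {\<alpha>. (\<forall>a\<in>set \<alpha>. 1 \<le> a) \<and> sum_list \<alpha> = n}"

definition peak_compositions :: "nat \<Rightarrow> nat list set" where
  "peak_compositions n = {\<alpha> \<in> compositions n. \<forall>i. Suc i < length \<alpha> \<longrightarrow> 1 < \<alpha> ! i}"

definition comp_set :: "nat list \<Rightarrow> nat set" where
  "comp_set \<alpha> = {sum_list (take i \<alpha>) | i. 1 \<le> i \<and> i < length \<alpha>}"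

text \<open>Intended for \<open>n \<ge> 1\<close> and \<open>X \<subseteq> {1..<n}\<close>.\<close>

definition comp_of_set :: "nat \<Rightarrow> nat set \<Rightarrow> nat list" where
  "comp_of_set n X =
     (let xs = sorted_list_of_set X in map2 (-) (xs @ [n]) (0 # xs))"

definition refines :: "nat list \<Rightarrow> nat list \<Rightarrow> bool" where
  "refines \<beta> \<alpha> \<longleftrightarrow> (\<exists>bs. [] \<notin> set bs \<and> concat bs = \<beta> \<and> map sum_list bs = \<alpha>)"

definition Peak :: "nat set \<Rightarrow> nat set" where
  "Peak X = {i \<in> X. i - 1 \<notin> X \<and> i \<noteq> 1}"

section \<open>Quasisymmetric functions\<close>

text \<open>
  A formal power series in \<open>x\<^sub>1, x\<^sub>2, \<dots>\<close> with integer coefficients is given by its coefficient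
  function on monomials; a monomial is its finitely supported exponent vector.
  The index \<open>0\<close> never occurs in the series below.
\<close>

type_synonym series = "(nat \<Rightarrow>\<^sub>0 nat) \<Rightarrow> int"

text \<open>
  The coefficient of a monomial \<open>m\<close> in \<open>\<Sum> x\<^bsub>i\<^sub>1\<^esub>\<^bsup>\<alpha>\<^sub>1\<^esup> \<cdots> x\<^bsub>i\<^sub>k\<^esub>\<^bsup>\<alpha>\<^sub>k\<^esup>\<close> is the number of index
  sequences \<open>i\<^sub>1 < \<cdots> < i\<^sub>k\<close> whose summand is \<open>m\<close>.
\<close>

definition monomial_qsym :: "nat list \<Rightarrow> series" where
  "monomial_qsym \<alpha> m = int (card {is. length is = length \<alpha> \<and> sorted_wrt (<) is \<and>
     (\<forall>i\<in>set is. 1 \<le> i) \<and>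
     m = (\<Sum>j<length \<alpha>. Poly_Mapping.single (is ! j) (\<alpha> ! j))})"

definition fundamental_qsym :: "nat list \<Rightarrow> series" where
  "fundamental_qsym \<alpha> m =
     (\<Sum>\<beta> | \<beta> \<in> compositions (sum_list \<alpha>) \<and> refines \<beta> \<alpha>. monomial_qsym \<beta> m)"

definition peak_qsym :: "nat list \<Rightarrow> series" where
  "peak_qsym \<alpha> m =
     2 ^ (card (Peak (comp_set \<alpha>)) + 1) *
     (\<Sum>\<beta> | \<beta> \<in> compositions (sum_list \<alpha>) \<and>
        Peak (comp_set \<alpha>) \<subseteq>
          (comp_set \<beta> - Suc ` comp_set \<beta>) \<union> (Suc ` comp_set \<beta> - comp_set \<beta>).
        fundamental_qsym \<beta> m)"

section \<open>Diagrams and fillings\<close>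

text \<open>
  A box is a pair \<open>(c, r)\<close> of column and row, counted from \<open>1\<close>, with row \<open>1\<close> at the bottom.
  Fillings are extensional functions on the diagram, so that counting fillings is meaningful.
\<close>

definition diagram :: "nat list \<Rightarrow> (nat \<times> nat) set" where
  "diagram \<alpha> = {(c, r). 1 \<le> r \<and> r \<le> length \<alpha> \<and> 1 \<le> c \<and> c \<le> \<alpha> ! (r - 1)}"

definition is_peak_diagram :: "(nat \<times> nat) set \<Rightarrow> bool" where
  "is_peak_diagram B \<longleftrightarrow> (\<exists>m. \<exists>\<gamma>\<in>peak_compositions m. B = diagram \<gamma>)"

definition standard_fillings :: "nat list \<Rightarrow> (nat \<times> nat \<Rightarrow> nat) set" where
  "standard_fillings \<alpha> =
     {T \<in> extensional (diagram \<alpha>). bij_betw T (diagram \<alpha>) {1..sum_list \<alpha>}}"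

definition column_of :: "nat list \<Rightarrow> (nat \<times> nat \<Rightarrow> nat) \<Rightarrow> nat \<Rightarrow> nat" where
  "column_of \<alpha> T i = fst (inv_into (diagram \<alpha>) T i)"

section \<open>Marked peak composition tableaux\<close>

text \<open>
  The marked letter \<open>i'\<close> is \<open>(i, False)\<close> and the unmarked letter \<open>i\<close> is \<open>(i, True)\<close>, so the
  lexicographic order on pairs is \<open>1' < 1 < 2' < 2 < \<cdots>\<close>.
\<close>

type_synonym letter = "nat \<times> bool"

definition letters :: "letter set" where
  "letters = {x. 1 \<le> fst x}"

definition marked :: "letter \<Rightarrow> bool" where
  "marked x \<longleftrightarrow> \<not> snd x"

definition marked_peak_tableaux :: "nat list \<Rightarrow> (nat \<times> nat \<Rightarrow> letter) set" where
  "marked_peak_tableaux \<alpha> = {T \<in> diagram \<alpha> \<rightarrow>\<^sub>E letters.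
     (\<forall>c c' r. (c, r) \<in> diagram \<alpha> \<and> (c', r) \<in> diagram \<alpha> \<and> c < c' \<longrightarrow>
        T (c, r) \<le> T (c', r) \<and> (marked (T (c, r)) \<longrightarrow> T (c, r) \<noteq> T (c', r))) \<and>
     (\<forall>r r'. (1, r) \<in> diagram \<alpha> \<and> (1, r') \<in> diagram \<alpha> \<and> r < r' \<longrightarrow> T (1, r) < T (1, r')) \<and>
     (\<forall>k\<le>sum_list \<alpha>. is_peak_diagram {b \<in> diagram \<alpha>. fst (T b) \<le> k}) \<and>
     (\<forall>r. (2, r) \<in> diagram \<alpha> \<and> (1, r + 1) \<in> diagram \<alpha> \<and> \<not> marked (T (2, r)) \<longrightarrow>
        fst (T (1, r + 1)) \<noteq> fst (T (2, r)))}"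

definition weight :: "nat list \<Rightarrow> (nat \<times> nat \<Rightarrow> letter) \<Rightarrow> nat \<Rightarrow> nat" where
  "weight \<alpha> T i = card {b \<in> diagram \<alpha>. fst (T b) = i}"

definition MPCT :: "nat list \<Rightarrow> (nat \<times> nat \<Rightarrow> letter) set" where
  "MPCT \<alpha> = {T \<in> marked_peak_tableaux \<alpha>.
     \<forall>i j. 1 \<le> i \<and> i < j \<and> weight \<alpha> T j \<noteq> 0 \<longrightarrow> weight \<alpha> T i \<noteq> 0}"

text \<open>
  The weight without its trailing zeros. For \<open>T \<in> MPCT \<alpha>\<close> no letter exceeds the number
  \<open>sum_list \<alpha>\<close> of boxes, so no weight is cut off.
\<close>

definition weight_comp :: "nat list \<Rightarrow> (nat \<times> nat \<Rightarrow> letter) \<Rightarrow> nat list" where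
  "weight_comp \<alpha> T = strip_while ((=) 0) (map (weight \<alpha> T) [1..<Suc (sum_list \<alpha>)])"

definition schur_Q :: "nat list \<Rightarrow> series" where
  "schur_Q \<alpha> m = (\<Sum>T\<in>MPCT \<alpha>. monomial_qsym (weight_comp \<alpha> T) m)"

section \<open>Standard peak Young composition tableaux\<close>

definition SPYCT :: "nat list \<Rightarrow> (nat \<times> nat \<Rightarrow> nat) set" where
  "SPYCT \<alpha> = {T \<in> standard_fillings \<alpha>.
     (\<forall>c c' r. (c, r) \<in> diagram \<alpha> \<and> (c', r) \<in> diagram \<alpha> \<and> c < c' \<longrightarrow> T (c, r) < T (c', r)) \<and>
     (\<forall>r r'. (1, r) \<in> diagram \<alpha> \<and> (1, r') \<in> diagram \<alpha> \<and> r < r' \<longrightarrow> T (1, r) < T (1, r')) \<and>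
     (\<forall>k\<le>sum_list \<alpha>. is_peak_diagram {b \<in> diagram \<alpha>. T b \<le> k}) \<and>
     (\<forall>c r r'. r' < r \<and> (c, r) \<in> diagram \<alpha> \<and> (c + 1, r') \<in> diagram \<alpha> \<and>
        T (c, r) < T (c + 1, r') \<longrightarrow>
          (c + 1, r) \<in> diagram \<alpha> \<and> T (c + 1, r) < T (c + 1, r'))}"

definition Des_left :: "nat list \<Rightarrow> (nat \<times> nat \<Rightarrow> nat) \<Rightarrow> nat set" where
  "Des_left \<alpha> T = {i. 1 \<le> i \<and> i < sum_list \<alpha> \<and> column_of \<alpha> T (i + 1) \<le> column_of \<alpha> T i}"

definition peak_young_schur :: "nat list \<Rightarrow> series" where
  "peak_young_schur \<alpha> m =
     (\<Sum>T\<in>SPYCT \<alpha>. peak_qsym (comp_of_set (sum_list \<alpha>) (Peak (Des_left \<alpha> T))) m)"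

section \<open>Dual immaculate recording tableaux\<close>

definition strip_sequence :: "nat list \<Rightarrow> (nat \<times> nat \<Rightarrow> nat) \<Rightarrow> nat list \<Rightarrow> bool" where
  "strip_sequence \<beta> Q as \<longleftrightarrow> as \<noteq> [] \<and> set as \<subseteq> {1..sum_list \<beta>} \<and>
     (\<forall>i. Suc i < length as \<longrightarrow> as ! Suc i = as ! i + 1 \<and>
        column_of \<beta> Q (as ! i) < column_of \<beta> Q (as ! Suc i))"

definition row_strip :: "nat list \<Rightarrow> (nat \<times> nat \<Rightarrow> nat) \<Rightarrow> nat list \<Rightarrow> bool" where
  "row_strip \<beta> Q as \<longleftrightarrow> strip_sequence \<beta> Q as \<and>
     (\<forall>bs. strip_sequence \<beta> Q bs \<and> set as \<subseteq> set bs \<longrightarrow> bs = as)"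

definition DIRT :: "nat list \<Rightarrow> (nat \<times> nat \<Rightarrow> nat) set" where
  "DIRT \<beta> = {Q \<in> standard_fillings \<beta>.
     (\<forall>c c' r. (c, r) \<in> diagram \<beta> \<and> (c', r) \<in> diagram \<beta> \<and> c < c' \<longrightarrow> Q (c, r) < Q (c', r)) \<and>
     (\<forall>as. row_strip \<beta> Q as \<longrightarrow> column_of \<beta> Q (hd as) = 1) \<and>
     (\<forall>r r'. (1, r) \<in> diagram \<beta> \<and> (1, r') \<in> diagram \<beta> \<and> r < r' \<longrightarrow> Q (1, r') < Q (1, r)) \<and>
     (\<forall>c r r'. r' < r \<and> (c, r) \<in> diagram \<beta> \<and> (c, r') \<in> diagram \<beta> \<and> Q (c, r') < Q (c, r) \<longrightarrow>
        (c + 1, r') \<in> diagram \<beta> \<and> Q (c + 1, r') < Q (c, r))}"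

definition has_row_strip_shape ::
    "nat list \<Rightarrow> (nat \<times> nat \<Rightarrow> nat) \<Rightarrow> nat list \<Rightarrow> bool" where
  "has_row_strip_shape \<beta> Q \<gamma> \<longleftrightarrow> \<gamma> \<in> compositions (sum_list \<beta>) \<and>
     (\<forall>i<length \<gamma>. \<exists>as. row_strip \<beta> Q as \<and>
        hd as = sum_list (take i \<gamma>) + 1 \<and> length as = \<gamma> ! i)"

definition dirt_coeff :: "nat list \<Rightarrow> nat list \<Rightarrow> nat" where
  "dirt_coeff \<alpha> \<beta> = card {Q \<in> DIRT \<beta>. has_row_strip_shape \<beta> Q (rev \<alpha>)}"

section \<open>Finiteness of the index sets\<close>

text \<open>The sums and cardinalities above are taken over finite sets.\<close>

lemma length_le_sum_list: "(\<forall>a\<in>set \<alpha>. 1 \<le> (a::nat)) \<Longrightarrow> length \<alpha> \<le> sum_list \<alpha>"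
  by (induction \<alpha>) auto

lemma finite_compositions: "finite (compositions n)"
proof (rule finite_subset)
  show "compositions n \<subseteq> {xs. set xs \<subseteq> {..n} \<and> length xs \<le> n}"
    by (auto simp: compositions_def length_le_sum_list intro: member_le_sum_list)
qed (rule finite_lists_length_le, simp)

lemma finite_peak_compositions: "finite (peak_compositions n)"
  using finite_compositions by (simp add: peak_compositions_def)

lemma finite_diagram: "finite (diagram \<alpha>)"
proof (rule finite_subset)
  show "diagram \<alpha> \<subseteq> {..sum_list \<alpha>} \<times> {..length \<alpha>}"
  proof
    fix b assume "b \<in> diagram \<alpha>"
    then obtain c r where b: "b = (c, r)" and r: "r - 1 < length \<alpha>" "r \<le> length \<alpha>"
      and c: "c \<le> \<alpha> ! (r - 1)"
      by (auto simp: diagram_def)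
    from c elem_le_sum_list[OF r(1)] have "c \<le> sum_list \<alpha>" by linarith
    with b r(2) show "b \<in> {..sum_list \<alpha>} \<times> {..length \<alpha>}" by simp
  qed
qed simp

lemma finite_standard_fillings: "finite (standard_fillings \<alpha>)"
proof (rule finite_subset)
  show "standard_fillings \<alpha> \<subseteq> diagram \<alpha> \<rightarrow>\<^sub>E {1..sum_list \<alpha>}"
    by (auto simp: standard_fillings_def PiE_def dest: bij_betwE)
qed (intro finite_PiE finite_diagram, simp)

lemma finite_SPYCT: "finite (SPYCT \<alpha>)"
  using finite_standard_fillings by (simp add: SPYCT_def)

lemma finite_DIRT: "finite (DIRT \<beta>)"
  using finite_standard_fillings by (simp add: DIRT_def)

lemma finite_MPCT: "finite (MPCT \<alpha>)"
proof (rule finite_subset)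
  let ?N = "card (diagram \<alpha>)"
  show "MPCT \<alpha> \<subseteq> diagram \<alpha> \<rightarrow>\<^sub>E ({..?N} \<times> UNIV)"
  proof
    fix T assume T: "T \<in> MPCT \<alpha>"
    have "fst (T b) \<le> ?N" if b: "b \<in> diagram \<alpha>" for b
    proof -
      have "{1..fst (T b)} \<subseteq> (\<lambda>b. fst (T b)) ` diagram \<alpha>"
      proof
        fix i assume i: "i \<in> {1..fst (T b)}"
        have "weight \<alpha> T (fst (T b)) \<noteq> 0"
        proof -
          have "b \<in> {b' \<in> diagram \<alpha>. fst (T b') = fst (T b)}" using b by simp
          moreover have "finite {b' \<in> diagram \<alpha>. fst (T b') = fst (T b)}"
            using finite_diagram by simp
          ultimately show ?thesis unfolding weight_def by (metis card_0_eq empty_iff)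
        qed
        hence "weight \<alpha> T i \<noteq> 0"
        proof (cases "i = fst (T b)")
          case False
          hence "1 \<le> i \<and> i < fst (T b)" using i by auto
          moreover have "\<forall>i j. 1 \<le> i \<and> i < j \<and> weight \<alpha> T j \<noteq> 0 \<longrightarrow> weight \<alpha> T i \<noteq> 0"
            using T unfolding MPCT_def by blast
          ultimately show ?thesis using \<open>weight \<alpha> T (fst (T b)) \<noteq> 0\<close> by blast
        qed simp
        hence "{b \<in> diagram \<alpha>. fst (T b) = i} \<noteq> {}"
          unfolding weight_def by (metis card.empty)
        thus "i \<in> (\<lambda>b. fst (T b)) ` diagram \<alpha>" by auto
      qed
      from surj_card_le[OF finite_diagram this] show ?thesis by simp
    qed
    moreover have "T \<in> extensional (diagram \<alpha>)"
      using T by (auto simp: MPCT_def marked_peak_tableaux_def PiE_def)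
    ultimately show "T \<in> diagram \<alpha> \<rightarrow>\<^sub>E ({..?N} \<times> UNIV)"
      by (auto simp: PiE_def mem_Times_iff)
  qed
qed (intro finite_PiE finite_diagram, simp)

end

theory Submission
  imports Defs
begin

text \<open>
  A marked tableau of shape \<open>\<alpha>\<close> standardizes to a word \<open>v\<close> of row indices whose prefixes have peak
  compositions as content; the marked tableaux of weight \<open>\<gamma>\<close> over \<open>v\<close> number \<open>2\<close> to the length of \<open>\<gamma>\<close>
  if no peak of the descent set of \<open>v\<close> is interior to a block of \<open>\<gamma>\<close>, and \<open>0\<close> otherwise. The same
  number is the coefficient in the peak function of that peak set. So both sides reduce to
  counting words by descent sets.

  A dual immaculate recording tableau amounts to a chain of compositions in which each step adds a
  new bottom row together with a horizontal strip. Inserting a letter into such a chain bumps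
  through the strips: a box arriving in column \<open>e\<close> of the smaller composition adds a box to the
  topmost row of the larger one whose length is maximal below \<open>e\<close>. This is a bijection from words
  to pairs of a Young composition tableau and a chain, and it turns row descents into
  column descents. The peak condition is transported because the number of rows of length at
  least two never exceeds the number of strips of length at least two.
\<close>

section \<open>Horizontal strips of compositions\<close>

text \<open>What insertion proves is stronger than the theorem: for every predicate on descent sets,
  the words of content \<open>\<alpha>\<close> satisfying it are counted by pairs of a tableau in
  some \<open>SPYCT \<beta>\<close> satisfying it and a chain ending in \<open>\<beta>\<close>.
  Peaks enter only when coefficients are compared at one monomial, whose exponents form a
  composition \<open>\<gamma>\<close>. The number \<open>2 ^ length \<gamma>\<close> arises there in
  two unrelated ways: each block of \<open>\<gamma>\<close> admits exactly two markings of a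
  compatible word, and each peak halves the number of subsets of \<open>comp_set \<gamma>\<close>
  that count, which cancels the power of two in the peak function up to a factor 2. The reversal of
  \<open>\<alpha>\<close> has a simple source: the first part of \<open>\<alpha>\<close> is its
  bottom row, and the strip that creates the bottom row is performed last. The obstacle is
  surjectivity: removing boxes from a chain yields a word, but that its prefixes have peak content
  is not visible in a single strip, since a strip also lengthens rows created by others. It follows
  from a count over all strips, with the size of the innermost strip as tie-breaker.\<close>

text \<open>
  \<open>strip p l x y\<close>: the composition \<open>y\<close> on the rows \<open>p, \<dots>, l - 1\<close> arises from \<open>x\<close> on the rows
  \<open>p + 1, \<dots>, l - 1\<close> by boxes added in increasing columns, never creating a row of the same
  length as a lower row. Rows keep their index in the final composition, counted from \<open>0\<close>.
\<close>

definition strip :: "nat \<Rightarrow> nat \<Rightarrow> (nat \<Rightarrow> nat) \<Rightarrow> (nat \<Rightarrow> nat) \<Rightarrow> bool" where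
  "strip p l x y \<longleftrightarrow> (\<forall>r. 0 < x r \<longleftrightarrow> Suc p \<le> r \<and> r < l) \<and> (\<forall>r. 0 < y r \<longleftrightarrow> p \<le> r \<and> r < l) \<and>
     (\<forall>r. x r \<le> y r) \<and> (\<forall>r' r. r' < r \<longrightarrow> y r = x r \<or> y r < x r' \<or> y r' \<le> x r)"

text \<open>Row \<open>l\<close> stands for a new row on top; it is the only addable row of length \<open>0\<close>.\<close>

definition addable :: "nat \<Rightarrow> (nat \<Rightarrow> nat) \<Rightarrow> nat \<Rightarrow> bool" where
  "addable l y j \<longleftrightarrow> j \<le> l \<and> (\<forall>r. j < r \<and> r \<le> l \<longrightarrow> y r \<noteq> y j)"

definition add_box :: "(nat \<Rightarrow> nat) \<Rightarrow> nat \<Rightarrow> nat \<Rightarrow> nat" where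
  "add_box y j = y(j := Suc (y j))"

text \<open>\<open>e\<close> is the column that a box enters in the smaller composition.
  \<open>below\<close> fixes only the length of the row to be extended; together with
  \<open>addable\<close>, which selects the topmost row of that length, it determines the
  row.\<close>

definition below :: "(nat \<Rightarrow> nat) \<Rightarrow> nat \<Rightarrow> nat \<Rightarrow> bool" where
  "below y e j \<longleftrightarrow> y j < e \<and> (\<forall>r. y r < e \<longrightarrow> y r \<le> y j)"

text \<open>If the upper of two rows changes, the strip condition puts its new columns entirely left
  of the end of the lower row in \<open>x\<close>, or right of the end of that row in
  \<open>y\<close>. Either way the two intervals of new columns are disjoint, which is what makes
  the added boxes a horizontal strip.\<close>

lemma strip_distinct_columns:
  assumes "strip p l x y" "x r < c" "c \<le> y r" "x r' < c" "c \<le> y r'"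
  shows "r = r'"
proof -
  have *: "y b = x b \<or> y b < x a \<or> y a \<le> x b" if "a < b" for a b
    using assms(1) that unfolding strip_def by blast
  show ?thesis
    using *[of r r'] *[of r' r] assms(2-) by (cases r r' rule: linorder_cases) linarith+
qed

text \<open>If row \<open>i\<close> has no box of the strip, the bump hits row \<open>i\<close>
  itself and both compositions gain the same box. Otherwise the strip box of row \<open>i\<close> in
  column \<open>x i + 1\<close> passes into the smaller composition, and the new box of
  \<open>y\<close>, in a column at most \<open>x i + 1\<close>, replaces it in the strip.\<close>

lemma strip_add_box:
  assumes V: "strip p l x y" and i: "Suc p \<le> i" "addable l x i"
    and j: "addable l y j" "below y (Suc (x i)) j"
  shows "strip p (max l (Suc i)) (add_box x i) (add_box y j)" "j = l \<longleftrightarrow> i = l"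
proof -
  let ?e = "Suc (x i)"
  have sx: "0 < x r \<longleftrightarrow> Suc p \<le> r \<and> r < l" and sy: "0 < y r \<longleftrightarrow> p \<le> r \<and> r < l" and le: "x r \<le> y r" for r
    using V unfolding strip_def by blast+
  have v: "y b = x b \<or> y b < x a \<or> y a \<le> x b" if "a < b" for a b
    using V that unfolding strip_def by blast
  have u: "a = b" if "x a < c" "c \<le> y a" "x b < c" "c \<le> y b" for a b c
    using strip_distinct_columns[OF V that] .
  have ti: "x r \<noteq> x i" if "i < r" "r \<le> l" for r
    using i(2) that unfolding addable_def by blast
  note il = i(2)[unfolded addable_def, THEN conjunct1]
  note jl = j(1)[unfolded addable_def, THEN conjunct1]
  have tj: "y r \<noteq> y j" if "j < r" "r \<le> l" for r
    using j(1) that unfolding addable_def by blast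
  have jb: "y r \<le> y j" if "y r \<le> x i" for r
    using j(2) that unfolding below_def by auto
  have je: "y j \<le> x i" using j(2) unfolding below_def by auto
  \<comment> \<open>Maximality of \<open>y j\<close> below \<open>x i + 1\<close>: a row of
    \<open>y\<close> longer than row \<open>j\<close> reaches column \<open>x i + 1\<close>.\<close>
  have nb: "x i < y r" if "y j < y r" for r
    using jb[of r] that by (meson not_le)
  have outx: "x r = 0" and outy: "y r = 0" if "l \<le> r" for r
    using sx[of r] sy[of r] that by auto
  have jp: "p \<le> j"
    using sy[of j] tj[of l] outy[of l] jl il i(1) by (cases "j = l") auto
  show 1: "j = l \<longleftrightarrow> i = l"
  proof
    assume "i = l"
    then show "j = l" using je outx[of l] outy[of l] tj[of l] jl by (cases "j = l") auto
  next
    assume "j = l"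
    show "i = l"
    proof (rule ccontr)
      assume "i \<noteq> l"
      then have "0 < x i" "0 < y p" "x p = 0" using sx[of i] sy[of p] sx[of p] i(1) il by auto
      moreover have "y j < y p" "y j < y i"
        using \<open>j = l\<close> outy[of l] \<open>0 < y p\<close> le[of i] \<open>0 < x i\<close> by auto
      then have "x i < y p" "x i < y i" using nb by blast+
      ultimately show False using v[of p i] i(1) by auto
    qed
  qed
  \<comment> \<open>With row \<open>i\<close> unchanged, \<open>y j = x i = y i\<close>. Row
    \<open>j\<close> being topmost of this length in \<open>y\<close> rules out
    \<open>j < i\<close>, and row \<open>i\<close> being topmost in \<open>x\<close> rules out
    \<open>i < j\<close>.\<close>
  have jeq: "j = i" if "y i = x i"
  proof (rule linorder_cases[of i j])
    assume "i < j"
    moreover have "y j = x i" using jb[of i] je that by auto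
    ultimately show ?thesis using v[of i j] ti[of j] jl le[of j] that by auto
  next
    assume "j < i"
    then show ?thesis using tj[of i] jb[of i] je that il by auto
  qed simp
  \<comment> \<open>Only row \<open>i\<close> can own the strip box in column
    \<open>x i + 1\<close>.\<close>
  have big: "a = i" if "x a \<le> x i" "x i < y a" "x i < y i" for a
    using u[of a ?e i] that by auto
  have cmp: "add_box y j b = add_box x i b \<or> add_box y j b < add_box x i a \<or> add_box y j a \<le> add_box x i b"
    if ab: "a < b" for a b
  proof (cases "y i = x i")
    case True
    have "j = i" using jeq[OF True] .
    consider "b = i" | "a = i" | "a \<noteq> i" "b \<noteq> i" by blast
    then show ?thesis
    proof cases
      case 2
      have "x b \<noteq> x i \<or> y b = x b" using ti[of b] outx[of b] outy[of b] ab 2 by (cases "b \<le> l") auto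
      then show ?thesis using v[OF ab] 2 ab \<open>j = i\<close> True by (auto simp: add_box_def)
    qed (use v[OF ab] \<open>j = i\<close> True ab in \<open>auto simp: add_box_def\<close>)
  next
    case False
    then have yi: "x i < y i" using le[of i] by simp
    then have ij: "j \<noteq> i" using je by auto
    have c1: "y j < x i" if "i < j"
      using v[OF that] ti[OF that jl] le[of j] je yi by auto
    consider "a = i" "b = j" | "a = j" "b = i" | "a = i" "b \<noteq> j" | "b = i" "a \<noteq> j"
      | "b = j" "a \<noteq> i" | "a = j" "b \<noteq> i" | "a \<noteq> i" "a \<noteq> j" "b \<noteq> i" "b \<noteq> j" by blast
    then show ?thesis
    proof cases
      case 1 then show ?thesis using c1 ab ij by (auto simp: add_box_def)
    next
      case 2 then show ?thesis using je ij by (auto simp: add_box_def)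
    next
      case 3 then show ?thesis using v[OF ab] ab ij by (auto simp: add_box_def)
    next
      case 4 then show ?thesis using v[OF ab] ab ij yi by (auto simp: add_box_def)
    next
      case 5
      \<comment> \<open>Row \<open>j\<close> must not grow to the length of a lower row
        \<open>a\<close>. A tie forces \<open>y j = x i\<close> and \<open>j < i\<close>, and then
        the rows \<open>a < i\<close> of the old strip would conflict around column
        \<open>x i + 1\<close>.\<close>
      have A: "Suc (y j) < x a" if "y j < y a"
      proof -
        have ya: "x i < y a" using nb that by blast
        have xa: "x i < x a" using big[of a] ya yi 5 by (meson not_le)
        have "x a \<noteq> Suc (y j)"
        proof
          assume "x a = Suc (y j)"
          then have e: "y j = x i" using xa je by auto
          then have "j < i" using c1 ij by (cases i j rule: linorder_cases) auto
          then show False using v[of a i] ab 5 yi ya e \<open>x a = Suc (y j)\<close> by auto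
        qed
        then show ?thesis using xa je by auto
      qed
      show ?thesis using v[OF ab] 5 A le[of a] ij ab
        by (auto simp: add_box_def)
    next
      case 6
      have "y b = x b \<or> x b \<noteq> y j"
      proof (rule ccontr)
        assume "\<not> ?thesis"
        then have "y j < y b" "x b \<le> x i" using le[of b] je by auto
        then show False using nb[of b] big[of b] yi 6 by auto
      qed
      then have "y b = x b \<or> y b < x j \<or> Suc (y j) \<le> x b" using v[OF ab] 6 le_neq_implies_less[of "y j" "x b"] by auto
      then show ?thesis using 6 ij ab by (auto simp: add_box_def)
    next
      case 7 then show ?thesis using v[OF ab] by (auto simp: add_box_def)
    qed
  qed
  have "add_box x i r \<le> add_box y j r" for r
  proof (cases "r = i \<and> j \<noteq> i")
    case True
    then have "y i \<noteq> x i" using jeq by blast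
    then show ?thesis using le[of i] True by (simp add: add_box_def)
  next
    case False then show ?thesis using le[of r] by (auto simp: add_box_def)
  qed
  moreover have "0 < add_box x i r \<longleftrightarrow> Suc p \<le> r \<and> r < max l (Suc i)" for r
    using sx[of r] i(1) il by (auto simp: add_box_def)
  moreover have "0 < add_box y j r \<longleftrightarrow> p \<le> r \<and> r < max l (Suc i)" for r
    using sy[of r] jp jl 1 il by (auto simp: add_box_def)
  ultimately show "strip p (max l (Suc i)) (add_box x i) (add_box y j)"
    unfolding strip_def using cmp by blast
qed

text \<open>The step in which the strip itself gets longer while \<open>x\<close> stays. Past the
  end of a longest row the new box opens a new column, so it shares no column with another strip box
  and ties with no lower row.\<close>

lemma strip_add_box_top:
  assumes V: "strip p l x y" and p: "p < l" and j: "addable l y j" "\<forall>r. y r \<le> y j"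
  shows "strip p l x (add_box y j)" "j < l"
proof -
  have sy: "0 < y r \<longleftrightarrow> p \<le> r \<and> r < l" and le: "x r \<le> y r" for r
    using V unfolding strip_def by blast+
  have v: "y b = x b \<or> y b < x a \<or> y a \<le> x b" if "a < b" for a b
    using V that unfolding strip_def by blast
  have jb: "y r \<le> y j" for r using j(2) by blast
  have jp: "p \<le> j" "j < l" using sy[of p] sy[of j] jb[of p] p by auto
  have tj: "y r < y j" if "j < r" for r
  proof (cases "r \<le> l")
    case True then show ?thesis using j(1) that jb[of r] unfolding addable_def by (auto simp: order_less_le)
  next
    case False then show ?thesis using sy[of r] sy[of j] jp by auto
  qed
  show "j < l" by fact
  have cmp: "add_box y j b = x b \<or> add_box y j b < x a \<or> add_box y j a \<le> x b" if ab: "a < b" for a b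
  proof -
    consider "b = j" | "a = j" | "a \<noteq> j" "b \<noteq> j" by blast
    then show ?thesis
    proof cases
      case 1
      have "y j = x j \<or> y j < x a \<or> y a \<le> x j" using v[OF ab] 1 by simp
      then have "y a \<le> x j" using le[of a] jb[of a] by auto
      then show ?thesis using 1 ab by (auto simp: add_box_def)
    next
      case 2
      then have "y b = x b \<or> y b < x j" using v[OF ab] tj[of b] le[of b] ab by auto
      then show ?thesis using 2 ab by (auto simp: add_box_def)
    next
      case 3 then show ?thesis using v[OF ab] by (auto simp: add_box_def)
    qed
  qed
  have "x r \<le> add_box y j r" for r using le[of r] by (auto simp: add_box_def)
  moreover have "0 < add_box y j r \<longleftrightarrow> p \<le> r \<and> r < l" for r
    using sy[of r] jp by (auto simp: add_box_def)
  moreover have "0 < x r \<longleftrightarrow> Suc p \<le> r \<and> r < l" for r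
    using V unfolding strip_def by blast
  ultimately show "strip p l x (add_box y j)" unfolding strip_def using cmp by blast
qed

text \<open>Recovers the row that triggered a bump from \<open>y\<close>, the bumped row and the
  enlarged \<open>x\<close>. With two candidates \<open>i\<close> and \<open>i'\<close>, each of the
  two smaller compositions lacks one box in one of these rows. Rows of \<open>y\<close> longer than
  row \<open>j\<close> exceed both old lengths, so the two strip conditions between \<open>i\<close>
  and \<open>i'\<close> contradict each other.\<close>

lemma strip_add_box_inj:
  assumes V: "strip p l x y" "strip p l x' y" and i: "addable l x i" "addable l x' i'"
    and j: "below y (Suc (x i)) j" "below y (Suc (x' i')) j" and eq: "add_box x i = add_box x' i'"
  shows "i = i'"
proof (rule ccontr)
  assume ne: "i \<noteq> i'"
  have le: "x r \<le> y r" and le': "x' r \<le> y r" for r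
    using V unfolding strip_def by blast+
  have v: "y b = x b \<or> y b < x a \<or> y a \<le> x b" and v': "y b = x' b \<or> y b < x' a \<or> y a \<le> x' b"
    if "a < b" for a b
    using V that unfolding strip_def by blast+
  have x1: "x' i = Suc (x i)" and x2: "x i' = Suc (x' i')"
    using fun_cong[OF eq, of i] fun_cong[OF eq, of i'] ne by (auto simp: add_box_def)
  have y1: "x i < y i" "x' i' < y i'" using le'[of i] le[of i'] x1 x2 by auto
  have nb: "x i < y r" "x' i' < y r" if "y j < y r" for r
    using j[unfolded below_def] that by (meson less_Suc_eq_le not_le)+
  have je: "y j \<le> x i" "y j \<le> x' i'" using j unfolding below_def by auto
  then have y2: "x' i' < y i" "x i < y i'" using nb[of i] nb[of i'] y1 by auto
  show False
    using v[of i i'] v'[of i i'] v[of i' i] v'[of i' i] x1 x2 y1 y2 ne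
    by (cases i i' rule: linorder_cases) auto
qed

text \<open>Inverse of \<open>strip_add_box\<close>; the alternative excluded by \<open>ne\<close>
  is the configuration produced by \<open>strip_add_box_top\<close>.\<close>

lemma strip_remove_box:
  assumes V: "strip p l' x y'" and j: "addable l y j" and y': "y' = add_box y j"
    and sy: "\<forall>r. 0 < y r \<longleftrightarrow> p \<le> r \<and> r < l" and l': "l' = max l (Suc j)" and p: "p < l"
    and ne: "\<not> ((\<forall>r. y r \<le> y j) \<and> l' = l \<and> strip p l x y)"
  obtains i x0 where "Suc p \<le> i" "addable l x0 i" "x = add_box x0 i" "strip p l x0 y"
    "below y (Suc (x0 i)) j" "l' = max l (Suc i)"
proof -
  have sx: "0 < x r \<longleftrightarrow> Suc p \<le> r \<and> r < l'" and sy': "0 < y' r \<longleftrightarrow> p \<le> r \<and> r < l'"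
    and le: "x r \<le> y' r" for r
    using V unfolding strip_def by blast+
  have v: "y' b = x b \<or> y' b < x a \<or> y' a \<le> x b" if "a < b" for a b
    using V that unfolding strip_def by blast
  have jl: "j \<le> l" using j unfolding addable_def by blast
  have tj: "y r \<noteq> y j" if "j < r" "r \<le> l" for r
    using j that unfolding addable_def by blast
  have y'r: "y' r = y r" if "r \<noteq> j" for r
    using y' that by (auto simp: add_box_def)
  have y'j: "y' j = Suc (y j)" using y' by (auto simp: add_box_def)
  have out: "y r = 0 \<and> x r = 0" if "l < r" for r
  proof -
    have "l' \<le> r" using l' that jl by simp
    then show ?thesis using sx[of r] sy[rule_format, of r] that by linarith
  qed
  show ?thesis
  proof (cases "x j \<le> y j")
    case False
    then have xj: "x j = Suc (y j)" using le[of j] y'j by simp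
    \<comment> \<open>The last box of row \<open>j\<close> lies in \<open>x\<close> as well, so it
      is removed from both: \<open>i = j\<close>.\<close>
    define x0 where "x0 = x(j := y j)"
    have x: "x = add_box x0 j" using xj unfolding x0_def add_box_def by auto
    have pj: "Suc p \<le> j" using sx[of j] xj by auto
    have tx: "addable l x0 j" unfolding addable_def
    proof (intro conjI allI impI jl)
      fix r assume r: "j < r \<and> r \<le> l"
      have "y r = x r \<or> y r < Suc (y j) \<or> Suc (y j) \<le> x r" using v[of j r] r y'r[of r] y'j xj by auto
      then show "x0 r \<noteq> x0 j" using tj[of r] le[of r] r y'r[of r] by (auto simp: x0_def)
    qed
    have cmp: "y b = x0 b \<or> y b < x0 a \<or> y a \<le> x0 b" if ab: "a < b" for a b
    proof -
      consider "b = j" | "a = j" "l < b" | "a = j" "b \<le> l" "b \<noteq> j" | "a \<noteq> j" "b \<noteq> j" by (cases "b \<le> l") auto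
      then show ?thesis
      proof cases
        case 2 then show ?thesis using out[of b] ab by (auto simp: x0_def)
      next
        case 3 then show ?thesis using v[OF ab] tj[of b] ab y'r[of b] y'j xj by (auto simp: x0_def)
      qed (use v[OF ab] y'r in \<open>auto simp: x0_def\<close>)
    qed
    have sy0: "y j = 0 \<longleftrightarrow> j = l"
      using sy tj[of l] jl pj by (cases "j = l") auto
    have "strip p l x0 y"
    proof -
      have "0 < x0 r \<longleftrightarrow> Suc p \<le> r \<and> r < l" for r
        using sx[of r] sy0 l' pj jl by (auto simp: x0_def)
      moreover have "x0 r \<le> y r" for r using le[of r] y'r[of r] by (auto simp: x0_def)
      ultimately show ?thesis unfolding strip_def using sy cmp by blast
    qed
    moreover have "below y (Suc (x0 j)) j" by (auto simp: below_def x0_def)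
    ultimately show ?thesis using that[of j x0] pj tx x l' by blast
  next
    case xj: True
    have jl': "j < l" "0 < y j"
    proof -
      have "p \<le> j" "j < l'" using sy'[of j] y'j by linarith+
      moreover have "j \<noteq> l"
      proof
        assume "j = l"
        then have "x j = 0" using sy[rule_format, of j] xj by linarith
        then show False using sx[of j] p \<open>j = l\<close> \<open>j < l'\<close> by auto
      qed
      ultimately show "j < l" "0 < y j" using jl sy[rule_format, of j] by linarith+
    qed
    then have l'l: "l' = l" using l' by auto
    have cmp: "y b = x b \<or> y b < x a \<or> y a \<le> x b" if ab: "a < b" for a b
      using v[OF ab] y'r[of a] y'r[of b] y'j xj ab by (cases "a = j"; cases "b = j") auto
    have lexy: "x r \<le> y r" for r using le[of r] y'r[of r] xj by (cases "r = j") auto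
    have V0: "strip p l x y"
      unfolding strip_def using sx sy lexy cmp l'l by blast
    have u: "r = j" if "x r \<le> y j" "y j < y r" for r
      using strip_distinct_columns[OF V, of r "Suc (y j)" j] y'r[of r] that y'j xj by (cases "r = j") auto
    show ?thesis
    proof (cases "\<exists>r. y j < x r")
      case False
      \<comment> \<open>No row of \<open>x\<close> extends past \<open>y j\<close>, so row
        \<open>j\<close> is a longest row of \<open>y\<close>: the case excluded by
        \<open>ne\<close>.\<close>
      have "y r \<le> y j" for r using u[of r] False by (cases "y j < y r") (auto simp: not_less)
      then show ?thesis using ne V0 l'l by blast
    next
      case True
      \<comment> \<open>The nearest column right of \<open>y j\<close> in which a row of
        \<open>x\<close> ends. For this \<open>e\<close>, row \<open>j\<close> has maximal length
        below \<open>e\<close>; that is \<open>bj\<close> further down.\<close>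
      define e where "e = (LEAST e. \<exists>r. x r = e \<and> y j < e)"
      have E: "\<exists>r. x r = e \<and> y j < e"
        unfolding e_def by (rule LeastI_ex) (use True in blast)
      have emin: "e \<le> x r" if "y j < x r" for r
        unfolding e_def by (rule Least_le) (use that in blast)
      \<comment> \<open>The lowest row of length \<open>e\<close>: once it is shortened, a lower row
        of length \<open>e\<close> in \<open>x\<close> would conflict with the strip box that row
        \<open>i\<close> gains in column \<open>e\<close>.\<close>
      define i where "i = (LEAST i. x i = e)"
      have xi: "x i = e" unfolding i_def by (rule LeastI_ex) (use E in blast)
      have imin: "i \<le> r" if "x r = e" for r unfolding i_def by (rule Least_le) (use that in blast)
      have je: "y j < e" using E by blast
      have ij: "i \<noteq> j" using xi je xj by auto
      have pi: "Suc p \<le> i" "i < l" using sx[of i] xi je l'l by auto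
      have bj: "y r \<le> y j" if "y r < e" for r
      proof (rule ccontr)
        assume "\<not> y r \<le> y j"
        then show False using u[of r] emin[of r] lexy[of r] that by (cases "x r \<le> y j") auto
      qed
      have lij: "\<not> i < j" if "e = Suc (y j)"
        using v[of i j] le[of i] that xi y'j xj by auto
      define x0 where "x0 = x(i := e - 1)"
      have x: "x = add_box x0 i" using xi je unfolding x0_def add_box_def by auto
      have tx: "addable l x0 i" unfolding addable_def
      proof (intro conjI allI impI)
        show "i \<le> l" using pi by simp
        fix r assume r: "i < r \<and> r \<le> l"
        show "x0 r \<noteq> x0 i"
        proof
          assume "x0 r = x0 i"
          then have xr: "x r = e - 1" using r by (auto simp: x0_def)
          then have "\<not> y j < x r" using emin[of r] je by auto
          then have e: "e = Suc (y j)" using xr je by auto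
          then have nij: "\<not> i < j" using lij by blast
          then have "j < r" using r by auto
          then have "y r \<noteq> y j" using tj r by blast
          then show False using cmp[of i r] r xr e xi lexy[of i] bj[of r] lexy[of r] by auto
        qed
      qed
      have cmp0: "y b = x0 b \<or> y b < x0 a \<or> y a \<le> x0 b" if ab: "a < b" for a b
      proof -
        consider "b = i" | "a = i" "b \<noteq> i" | "a \<noteq> i" "b \<noteq> i" by blast
        then show ?thesis
        proof cases
          case 1
          have "y i < x a" if "e \<le> y a"
          proof -
            have "a \<noteq> j" using that je by auto
            then have "y j < x a" using u[of a] that je by (meson not_le less_le_trans)
            then have "e < x a" using emin[of a] imin[of a] ab 1 by (auto simp: order_less_le)
            then show ?thesis using cmp[of a i] ab 1 xi lexy[of a] by auto
          qed
          then show ?thesis using 1 ab je by (cases "e \<le> y a") (auto simp: x0_def)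
        next
          case 2
          have "y b = x b \<or> y b \<noteq> e - 1"
          proof (rule ccontr)
            assume "\<not> ?thesis"
            then have yb: "y b \<noteq> x b" "y b = e - 1" by auto
            then have e: "e = Suc (y j)" using bj[of b] je by auto
            then have "j < b" using lij ij ab 2 by auto
            moreover have "b \<le> l" using out[of b] yb by (cases "b \<le> l") auto
            ultimately show False using tj[of b] yb e by auto
          qed
          then show ?thesis using cmp[OF ab] 2 ab xi by (auto simp: x0_def)
        next
          case 3 then show ?thesis using cmp[OF ab] by (auto simp: x0_def)
        qed
      qed
      have "strip p l x0 y"
      proof -
        have "0 < x0 r \<longleftrightarrow> Suc p \<le> r \<and> r < l" for r
          using sx[of r] pi je jl' l'l by (auto simp: x0_def)
        moreover have "x0 r \<le> y r" for r using lexy[of r] xi by (auto simp: x0_def)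
        ultimately show ?thesis unfolding strip_def using sy cmp0 by blast
      qed
      moreover have "below y (Suc (x0 i)) j" using je bj by (auto simp: below_def x0_def)
      ultimately show ?thesis using that[of i x0] pi tx x l'l by auto
    qed
  qed
qed

text \<open>Transports the comparison of two consecutive boxes through one strip. If the second box
  lies strictly further right in \<open>x\<close>, the freshly extended row \<open>j\<close> is
  itself short enough to be chosen, so the second box of \<open>y\<close> is strictly right too. If
  the second box of \<open>x\<close> is weakly left but that of \<open>y\<close> is not, two
  different rows \<open>i\<close> and \<open>i'\<close> would own column \<open>x i + 1\<close> of
  the strip.\<close>

lemma column_less_iff:
  assumes V: "strip p l x y" and j: "below y (Suc (x i)) j"
    and j': "below (add_box y j) (Suc (add_box x i i')) j'"
  shows "add_box y j j' \<le> y j \<longleftrightarrow> add_box x i i' \<le> x i"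
proof
  assume A: "add_box y j j' \<le> y j"
  show "add_box x i i' \<le> x i"
  proof (rule ccontr)
    assume "\<not> ?thesis"
    then have "add_box y j j < Suc (add_box x i i')" using j by (auto simp: below_def add_box_def)
    then have "add_box y j j \<le> add_box y j j'" using j' unfolding below_def by blast
    then show False using A by (simp add: add_box_def)
  qed
next
  assume A: "add_box x i i' \<le> x i"
  have le: "x r \<le> y r" for r using V unfolding strip_def by blast
  have nb: "x i < y r" if "y j < y r" for r
    using j that unfolding below_def by (meson less_Suc_eq_le not_le)
  have B: "add_box y j j' \<le> add_box x i i'" using j' unfolding below_def by auto
  show "add_box y j j' \<le> y j"
  proof (rule ccontr)
    assume C: "\<not> ?thesis"
    have i': "i' \<noteq> i" using A by (auto simp: add_box_def)
    have j'j: "j' = j"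
    proof (rule ccontr)
      assume "j' \<noteq> j"
      then have "y j < y j'" "y j' \<le> x i" using A B C by (auto simp: add_box_def)
      then show False using nb[of j'] by simp
    qed
    then have D: "y j < x i'" "x i' \<le> x i" using A B i' by (auto simp: add_box_def)
    have yi: "y j < y i"
      using D le[of i] by linarith
    then have "x i < y i'" "x i < y i" using nb[of i'] nb[of i] le[of i'] D(1) less_le_trans by blast+
    then show False using strip_distinct_columns[OF V, of i' "Suc (x i)" i] D i' by auto
  qed
qed

section \<open>Insertion into chains of strips\<close>

text \<open>The empty chain stands for the empty composition.\<close>

fun top_state :: "(nat \<Rightarrow> nat) list \<Rightarrow> nat \<Rightarrow> nat" where
  "top_state [] = (\<lambda>_. 0)"
| "top_state (y # ys) = y"

text \<open>The chain is listed from the largest composition inwards, and the first part of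
  \<open>\<alpha>\<close> is the size of the outermost strip, whose new bottom row is
  \<open>p\<close>. The sum \<open>p + length \<alpha>\<close>, the number of rows of the final
  composition, is the same at every level, so all levels share one indexing of the rows.\<close>

fun strips :: "nat \<Rightarrow> nat list \<Rightarrow> (nat \<Rightarrow> nat) list \<Rightarrow> bool" where
  "strips p [] ys \<longleftrightarrow> ys = []"
| "strips p (a # \<alpha>) [] \<longleftrightarrow> False"
| "strips p (a # \<alpha>) (y # ys) \<longleftrightarrow> strips (Suc p) \<alpha> ys \<and>
     strip p (Suc p + length \<alpha>) (top_state ys) y \<and>
     (\<Sum>r<Suc p + length \<alpha>. y r) = (\<Sum>r<Suc p + length \<alpha>. top_state ys r) + a"

fun grow :: "nat \<Rightarrow> nat list \<Rightarrow> nat list" where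
  "grow i [] = [1]"
| "grow 0 (a # \<alpha>) = Suc a # \<alpha>"
| "grow (Suc i) (a # \<alpha>) = a # grow i \<alpha>"

text \<open>The inner \<open>Max\<close> chooses the length and the outer one the topmost row of
  that length. Row \<open>l\<close> is meant to be the empty row on top, so for \<open>0 < e\<close>
  there is always a candidate.\<close>

definition slot :: "nat \<Rightarrow> (nat \<Rightarrow> nat) \<Rightarrow> nat \<Rightarrow> nat" where
  "slot l y e = Max {j. j \<le> l \<and> y j = Max (y ` {..l} \<inter> {..<e})}"

text \<open>The letter counts strips from the outermost one; the second component is the row of the
  outermost composition that receives the box. Letter \<open>0\<close> lengthens the outermost
  strip: the threshold one past the longest row makes \<open>slot\<close> choose a longest row. A
  letter that runs past all strips opens a new one on row \<open>l\<close>.\<close>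

fun ins :: "nat \<Rightarrow> (nat \<Rightarrow> nat) list \<Rightarrow> nat \<Rightarrow> (nat \<Rightarrow> nat) list \<times> nat" where
  "ins l [] i = ([add_box (\<lambda>_. 0) l], l)"
| "ins l (y # ys) 0 = (let j = slot l y (Suc (Max (y ` {..l}))) in (add_box y j # ys, j))"
| "ins l (y # ys) (Suc i) =
     (let (zs, j') = ins l ys i; j = slot l y (Suc (top_state ys j')) in (add_box y j # zs, j))"

section \<open>Correctness and invertibility of the insertion of one letter\<close>

lemma length_grow: "i \<le> length \<alpha> \<Longrightarrow> length (grow i \<alpha>) = max (length \<alpha>) (Suc i)"
  by (induction i \<alpha> rule: grow.induct) auto

lemma slot_props:
  assumes "\<forall>r\<ge>l. y r = 0" "0 < e"
  shows "addable l y (slot l y e)" "below y e (slot l y e)"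
proof -
  let ?S = "y ` {..l} \<inter> {..<e}" and ?J = "{j. j \<le> l \<and> y j = Max (y ` {..l} \<inter> {..<e})}"
  have S: "finite ?S" "?S \<noteq> {}" using assms by (auto intro!: exI[of _ 0] image_eqI[of _ _ l])
  then have M: "Max ?S \<in> ?S" by (rule Max_in)
  have J: "finite ?J" "?J \<noteq> {}" using M by auto
  then have s: "slot l y e \<in> ?J" unfolding slot_def by (rule Max_in)
  show "addable l y (slot l y e)" unfolding addable_def
  proof (intro conjI allI impI notI)
    show "slot l y e \<le> l" using s by blast
    fix r assume r: "slot l y e < r \<and> r \<le> l" and "y r = y (slot l y e)"
    then have "r \<in> ?J" using s by auto
    then have "r \<le> slot l y e" unfolding slot_def using J by (intro Max_ge) auto
    then show False using r by simp
  qed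
  have "y (slot l y e) < e" using s M by auto
  moreover have "y r \<le> y (slot l y e)" if "y r < e" for r
  proof (cases "r \<le> l")
    case True
    then have "y r \<in> ?S" using that by auto
    then show ?thesis using s S by (auto intro: Max_ge)
  next
    case False then show ?thesis using assms by simp
  qed
  ultimately show "below y e (slot l y e)" unfolding below_def by blast
qed

text \<open>Identifies \<open>slot\<close> in the inverse direction, where a row is known only by
  these two properties.\<close>

lemma addable_below_unique:
  assumes "addable l y j" "addable l y j'" "below y e j" "below y e j'"
  shows "j = j'"
proof -
  have "y j = y j'" using assms(3,4) unfolding below_def by (meson le_antisym)
  then show ?thesis using assms(1,2) unfolding addable_def by (metis linorder_neqE_nat)
qed

lemma slot_top:
  assumes "\<forall>r\<ge>l. y r = 0"
  shows "below y (Suc (Max (y ` {..l}))) j \<longleftrightarrow> (\<forall>r. y r \<le> y j)"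
proof -
  have *: "y r \<le> Max (y ` {..l})" for r
    using assms by (cases "r \<le> l") auto
  show ?thesis using *[of j] * unfolding below_def by (auto simp: less_Suc_eq_le)
qed

lemma add_box_inj: "add_box x i = add_box x' i \<Longrightarrow> x = x'"
  unfolding add_box_def by (rule ext) (metis fun_upd_apply nat.inject)

lemma sum_add_box:
  assumes "j \<le> l" "\<forall>r\<ge>l. y r = 0"
  shows "(\<Sum>r<max l (Suc j). add_box y j r) = Suc (\<Sum>r<l. y r)"
proof -
  have "(\<Sum>r<max l (Suc j). add_box y j r) = (\<Sum>r<max l (Suc j). y r + (if r = j then 1 else 0))"
    by (intro sum.cong) (auto simp: add_box_def)
  also have "\<dots> = Suc (\<Sum>r<max l (Suc j). y r)" by (simp add: sum.distrib sum.delta)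
  also have "(\<Sum>r<max l (Suc j). y r) = (\<Sum>r<l. y r)"
    by (rule sum.mono_neutral_right) (use assms in auto)
  finally show ?thesis .
qed

lemma strips_length: "strips p \<alpha> ys \<Longrightarrow> length ys = length \<alpha>"
  by (induction p \<alpha> ys rule: strips.induct) auto

lemma strips_support: "strips p \<alpha> ys \<Longrightarrow> 0 < top_state ys r \<longleftrightarrow> p \<le> r \<and> r < p + length \<alpha>"
  by (cases "(p, \<alpha>, ys)" rule: strips.cases) (auto simp: strip_def)

lemma ins_Cons_cases:
  assumes S: "strips p (a # \<alpha>) (y # ys)" and i: "i \<le> length (a # \<alpha>)"
    and I: "ins (p + length (a # \<alpha>)) (y # ys) i = (zs, j)"
  obtains (top) "i = 0" "zs = add_box y j # ys" "addable (Suc p + length \<alpha>) y j" "\<forall>r. y r \<le> y j"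
  | (bump) i' zs' j' where "i = Suc i'" "i' \<le> length \<alpha>" "ins (Suc p + length \<alpha>) ys i' = (zs', j')"
      "zs = add_box y j # zs'" "addable (Suc p + length \<alpha>) y j" "below y (Suc (top_state ys j')) j"
proof -
  let ?l = "Suc p + length \<alpha>"
  have V: "strip p ?l (top_state ys) y" using S by simp
  have out: "\<forall>r\<ge>?l. y r = 0" using V unfolding strip_def by (meson not_gr_zero not_le)
  show thesis
  proof (cases i)
    case 0
    define j' where "j' = slot ?l y (Suc (Max (y ` {..?l})))"
    have eq: "zs = add_box y j # ys" "j = j'" using I 0 by (auto simp: Let_def j'_def)
    have "addable ?l y j" "\<forall>r. y r \<le> y j"
      using slot_props[OF out zero_less_Suc, of "Max (y ` {..?l})"] slot_top[OF out, of j']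
      unfolding eq(2) j'_def by auto
    then show thesis using top 0 eq by blast
  next
    case (Suc i')
    obtain zs' j' where I': "ins ?l ys i' = (zs', j')" by force
    have eq: "zs = add_box y j # zs'" "j = slot ?l y (Suc (top_state ys j'))"
      using I Suc I' by (auto simp: Let_def)
    have "addable ?l y j" "below y (Suc (top_state ys j')) j"
      using slot_props[OF out zero_less_Suc, of "top_state ys j'"] unfolding eq(2) by blast+
    then show thesis using bump[OF Suc _ I'] Suc i eq by auto
  qed
qed

text \<open>The induction runs outwards. The last two conjuncts serve the next bump:
  \<open>p \<le> j\<close> places the new box in a row that the smaller composition may occupy, and
  a new top row appears exactly when a new strip does.\<close>

lemma ins_props:
  assumes "strips p \<alpha> ys" "i \<le> length \<alpha>" "ins (p + length \<alpha>) ys i = (zs, j)"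
  shows "strips p (grow i \<alpha>) zs \<and> top_state zs = add_box (top_state ys) j \<and>
    addable (p + length \<alpha>) (top_state ys) j \<and> p \<le> j \<and> (j = p + length \<alpha> \<longleftrightarrow> i = length \<alpha>)"
  using assms
proof (induction p \<alpha> ys arbitrary: i zs j rule: strips.induct)
  case (1 p ys)
  then show ?case by (auto simp: strip_def add_box_def addable_def)
next
  case (3 p a \<alpha> y ys)
  let ?l = "Suc p + length \<alpha>"
  have V: "strip p ?l (top_state ys) y" using 3 by simp
  have out: "\<forall>r\<ge>?l. y r = 0" using V unfolding strip_def by (meson not_gr_zero not_le)
  have sum: "(\<Sum>r<?l. y r) = (\<Sum>r<?l. top_state ys r) + a" using 3 by simp
  show ?case
  proof (rule ins_Cons_cases[OF 3(2-4)])
    assume 0: "i = 0" "zs = add_box y j # ys" and j: "addable ?l y j" "\<forall>r. y r \<le> y j"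
    have pl: "p < ?l" by simp
    note T = strip_add_box_top[OF V pl j]
    have mx: "max ?l (Suc j) = ?l" "j \<le> ?l" using T(2) by linarith+
    have "0 < y p" using V unfolding strip_def by auto
    then have "0 < y j" using j(2)[rule_format, of p] by linarith
    then have "p \<le> j" using V unfolding strip_def by blast
    moreover have "(\<Sum>r<?l. add_box y j r) = Suc (\<Sum>r<?l. y r)"
      using sum_add_box[OF mx(2) out] unfolding mx(1) .
    ultimately show ?thesis using 0 T 3(2) j sum by (simp del: sum.lessThan_Suc)
  next
    fix i' zs' j'
    assume Suc: "i = Suc i'" "i' \<le> length \<alpha>" and I: "ins ?l ys i' = (zs', j')" and eq: "zs = add_box y j # zs'"
      and j: "addable ?l y j" "below y (Suc (top_state ys j')) j"
    have IH: "strips (Suc p) (grow i' \<alpha>) zs'" "top_state zs' = add_box (top_state ys) j'"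
      "addable ?l (top_state ys) j'" "Suc p \<le> j'" "j' = ?l \<longleftrightarrow> i' = length \<alpha>"
      using 3(1)[of i' zs' j'] 3(2) Suc(2) I by auto
    note T = strip_add_box[OF V IH(4,3) j]
    have jl: "j \<le> ?l" "j' \<le> ?l" using j IH unfolding addable_def by auto
    have outx: "\<forall>r\<ge>?l. top_state ys r = 0" using V unfolding strip_def by (meson not_gr_zero not_le)
    have "p \<le> j"
    proof (rule ccontr)
      assume "\<not> p \<le> j"
      then have "y j = 0" using V unfolding strip_def by (meson not_gr_zero)
      moreover have "y ?l = 0" using out by blast
      moreover have "j < ?l" using \<open>\<not> p \<le> j\<close> by simp
      ultimately show False using j(1) unfolding addable_def by auto
    qed
    have len: "Suc p + length (grow i' \<alpha>) = max ?l (Suc j')" "max ?l (Suc j) = max ?l (Suc j')"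
      using length_grow[of i' \<alpha>] Suc IH(5) T(2) jl by (auto simp: max_def)
    have "(\<Sum>r<max ?l (Suc j'). add_box y j r) = Suc (\<Sum>r<?l. y r)"
      using sum_add_box[of j ?l y] jl out len by simp
    moreover have "(\<Sum>r<max ?l (Suc j'). add_box (top_state ys) j' r) = Suc (\<Sum>r<?l. top_state ys r)"
      using sum_add_box[OF jl(2) outx] .
    ultimately show ?thesis
      using Suc eq IH T j len \<open>p \<le> j\<close> sum by (simp del: sum.lessThan_Suc)
  qed
qed auto

text \<open>The outermost state before and the chain after reveal which clause of \<open>ins\<close>
  acted; \<open>strip_add_box_inj\<close> then recovers the row reached one level further
  in.\<close>

lemma ins_inj:
  assumes "strips p \<alpha> ys" "strips p \<alpha>' ys'" "i \<le> length \<alpha>" "i' \<le> length \<alpha>'"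
    and "ins (p + length \<alpha>) ys i = (zs, j)" "ins (p + length \<alpha>') ys' i' = (zs, j)"
    and "top_state ys = top_state ys'"
  shows "ys = ys' \<and> i = i'"
  using assms
proof (induction p \<alpha> ys arbitrary: \<alpha>' ys' i i' zs j rule: strips.induct)
  case (1 p ys)
  then have "ys = []" by simp
  then have "\<not> (0 < top_state ys' p)" using 1(7) by (metis top_state.simps(1) less_irrefl)
  then have "\<alpha>' = []" using strips_support[OF 1(2), of p] by auto
  then show ?case using 1 by auto
next
  case (3 p a \<alpha> y ys)
  have "0 < y p" using strips_support[OF 3(2), of p] by simp
  then have "0 < top_state ys' p" using 3(8) by simp
  then obtain b \<beta> y' xs where eq: "\<alpha>' = b # \<beta>" "ys' = y' # xs"
    using 3(3) by (cases \<alpha>'; cases ys') auto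
  have yy: "y' = y" using 3(8) eq by simp
  have s: "0 < y r \<longleftrightarrow> p \<le> r \<and> r < Suc p + length \<alpha>" "0 < y r \<longleftrightarrow> p \<le> r \<and> r < Suc p + length \<beta>" for r
    using strips_support[OF 3(2), of r] strips_support[OF 3(3), of r] eq yy by auto
  have len: "length \<beta> = length \<alpha>"
    using s[of "Suc p + length \<alpha>"] s[of "Suc p + length \<beta>"] by auto
  let ?l = "Suc p + length \<alpha>"
  have V: "strip p ?l (top_state ys) y" "strip p ?l (top_state xs) y"
    using 3(2,3) eq yy len by auto
  have S: "strips (Suc p) \<alpha> ys" "strips (Suc p) \<beta> xs" using 3(2,3) eq by auto
  \<comment> \<open>Letter \<open>0\<close> and a bump cannot give the same result: a bump from
    column \<open>w r + 1\<close> under the same strip means that row \<open>r\<close> of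
    \<open>y\<close> reaches that column, so a row chosen below it is not a longest one.\<close>
  have max_contr: "\<not> (\<forall>r. y r \<le> y k)"
    if "x = add_box w r" "below y (Suc (w r)) k" "strip p ?l x y" for w r k x
  proof
    assume m: "\<forall>r. y r \<le> y k"
    have "Suc (w r) \<le> y r" using that(1,3) unfolding strip_def add_box_def by (metis fun_upd_same)
    then show False using m[rule_format, of r] that(2) unfolding below_def by auto
  qed
  note C = ins_Cons_cases[OF 3(2,4,6)] and C' = ins_Cons_cases[OF 3(3)[unfolded eq yy] 3(5)[unfolded eq] 3(7)[unfolded eq yy]]
  show ?case
  proof (rule C)
    assume A: "i = 0" "zs = add_box y j # ys" "\<forall>r. y r \<le> y j"
    show ?case
    proof (rule C')
      assume "i' = 0" "zs = add_box y j # xs"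
      then show ?case using A eq yy by simp
    next
      fix k zs' j' assume B: "k \<le> length \<beta>" "ins (Suc p + length \<beta>) xs k = (zs', j')"
         "zs = add_box y j # zs'" "below y (Suc (top_state xs j')) j"
      have "top_state ys = add_box (top_state xs) j'"
        using ins_props[OF S(2) B(1,2)] A(2) B(3) by simp
      then show ?case using max_contr[where w = "top_state xs" and r = j' and k = j and x = "top_state ys"] B(4) V(1) A(3) by blast
    qed
  next
    fix k zs' j' assume A: "i = Suc k" "k \<le> length \<alpha>" "ins ?l ys k = (zs', j')"
         "zs = add_box y j # zs'" "below y (Suc (top_state ys j')) j"
    note P = ins_props[OF S(1) A(2,3)]
    show ?case
    proof (rule C')
      assume B: "i' = 0" "zs = add_box y j # xs" "\<forall>r. y r \<le> y j"
      have "top_state xs = add_box (top_state ys) j'" using P A(4) B(2) by simp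
      then show ?case using max_contr[where w = "top_state ys" and r = j' and k = j and x = "top_state xs"] A(5) V(2) B(3) by blast
    next
      fix k2 zs2 j2 assume B: "i' = Suc k2" "k2 \<le> length \<beta>" "ins (Suc p + length \<beta>) xs k2 = (zs2, j2)"
         "zs = add_box y j # zs2" "below y (Suc (top_state xs j2)) j"
      have z: "zs2 = zs'" using A(4) B(4) by simp
      note P2 = ins_props[OF S(2) B(2,3)]
      have e: "add_box (top_state ys) j' = add_box (top_state xs) j2" using P P2 z by simp
      have "j' = j2"
        using strip_add_box_inj[OF V _ _ A(5) B(5) e] P P2 len by simp
      moreover from this have "top_state ys = top_state xs" using add_box_inj e by blast
      ultimately have "ys = xs \<and> k = k2"
        using 3(1)[OF S A(2) B(2) A(3), of] B(3) z by simp
      then show ?case using A(1) B(1) eq yy by simp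
    qed
  qed
qed auto

text \<open>Peels strips from the outside. At each level the box either came from lengthening this
  strip or, by \<open>strip_remove_box\<close>, from a box of the next smaller composition, to which
  the induction hypothesis applies.\<close>

lemma ins_surj:
  assumes "strips p \<alpha>' zs" "top_state zs = add_box y j" "addable l y j"
    and "\<forall>r. 0 < y r \<longleftrightarrow> p \<le> r \<and> r < l" "p \<le> l" "p + length \<alpha>' = max l (Suc j)"
  shows "\<exists>\<alpha> ys i. strips p \<alpha> ys \<and> i \<le> length \<alpha> \<and> p + length \<alpha> = l \<and> \<alpha>' = grow i \<alpha> \<and>
    top_state ys = y \<and> ins l ys i = (zs, j)"
  using assms
proof (induction p \<alpha>' zs arbitrary: y j l rule: strips.induct)
  case (1 p ys)
  then have "add_box y j j = 0" by (metis strips.simps(1) top_state.simps(1))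
  then show ?case by (simp add: add_box_def)
next
  case (3 p a \<alpha>' z zs)
  let ?l = "Suc p + length \<alpha>'"
  have z: "z = add_box y j" using 3(3) by simp
  have l: "?l = max l (Suc j)" using 3(7) by simp
  have V: "strip p ?l (top_state zs) z" and S: "strips (Suc p) \<alpha>' zs"
    and sum: "(\<Sum>r<?l. z r) = (\<Sum>r<?l. top_state zs r) + a" using 3(2) by auto
  have jl: "j \<le> l" using 3(4) unfolding addable_def by blast
  have out: "\<forall>r\<ge>l. y r = 0" using 3(5) by (meson not_gr_zero not_le)
  have sumz: "(\<Sum>r<?l. z r) = Suc (\<Sum>r<l. y r)" using sum_add_box[OF jl out] z l by simp
  show ?case
  proof (cases "p = l")
    case True
    \<comment> \<open>The old chain is empty, and the only strip consists of the one new
      box.\<close>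
    then have y0: "y = (\<lambda>_. 0)" using 3(5) by (intro ext) (meson not_gr_zero not_le)
    then have "j = l" using 3(4) jl unfolding addable_def by (cases "j = l") auto
    then have "length \<alpha>' = 0" using l True by simp
    then have e: "\<alpha>' = []" "zs = []" using S by auto
    have "a = 1" using sum sumz e y0 by simp
    then show ?thesis using e y0 \<open>j = l\<close> True z by (intro exI[of _ "[]"] exI[of _ 0]) simp
  next
    case False
    then have pl: "p < l" using 3(6) by simp
    show ?thesis
    proof (cases "(\<forall>r. y r \<le> y j) \<and> ?l = l \<and> strip p l (top_state zs) y")
      case True
      define b where "b = a - 1"
      \<comment> \<open>Row \<open>p\<close> is empty in the smaller composition but not in
        \<open>y\<close>, so the shortened strip is nonempty and the subtraction
        \<open>a - 1\<close> does not truncate.\<close>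
      have "(\<Sum>r<?l. y r) = (\<Sum>r<?l. top_state zs r) + (a - 1) \<and> 0 < a"
      proof -
        have "(\<Sum>r<?l. top_state zs r) < (\<Sum>r<?l. y r)"
        proof (rule sum_strict_mono_ex1)
          show "\<forall>r\<in>{..<?l}. top_state zs r \<le> y r" using True unfolding strip_def by blast
          have "top_state zs p < y p" using conjunct2[OF conjunct2[OF True]] pl unfolding strip_def
            by (metis Suc_n_not_le_n le_refl not_gr_zero)
          then show "\<exists>r\<in>{..<?l}. top_state zs r < y r" by auto
        qed simp
        moreover have "?l = l" using True by blast
        then have "(\<Sum>r<?l. z r) = Suc (\<Sum>r<?l. y r)" using sumz by metis
        ultimately show ?thesis using sum by linarith
      qed
      then have ys: "strips p (b # \<alpha>') (y # zs)" "grow 0 (b # \<alpha>') = a # \<alpha>'"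
        using S True by (auto simp: b_def simp del: sum.lessThan_Suc)
      have "slot l y (Suc (Max (y ` {..l}))) = j"
        using slot_props[OF out zero_less_Suc, of "Max (y ` {..l})"] 3(4) slot_top[OF out, of j] True
        by (meson addable_below_unique)
      then have "ins l (y # zs) 0 = (z # zs, j)" by (simp add: z)
      then show ?thesis using ys True by (intro exI[of _ "b # \<alpha>'"] exI[of _ "y # zs"] exI[of _ 0]) auto
    next
      case False
      obtain i x0 where X: "Suc p \<le> i" "addable l x0 i" "top_state zs = add_box x0 i" "strip p l x0 y"
        "below y (Suc (x0 i)) j" "?l = max l (Suc i)"
        using strip_remove_box[OF V 3(4) z 3(5) l pl False] by metis
      have "\<forall>r. 0 < x0 r \<longleftrightarrow> Suc p \<le> r \<and> r < l" using X(4) unfolding strip_def by blast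
      from 3(1)[OF S X(3,2) this _ X(6)] pl obtain \<alpha> ys k where
        IH: "strips (Suc p) \<alpha> ys" "k \<le> length \<alpha>" "Suc p + length \<alpha> = l" "\<alpha>' = grow k \<alpha>"
          "top_state ys = x0" "ins l ys k = (zs, i)" by auto
      have "slot l y (Suc (x0 i)) = j"
        using slot_props[OF out zero_less_Suc, of "x0 i"] 3(4) X(5) by (meson addable_below_unique)
      then have I: "ins l (y # ys) (Suc k) = (z # zs, j)" using IH by (simp add: z)
      have il: "i \<le> l" using X(2) unfolding addable_def by blast
      have "\<forall>r\<ge>l. x0 r = 0" using X(4) unfolding strip_def by (meson not_gr_zero not_le)
      then have "(\<Sum>r<?l. top_state zs r) = Suc (\<Sum>r<l. x0 r)"
        using sum_add_box[OF il] X(3,6) by simp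
      then have "(\<Sum>r<l. y r) = (\<Sum>r<l. x0 r) + a" using sum sumz by simp
      then have "strips p (a # \<alpha>) (y # ys)" using IH X(4) by (simp del: sum.lessThan_Suc)
      then show ?thesis using I IH
        by (intro exI[of _ "a # \<alpha>"] exI[of _ "y # ys"] exI[of _ "Suc k"]) auto
    qed
  qed
qed auto

text \<open>If one of the letters is \<open>0\<close>, the outermost strip decides, because letter
  \<open>0\<close> extends a longest row and a bump never lands right of the column it starts from.
  If both are positive, \<open>column_less_iff\<close> passes the comparison to the next
  strip.\<close>

lemma ins_descent:
  assumes "strips p \<alpha> ys" "i \<le> length \<alpha>" "ins (p + length \<alpha>) ys i = (zs, j)"
    and "i' \<le> length (grow i \<alpha>)" "ins (p + length (grow i \<alpha>)) zs i' = (zs', j')"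
  shows "top_state zs j' \<le> top_state ys j \<longleftrightarrow> i < i'"
  using assms
proof (induction p \<alpha> ys arbitrary: i zs j i' zs' j' rule: strips.induct)
  case (1 p ys)
  then have e: "i = 0" "ys = []" "zs = [add_box (\<lambda>_. 0) p]" "j = p" by auto
  have S: "strips p [1] zs" using ins_props[OF 1(1-3)] e by simp
  have I: "ins (p + length [1]) zs i' = (zs', j')" and i': "i' \<le> length [1]" using 1(4,5) e by auto
  show ?case
  proof (rule ins_Cons_cases[OF S[unfolded e(3)] i' I[unfolded e(3)]])
    assume "i' = 0" "\<forall>r. add_box (\<lambda>_. 0) p r \<le> add_box (\<lambda>_. 0) p j'"
    then show ?case using e by (metis add_box_def fun_upd_same le_zero_eq less_nat_zero_code not_less_eq_eq top_state.simps zero_le)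
  next
    fix k zs'' k' assume "i' = Suc k" "below (add_box (\<lambda>_. 0) p) (Suc (top_state [] k')) j'"
    then show ?case using e by (simp add: below_def)
  qed
next
  case (3 p a \<alpha> y ys)
  let ?l = "Suc p + length \<alpha>"
  have V: "strip p ?l (top_state ys) y" and S: "strips (Suc p) \<alpha> ys" using 3(2) by auto
  have xy: "top_state ys r \<le> y r" for r using V unfolding strip_def by blast
  have S': "strips p (grow i (a # \<alpha>)) zs" "top_state zs = add_box y j"
    using ins_props[OF 3(2-4)] by auto
  obtain b \<beta> where g: "grow i (a # \<alpha>) = b # \<beta>" by (cases i) auto
  show ?case
  proof (rule ins_Cons_cases[OF 3(2-4)])
    assume A: "i = 0" "zs = add_box y j # ys" "\<forall>r. y r \<le> y j"
    show ?case
    proof (rule ins_Cons_cases[OF S'(1)[unfolded g A(2)] 3(5)[unfolded g] 3(6)[unfolded g A(2)]])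
      assume "i' = 0" "\<forall>r. add_box y j r \<le> add_box y j j'"
      then show ?case using A by (metis add_box_def fun_upd_same not_less_eq_eq order_less_irrefl top_state.simps(2))
    next
      fix k zs'' k' assume "i' = Suc k" "below (add_box y j) (Suc (top_state ys k')) j'"
      then have "add_box y j j' \<le> top_state ys k'" "i' = Suc k" by (auto simp: below_def)
      then show ?case using A xy[of k'] le_trans by fastforce
    qed
  next
    fix k zs1 j1 assume A: "i = Suc k" "k \<le> length \<alpha>" "ins ?l ys k = (zs1, j1)"
      "zs = add_box y j # zs1" "below y (Suc (top_state ys j1)) j"
    have \<beta>: "\<beta> = grow k \<alpha>" using g A(1) by simp
    show ?case
    proof (rule ins_Cons_cases[OF S'(1)[unfolded g A(4)] 3(5)[unfolded g] 3(6)[unfolded g A(4)]])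
      assume "i' = 0" "\<forall>r. add_box y j r \<le> add_box y j j'"
      then show ?case using A by (metis add_box_def fun_upd_same not_less_eq_eq not_less0 top_state.simps(2))
    next
      fix k2 zs2 j2 assume B: "i' = Suc k2" "k2 \<le> length \<beta>" "ins (Suc p + length \<beta>) zs1 k2 = (zs2, j2)"
        "below (add_box y j) (Suc (top_state zs1 j2)) j'"
      have IH: "top_state zs1 j2 \<le> top_state ys j1 \<longleftrightarrow> k < k2"
        using 3(1)[OF S A(2,3)] B(2,3) \<beta> by blast
      have z: "top_state zs1 = add_box (top_state ys) j1"
        using ins_props[OF S A(2,3)] by blast
      have "add_box y j j' \<le> y j \<longleftrightarrow> add_box (top_state ys) j1 j2 \<le> top_state ys j1"
        by (rule column_less_iff[OF V A(5)]) (use B(4) z in simp)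
      then show ?case using IH z A B by simp
    qed
  qed
qed auto

section \<open>Insertion of words\<close>

text \<open>For a content function this is the peak condition and the absence of gaps at once: a
  nonempty row has a row of length at least two directly below it.\<close>

definition peak_fun :: "(nat \<Rightarrow> nat) \<Rightarrow> bool" where
  "peak_fun f \<longleftrightarrow> (\<forall>r. 0 < f (Suc r) \<longrightarrow> 1 < f r)"

definition peak_word :: "nat list \<Rightarrow> bool" where
  "peak_word v \<longleftrightarrow> (\<forall>k\<le>length v. peak_fun (count_list (take k v)))"

text \<open>The fourth condition on standard peak Young composition tableaux, read at the moment a
  box is added: the row that grows is the topmost one of its length, where empty rows above it do
  not count.\<close>

definition young_word :: "nat list \<Rightarrow> bool" where
  "young_word v \<longleftrightarrow> (\<forall>k<length v. \<forall>r>v ! k.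
     0 < count_list (take k v) r \<longrightarrow> count_list (take k v) r \<noteq> count_list (take k v) (v ! k))"

definition word_col :: "nat list \<Rightarrow> nat \<Rightarrow> nat" where
  "word_col v k = count_list (take (Suc k) v) (v ! k)"

text \<open>The content of a peak word as a list. Peak words never skip a row, so for them
  \<open>grow\<close> only meets indices up to the current length.\<close>

definition shape :: "nat list \<Rightarrow> nat list" where
  "shape v = fold grow v []"

lemma shape_simps [simp]: "shape [] = []" "shape (v @ [i]) = grow i (shape v)"
  by (auto simp: shape_def)

lemma grow_positive: "0 \<notin> set \<alpha> \<Longrightarrow> 0 \<notin> set (grow i \<alpha>)"
  by (induction i \<alpha> rule: grow.induct) auto

lemma shape_positive: "0 \<notin> set (shape v)"
  by (induction v rule: rev_induct) (auto dest: grow_positive)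

lemma nth_default_grow: "i \<le> length \<alpha> \<Longrightarrow> nth_default 0 (grow i \<alpha>) = add_box (nth_default 0 \<alpha>) i"
proof (induction i \<alpha> rule: grow.induct)
  case (1 i) then show ?case by (auto simp: add_box_def nth_default_def fun_eq_iff)
next
  case (2 a \<alpha>) then show ?case by (auto simp: add_box_def fun_eq_iff nth_default_Cons split: nat.splits)
next
  case (3 i a \<alpha>)
  have "nth_default 0 (a # grow i \<alpha>) r = add_box (nth_default 0 (a # \<alpha>)) (Suc i) r" for r
    using fun_cong[OF 3(1)] 3(2) by (cases r) (auto simp: add_box_def nth_default_Cons)
  then show ?case by auto
qed

lemma nth_default_pos_iff:
  fixes \<alpha> :: "nat list"
  shows "0 \<notin> set \<alpha> \<Longrightarrow> 0 < nth_default 0 \<alpha> r \<longleftrightarrow> r < length \<alpha>"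
  by (auto simp: nth_default_def in_set_conv_nth)

lemma nth_default_inj:
  fixes \<alpha> :: "nat list"
  assumes "0 \<notin> set \<alpha>" "0 \<notin> set \<beta>" "nth_default 0 \<alpha> = nth_default 0 \<beta>"
  shows "\<alpha> = \<beta>"
proof (rule nth_equalityI)
  show len: "length \<alpha> = length \<beta>"
    using nth_default_pos_iff[OF assms(1)] nth_default_pos_iff[OF assms(2)] assms(3)
    by (metis linorder_neqE_nat order_less_irrefl)
  show "\<alpha> ! i = \<beta> ! i" if "i < length \<alpha>" for i
    using fun_cong[OF assms(3), of i] that len by (simp add: nth_default_def)
qed

lemma count_list_snoc: "count_list (v @ [i]) = add_box (count_list v) i"
  by (auto simp: add_box_def fun_eq_iff)

lemma peak_word_Nil [simp]: "peak_word []"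
  by (simp add: peak_word_def peak_fun_def)

lemma peak_word_snoc: "peak_word (v @ [i]) \<longleftrightarrow> peak_word v \<and> peak_fun (count_list (v @ [i]))"
  unfolding peak_word_def by (auto simp: le_Suc_eq)

lemma young_word_snoc: "young_word (v @ [i]) \<longleftrightarrow> young_word v \<and>
   (\<forall>r>i. 0 < count_list v r \<longrightarrow> count_list v r \<noteq> count_list v i)"
  unfolding young_word_def by (auto simp: less_Suc_eq nth_append)

lemma word_col_snoc: "k < length v \<Longrightarrow> word_col (v @ [i]) k = word_col v k"
  "word_col (v @ [i]) (length v) = Suc (count_list v i)"
  by (auto simp: word_col_def nth_append)

lemma peak_fun_support:
  assumes "peak_fun (add_box f i)" "\<And>r. 0 < f r \<longleftrightarrow> r < l"
  shows "i \<le> l"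
proof (rule ccontr)
  assume "\<not> i \<le> l"
  then obtain r where r: "i = Suc r" "l \<le> r" by (cases i) auto
  then have "1 < add_box f i r" using assms(1)[unfolded peak_fun_def, rule_format, of r] by (simp add: add_box_def)
  then show False using assms(2)[of r] r by (auto simp: add_box_def)
qed

lemma count_list_shape: "peak_word v \<Longrightarrow> count_list v = nth_default 0 (shape v)"
proof (induction v rule: rev_induct)
  case Nil then show ?case by (auto simp: nth_default_def)
next
  case (snoc i v)
  then have IH: "count_list v = nth_default 0 (shape v)" and p: "peak_fun (add_box (count_list v) i)"
    by (auto simp: peak_word_snoc count_list_snoc)
  have "i \<le> length (shape v)"
    by (rule peak_fun_support[OF p]) (simp add: IH nth_default_pos_iff shape_positive)
  then show ?case by (simp add: count_list_snoc IH nth_default_grow del: count_list_append)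
qed

lemma peak_word_snoc_le: "peak_word (v @ [i]) \<Longrightarrow> i \<le> length (shape v)"
  by (rule peak_fun_support[of "count_list v"])
    (auto simp: peak_word_snoc count_list_snoc count_list_shape nth_default_pos_iff shape_positive simp del: count_list_append)

text \<open>Column 2 occurs at most once in a strip, so a strip creates at most one row of length at
  least two. A strip that does so also contains the first box of its new row \<open>p\<close>, hence
  has at least two boxes.\<close>

lemma strips_twos:
  "strips p \<alpha> ys \<Longrightarrow> card {r. 1 < top_state ys r} \<le> card {i. i < length \<alpha> \<and> 1 < \<alpha> ! i}"
proof (induction p \<alpha> ys rule: strips.induct)
  case (3 p a \<alpha> y ys)
  let ?l = "Suc p + length \<alpha>" and ?x = "top_state ys"
  have V: "strip p ?l ?x y" and sum: "(\<Sum>r<?l. y r) = (\<Sum>r<?l. ?x r) + a"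
    and IH: "card {r. 1 < ?x r} \<le> card {i. i < length \<alpha> \<and> 1 < \<alpha> ! i}" using 3 by auto
  have le: "?x r \<le> y r" for r using V unfolding strip_def by blast
  have fin: "finite {r. 1 < ?x r}"
    by (rule finite_subset[of _ "{..<?l}"]) (use V in \<open>auto simp: strip_def\<close>)
  have u: "r = r'" if "\<not> 1 < ?x r" "1 < y r" "\<not> 1 < ?x r'" "1 < y r'" for r r'
    using strip_distinct_columns[OF V, of r 2 r'] that by simp
  have eq: "{i. i < length (a # \<alpha>) \<and> 1 < (a # \<alpha>) ! i} =
      (if 1 < a then {0} else {}) \<union> Suc ` {i. i < length \<alpha> \<and> 1 < \<alpha> ! i}"
    by (auto simp: less_Suc_eq_0_disj)
  have card: "card {i. i < length (a # \<alpha>) \<and> 1 < (a # \<alpha>) ! i} =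
      (if 1 < a then 1 else 0) + card {i. i < length \<alpha> \<and> 1 < \<alpha> ! i}"
    unfolding eq by (subst card_Un_disjoint) (auto simp: card_image)
  show ?case
  proof (cases "\<exists>r0. \<not> 1 < ?x r0 \<and> 1 < y r0")
    case True
    then obtain r0 where r0: "\<not> 1 < ?x r0" "1 < y r0" by blast
    have sub: "{r. 1 < y r} \<subseteq> insert r0 {r. 1 < ?x r}" using u[OF _ _ r0] by blast
    have "card {r. 1 < y r} \<le> Suc (card {r. 1 < ?x r})"
      using card_mono[OF _ sub] fin card_insert_le_m1[of "Suc (card {r. 1 < ?x r})" "{r. 1 < ?x r}" r0]
      by simp
    moreover have "1 < a"
    proof -
      have yp: "0 < y p" "\<not> 0 < ?x p" "0 < y r0" using V r0 unfolding strip_def by auto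
      have r0l: "r0 < ?l" "p < ?l" using V r0 yp unfolding strip_def by auto
      show ?thesis
      \<comment> \<open>The box in column 2 lies either in row \<open>p\<close>, which then gains
        two boxes, or in another row, in addition to the first box of row \<open>p\<close>.\<close>
      proof (cases "r0 = p")
        case True
        have "(\<Sum>r<?l. ?x r + (if r = p then 2 else 0)) \<le> (\<Sum>r<?l. y r)"
          using le yp r0 True by (intro sum_mono) auto
        then show ?thesis using sum r0l by (simp add: sum.distrib del: sum.lessThan_Suc)
      next
        case False
        have "(\<Sum>r<?l. ?x r + ((if r = p then 1 else 0) + (if r = r0 then 1 else 0))) \<le> (\<Sum>r<?l. y r)"
          using le yp r0 False by (intro sum_mono) (auto simp: Suc_le_eq)
        then show ?thesis using sum r0l by (simp add: sum.distrib del: sum.lessThan_Suc)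
      qed
    qed
    ultimately show ?thesis using IH card by simp
  next
    case False
    then have "{r. 1 < y r} \<subseteq> {r. 1 < ?x r}" by blast
    then have "card {r. 1 < y r} \<le> card {r. 1 < ?x r}" using fin by (rule card_mono[rotated])
    then show ?thesis using IH card by simp
  qed
qed auto

text \<open>The innermost strip is a single row, the topmost of the final composition, and later
  strips only lengthen it.\<close>

lemma strips_last:
  "strips p \<alpha> ys \<Longrightarrow> \<alpha> \<noteq> [] \<Longrightarrow> last \<alpha> \<le> top_state ys (p + length \<alpha> - 1)"
proof (induction p \<alpha> ys rule: strips.induct)
  case (3 p a \<alpha> y ys)
  show ?case
  proof (cases "\<alpha> = []")
    case True
    have "y r = 0" if "r < p" for r using 3(2) that unfolding strips.simps strip_def by (meson not_gr_zero not_le)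
    then have "(\<Sum>r<p. y r) = 0" by simp
    then show ?thesis using 3 True by auto
  next
    case False
    then have "last \<alpha> \<le> top_state ys (Suc p + length \<alpha> - 1)" using 3 by auto
    also have "\<dots> \<le> y (Suc p + length \<alpha> - 1)" using 3(2) unfolding strips.simps strip_def by blast
    finally show ?thesis using False by simp
  qed
qed auto

text \<open>Call a row or strip large if its size is at least two. A part of size 1 before the end
  leaves at most \<open>length \<alpha> - 1\<close> large strips, while the peak condition gives at
  least as many large rows. By \<open>strips_twos\<close> equality holds, so the last part is large;
  by \<open>strips_last\<close> the top row is then large too, which is one large row too
  many.\<close>

lemma strips_peak_fun:
  assumes S: "strips 0 \<alpha> ys" and P: "peak_fun (top_state ys)"
  shows "peak_fun (nth_default 0 \<alpha>)"
proof -
  have sup: "0 < top_state ys r \<longleftrightarrow> r < length \<alpha>" for r using strips_support[OF S, of r] by simp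
  let ?A = "{i. i < length \<alpha> \<and> 1 < \<alpha> ! i}"
  have "1 < \<alpha> ! i" if i: "Suc i < length \<alpha>" for i
  proof (rule ccontr)
    assume i1: "\<not> 1 < \<alpha> ! i"
    have sub: "?A \<subseteq> {..<length \<alpha>} - {i}" using i1 by auto
    then have cA: "card ?A \<le> length \<alpha> - 1" using i card_mono[OF _ sub] by simp
    have sub2: "{..<length \<alpha> - 1} \<subseteq> {r. 1 < top_state ys r}" using P sup unfolding peak_fun_def by auto
    have fin: "finite {r. 1 < top_state ys r}"
      by (rule finite_subset[of _ "{..<length \<alpha>}"]) (use sup less_trans in fastforce)+
    have c2: "length \<alpha> - 1 \<le> card {r. 1 < top_state ys r}" using card_mono[OF fin sub2] by simp
    have "card ?A = card ({..<length \<alpha>} - {i})" using cA c2 strips_twos[OF S] i by simp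
    then have "?A = {..<length \<alpha>} - {i}" using card_subset_eq[OF _ sub] by simp
    moreover have "length \<alpha> - 1 \<in> {..<length \<alpha>} - {i}" using i by auto
    ultimately have "length \<alpha> - 1 \<in> ?A" by blast
    then have "1 < last \<alpha>" using i last_conv_nth[of \<alpha>] by force
    then have "1 < top_state ys (length \<alpha> - 1)" using strips_last[OF S] i by (cases "\<alpha> = []") auto
    then have "{..<length \<alpha>} \<subseteq> {r. 1 < top_state ys r}"
    proof -
      have "{..<length \<alpha>} = insert (length \<alpha> - 1) {..<length \<alpha> - 1}" using i by auto
      then show ?thesis using sub2 \<open>1 < top_state ys (length \<alpha> - 1)\<close> by auto
    qed
    from card_mono[OF fin this] have "length \<alpha> \<le> card {r. 1 < top_state ys r}" by simp
    then show False using cA strips_twos[OF S] i by simp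
  qed
  then show ?thesis unfolding peak_fun_def nth_default_def by auto
qed

text \<open>The peak condition is at risk only when a new top row appears. Then \<open>grow\<close>
  appended a part to \<open>\<alpha>\<close>, so the former last part exceeds 1, and by
  \<open>strips_last\<close> so does the former top row.\<close>

lemma ins_peak_fun:
  assumes S: "strips 0 \<alpha> ys" "i \<le> length \<alpha>" "ins (length \<alpha>) ys i = (zs, j)"
    and P: "peak_fun (top_state ys)" "peak_fun (nth_default 0 (grow i \<alpha>))"
  shows "peak_fun (top_state zs)"
  unfolding peak_fun_def
proof (intro allI impI)
  fix r assume r: "0 < top_state zs (Suc r)"
  have I: "top_state zs = add_box (top_state ys) j" "j = length \<alpha> \<longleftrightarrow> i = length \<alpha>" "j \<le> length \<alpha>"
    using ins_props[of 0 \<alpha> ys i zs j] S by (auto simp: addable_def)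
  show "1 < top_state zs r"
  proof (cases "0 < top_state ys (Suc r)")
    case True
    then have "1 < top_state ys r" using P unfolding peak_fun_def by blast
    then show ?thesis using I by (auto simp: add_box_def)
  next
    case False
    then have "Suc r = j" using r I by (auto simp: add_box_def split: if_splits)
    moreover from this have "j = length \<alpha>" using False strips_support[OF S(1), of j] I by auto
    ultimately have "i = Suc r" "length \<alpha> = Suc r" using I by auto
    then have "1 < nth_default 0 (grow i \<alpha>) r"
      using P(2)[unfolded peak_fun_def nth_default_grow[OF S(2)], rule_format, of r] nth_default_grow[OF S(2)]
      by (simp add: add_box_def)
    then have "1 < nth_default 0 \<alpha> r"
      unfolding nth_default_grow[OF S(2)] using \<open>i = Suc r\<close> by (simp add: add_box_def)
    then have "1 < \<alpha> ! r" using \<open>length \<alpha> = Suc r\<close> by (simp add: nth_default_def)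
    moreover have "\<alpha> ! r = last \<alpha>" using \<open>length \<alpha> = Suc r\<close> by (cases \<alpha> rule: rev_cases) auto
    ultimately have "1 < top_state ys r" using strips_last[OF S(1)] \<open>length \<alpha> = Suc r\<close> by (cases "\<alpha> = []") auto
    then show ?thesis using I by (auto simp: add_box_def)
  qed
qed

text \<open>Each strip brings one new row, so \<open>length ys\<close> is the current number of
  rows, as \<open>ins\<close> expects. The first component records the rows in which the outermost
  composition grows.\<close>

definition insert_word :: "nat list \<Rightarrow> nat list \<times> (nat \<Rightarrow> nat) list" where
  "insert_word v = fold (\<lambda>i (t, ys). let (zs, j) = ins (length ys) ys i in (t @ [j], zs)) v ([], [])"

lemma insert_word_simps:
  "insert_word [] = ([], [])"
  "insert_word (v @ [i]) = (let (t, ys) = insert_word v; (zs, j) = ins (length ys) ys i in (t @ [j], zs))"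
  by (auto simp: insert_word_def split_beta)

text \<open>The target of the bijection: a tableau word and a chain that end in the same
  composition.\<close>

definition recording_pairs :: "nat list \<Rightarrow> (nat list \<times> (nat \<Rightarrow> nat) list) set" where
  "recording_pairs \<alpha> =
     {(t, ys). peak_word t \<and> young_word t \<and> strips 0 \<alpha> ys \<and> top_state ys = count_list t}"

lemma recording_pairs_snoc:
  assumes "(t, ys) \<in> recording_pairs \<alpha>" "i \<le> length \<alpha>" "ins (length \<alpha>) ys i = (zs, j)"
    "peak_fun (nth_default 0 (grow i \<alpha>))"
  shows "(t @ [j], zs) \<in> recording_pairs (grow i \<alpha>)"
proof -
  have t: "peak_word t" "young_word t" "strips 0 \<alpha> ys" "top_state ys = count_list t"
    using assms(1) by (auto simp: recording_pairs_def)
  have I: "strips 0 (grow i \<alpha>) zs" "top_state zs = add_box (top_state ys) j" "addable (length \<alpha>) (top_state ys) j"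
    using ins_props[OF t(3) assms(2)] assms(3) by auto
  have "peak_fun (top_state zs)"
    using ins_peak_fun[OF t(3) assms(2,3) _ assms(4)] t(1,4) unfolding peak_word_def by auto
  moreover have "top_state zs = count_list (t @ [j])" using I t by (simp add: count_list_snoc del: count_list_append)
  moreover have "\<forall>r>j. 0 < count_list t r \<longrightarrow> count_list t r \<noteq> count_list t j"
  proof (intro allI impI)
    fix r assume "j < r" "0 < count_list t r"
    moreover from this have "r \<le> length \<alpha>" using strips_support[OF t(3), of r] t(4) by simp
    ultimately show "count_list t r \<noteq> count_list t j" using I(3) t(4) unfolding addable_def by auto
  qed
  ultimately show ?thesis
    unfolding recording_pairs_def using t I by (simp add: peak_word_snoc young_word_snoc del: count_list_append)
qed

lemma insert_word_recording: "peak_word v \<Longrightarrow> insert_word v \<in> recording_pairs (shape v)"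
proof (induction v rule: rev_induct)
  case Nil
  then show ?case by (auto simp: insert_word_simps recording_pairs_def young_word_def)
next
  case (snoc i v)
  obtain t ys where r: "insert_word v = (t, ys)" by force
  obtain zs j where I: "ins (length ys) ys i = (zs, j)" by force
  have v: "peak_word v" using snoc by (simp add: peak_word_snoc)
  then have R: "(t, ys) \<in> recording_pairs (shape v)" using snoc r by simp
  then have len: "length ys = length (shape v)" by (auto simp: recording_pairs_def strips_length)
  have "peak_fun (nth_default 0 (shape (v @ [i])))"
    using snoc(2) count_list_shape[OF snoc(2)] by (simp add: peak_word_snoc del: shape_simps count_list_append)
  then show ?case
    using recording_pairs_snoc[OF R peak_word_snoc_le[OF snoc(2)]] I len r by (simp add: insert_word_simps)
qed

lemma length_insert_word: "length (fst (insert_word v)) = length v"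
  by (induction v rule: rev_induct) (auto simp: insert_word_simps split_beta Let_def)

text \<open>The recorded word without its last letter has the outermost state before the last step
  as content, so \<open>ins_inj\<close> undoes one letter at a time.\<close>

lemma insert_word_inj: "peak_word v \<Longrightarrow> peak_word v' \<Longrightarrow> insert_word v = insert_word v' \<Longrightarrow> v = v'"
proof (induction v arbitrary: v' rule: rev_induct)
  case Nil
  then have "fst (insert_word v') = []" by (metis fst_conv insert_word_simps(1))
  then show ?case using length_insert_word[of v'] by simp
next
  case (snoc i v)
  have "length v' = length (v @ [i])" using snoc(4) length_insert_word by metis
  then obtain w i' where v': "v' = w @ [i']" by (cases v' rule: rev_cases) auto
  obtain t ys where r: "insert_word v = (t, ys)" by force
  obtain zs j where I: "ins (length ys) ys i = (zs, j)" by force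
  obtain t' ys' where r': "insert_word w = (t', ys')" by force
  obtain zs' j' where I': "ins (length ys') ys' i' = (zs', j')" by force
  have eq: "t = t'" "j = j'" "zs = zs'"
    using snoc(4) v' r r' I I' by (auto simp: insert_word_simps)
  have p: "peak_word v" "peak_word w" using snoc v' by (auto simp: peak_word_snoc)
  have R: "strips 0 (shape v) ys" "strips 0 (shape w) ys'" "top_state ys = top_state ys'"
    using insert_word_recording[OF p(1)] insert_word_recording[OF p(2)] r r' eq
    by (auto simp: recording_pairs_def)
  have "ys = ys' \<and> i = i'"
    using ins_inj[OF R(1,2) peak_word_snoc_le peak_word_snoc_le, of i i' zs j] snoc(2,3) v' R I I' eq
    by (simp add: strips_length)
  then show ?case using snoc(1)[OF p] r r' eq v' by simp
qed

lemma insert_word_surj: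
  "(t, ys) \<in> recording_pairs \<alpha> \<Longrightarrow> \<exists>v. peak_word v \<and> shape v = \<alpha> \<and> insert_word v = (t, ys)"
proof (induction t arbitrary: ys \<alpha> rule: rev_induct)
  case Nil
  then have "top_state ys = (\<lambda>_. 0)" "strips 0 \<alpha> ys" by (auto simp: recording_pairs_def)
  moreover from this have "\<alpha> = []" using strips_support[of 0 \<alpha> ys 0] by auto
  ultimately show ?case by (intro exI[of _ "[]"]) (simp add: insert_word_simps)
next
  case (snoc j t)
  then have t: "peak_word (t @ [j])" "young_word (t @ [j])" "strips 0 \<alpha> ys"
    "top_state ys = add_box (count_list t) j"
    by (auto simp: recording_pairs_def count_list_snoc simp del: count_list_append)
  define l where "l = length (shape t)"
  have p: "peak_word t" using t by (simp add: peak_word_snoc)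
  have sup: "0 < count_list t r \<longleftrightarrow> r < l" for r
    using count_list_shape[OF p] by (simp add: nth_default_pos_iff shape_positive l_def)
  have jl: "j \<le> l" using peak_word_snoc_le[OF t(1)] l_def by simp
  have ad: "addable l (count_list t) j" unfolding addable_def
  proof (intro conjI allI impI jl)
    fix r assume r: "j < r \<and> r \<le> l"
    show "count_list t r \<noteq> count_list t j"
    proof (cases "r = l")
      case True then show ?thesis using sup[of r] sup[of j] r by auto
    next
      case False then show ?thesis using t(2) sup[of r] r by (auto simp: young_word_snoc)
    qed
  qed
  have "r < length \<alpha> \<longleftrightarrow> r < max l (Suc j)" for r
    using strips_support[OF t(3), of r] t(4) sup[of r] jl by (auto simp: add_box_def split: if_splits)
  then have "length \<alpha> = max l (Suc j)" by (metis linorder_neqE_nat order_less_irrefl)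
  then obtain \<beta> zs i where B: "strips 0 \<beta> zs" "i \<le> length \<beta>" "length \<beta> = l" "\<alpha> = grow i \<beta>"
    "top_state zs = count_list t" "ins l zs i = (ys, j)"
    using ins_surj[OF t(3,4) ad] sup by auto
  have "(t, zs) \<in> recording_pairs \<beta>" using B t by (simp add: recording_pairs_def peak_word_snoc young_word_snoc)
  then obtain v where v: "peak_word v" "shape v = \<beta>" "insert_word v = (t, zs)" using snoc(1) by blast
  \<comment> \<open>The point that no single step shows: the new word has peak content because the
    final state of its chain is peak.\<close>
  have "peak_fun (nth_default 0 \<alpha>)"
    using strips_peak_fun[OF t(3)] t(1,4) by (simp add: peak_word_snoc count_list_snoc del: count_list_append)
  then have "peak_word (v @ [i])"
    using v B by (simp add: peak_word_snoc count_list_snoc count_list_shape nth_default_grow del: count_list_append)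
  moreover have "insert_word (v @ [i]) = (t @ [j], ys)"
    using v B strips_length[OF B(1)] by (simp add: insert_word_simps)
  ultimately show ?case using v B by (intro exI[of _ "v @ [i]"]) simp
qed

lemma insert_word_descent:
  "peak_word v \<Longrightarrow> Suc k < length v \<Longrightarrow>
    v ! k < v ! Suc k \<longleftrightarrow> word_col (fst (insert_word v)) (Suc k) \<le> word_col (fst (insert_word v)) k"
proof (induction v rule: rev_induct)
  case (snoc i v)
  obtain t ys where r: "insert_word v = (t, ys)" by force
  obtain zs j where I: "ins (length ys) ys i = (zs, j)" by force
  have f: "fst (insert_word (v @ [i])) = t @ [j]" using r I by (simp add: insert_word_simps)
  have lt: "length t = length v" using length_insert_word[of v] r by simp
  have p: "peak_word v" using snoc by (simp add: peak_word_snoc)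
  show ?case
  proof (cases "Suc k < length v")
    case True
    then show ?thesis using snoc(1)[OF p True] f r lt by (simp add: nth_append word_col_snoc)
  next
    case False
    then have k: "length v = Suc k" using snoc by simp
    then obtain w i0 where w: "v = w @ [i0]" by (cases v rule: rev_cases) auto
    obtain t0 xs where r0: "insert_word w = (t0, xs)" by force
    obtain ys' j0 where I0: "ins (length xs) xs i0 = (ys', j0)" by force
    have eq: "t = t0 @ [j0]" "ys = ys'" using r w r0 I0 by (auto simp: insert_word_simps)
    have pw: "peak_word w" using p w by (simp add: peak_word_snoc)
    have R: "strips 0 (shape w) xs" "top_state xs = count_list t0" "strips 0 (shape v) ys" "top_state ys = count_list t"
      using insert_word_recording[OF pw] insert_word_recording[OF p] r r0 by (auto simp: recording_pairs_def)
    have "top_state ys j \<le> top_state xs j0 \<longleftrightarrow> i0 < i"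
      using ins_descent[OF R(1) peak_word_snoc_le, of i0 ys j0 i zs j] p w I I0 eq R peak_word_snoc_le[OF snoc(2)]
      by (simp add: strips_length)
    moreover have t0: "length t0 = k" using lt eq k by simp
    moreover have "word_col (t @ [j]) (Suc k) = Suc (top_state ys j)"
      using word_col_snoc(2)[where v = t and i = j] lt k R(4) by simp
    moreover have "word_col (t @ [j]) k = Suc (top_state xs j0)"
      using word_col_snoc(1)[where v = t and i = j and k = k] word_col_snoc(2)[where v = t0 and i = j0]
        eq(1) t0 R(2) by simp
    ultimately show ?thesis using k w f by (simp add: nth_append)
  qed
qed simp

section \<open>Row words of fillings\<close>

text \<open>Letters count rows from \<open>0\<close>, diagrams from \<open>1\<close>; in the filling
  below, position \<open>k\<close> of the word gives the entry \<open>k + 1\<close>.\<close>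

definition box_at :: "nat list \<Rightarrow> nat \<Rightarrow> nat \<times> nat" where
  "box_at v k = (word_col v k, Suc (v ! k))"

definition row_fillings :: "nat list \<Rightarrow> (nat \<times> nat \<Rightarrow> nat) set" where
  "row_fillings \<beta> = {T \<in> standard_fillings \<beta>.
     \<forall>c c' r. (c, r) \<in> diagram \<beta> \<and> (c', r) \<in> diagram \<beta> \<and> c < c' \<longrightarrow> T (c, r) < T (c', r)}"

definition row_words :: "nat list \<Rightarrow> nat list set" where
  "row_words \<beta> = {v. length v = sum_list \<beta> \<and> count_list v = nth_default 0 \<beta>}"

definition filling :: "nat list \<Rightarrow> nat list \<Rightarrow> nat \<times> nat \<Rightarrow> nat" where
  "filling \<beta> v = restrict (\<lambda>b. Suc (inv_into {..<length v} (box_at v) b)) (diagram \<beta>)"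

lemma diagram_iff: "(c, r) \<in> diagram \<beta> \<longleftrightarrow> 1 \<le> r \<and> 1 \<le> c \<and> c \<le> nth_default 0 \<beta> (r - 1)"
  by (auto simp: diagram_def nth_default_def)

lemma count_list_take_card:
  "m \<le> length v \<Longrightarrow> count_list (take m v) r = card {i. i < m \<and> v ! i = r}"
  unfolding count_list_eq_length_filter length_filter_conv_card
  by (intro arg_cong[of _ _ card]) auto

lemma count_list_take_mono: "m \<le> m' \<Longrightarrow> count_list (take m v) r \<le> count_list (take m' v) r"
proof -
  assume "m \<le> m'"
  then have "take m' v = take m v @ take (m' - m) (drop m v)"
    by (metis le_add_diff_inverse take_add)
  then show ?thesis by simp
qed

lemma count_list_take_le: "count_list (take m v) r \<le> count_list v r"
  using count_list_take_mono[of m "max m (length v)" v r] by simp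

lemma word_col_eq: "k < length v \<Longrightarrow> word_col v k = Suc (count_list (take k v) (v ! k))"
  by (simp add: word_col_def take_Suc_conv_app_nth)

lemma bij_betw_box_at:
  assumes v: "v \<in> row_words \<beta>"
  shows "bij_betw (box_at v) {..<length v} (diagram \<beta>)"
proof (rule bij_betw_imageI)
  have cnt: "count_list v = nth_default 0 \<beta>" using v by (simp add: row_words_def)
  have less: "word_col v k < word_col v k'" if "k < k'" "k' < length v" "v ! k = v ! k'" for k k'
    using count_list_take_mono[of "Suc k" k' v "v ! k"] that word_col_eq[of k' v]
    by (simp add: word_col_def)
  show "inj_on (box_at v) {..<length v}"
  proof (rule inj_onI)
    fix k k' assume "k \<in> {..<length v}" "k' \<in> {..<length v}" "box_at v k = box_at v k'"
    then show "k = k'" using less[of k k'] less[of k' k] by (cases k k' rule: linorder_cases) (auto simp: box_at_def)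
  qed
  show "box_at v ` {..<length v} = diagram \<beta>"
  proof (intro equalityI subsetI)
    fix b assume "b \<in> box_at v ` {..<length v}"
    then obtain k where k: "k < length v" "b = box_at v k" by auto
    show "b \<in> diagram \<beta>"
      using k word_col_eq[OF k(1)] count_list_take_le[of "Suc k" v "v ! k"]
      by (simp add: box_at_def diagram_iff cnt[symmetric] word_col_def)
  next
    fix b assume b: "b \<in> diagram \<beta>"
    obtain c r where cr: "b = (c, r)" by force
    have c: "1 \<le> r" "1 \<le> c" "c \<le> count_list v (r - 1)" using b cr by (auto simp: diagram_iff cnt)
    \<comment> \<open>The box in column \<open>c\<close> of a row is placed by the first prefix that
      contains \<open>c\<close> letters of that row.\<close>
    define m where "m = (LEAST m. c \<le> count_list (take m v) (r - 1))"
    have m: "c \<le> count_list (take m v) (r - 1)"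
      unfolding m_def by (rule LeastI[of _ "length v"]) (use c in simp)
    obtain k where k: "m = Suc k" using m c by (cases m) auto
    have lt: "count_list (take k v) (r - 1) < c"
      using not_less_Least[of k "\<lambda>m. c \<le> count_list (take m v) (r - 1)"] k m_def by simp
    have kl: "k < length v" using m lt k by (rule_tac ccontr) simp
    then have "v ! k = r - 1" "count_list (take (Suc k) v) (r - 1) = c"
      using m lt k by (auto simp: take_Suc_conv_app_nth split: if_splits)
    then have "box_at v k = b" using cr c by (auto simp: box_at_def word_col_def)
    then show "b \<in> box_at v ` {..<length v}" using kl by blast
  qed
qed

lemma filling_box_at:
  assumes "v \<in> row_words \<beta>" "k < length v"
  shows "box_at v k \<in> diagram \<beta>" "filling \<beta> v (box_at v k) = Suc k"
proof -
  note B = bij_betw_box_at[OF assms(1)]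
  show "box_at v k \<in> diagram \<beta>" using B assms(2) by (auto simp: bij_betw_def)
  then show "filling \<beta> v (box_at v k) = Suc k"
    using B assms(2) by (simp add: filling_def bij_betw_def)
qed

lemma filling_cases:
  assumes "v \<in> row_words \<beta>" "b \<in> diagram \<beta>"
  obtains k where "k < length v" "b = box_at v k" "filling \<beta> v b = Suc k"
  using bij_betw_box_at[OF assms(1)] assms filling_box_at(2)[OF assms(1)]
  by (auto simp: bij_betw_def)

lemma filling_standard:
  assumes v: "v \<in> row_words \<beta>"
  shows "filling \<beta> v \<in> standard_fillings \<beta>"
proof -
  have "bij_betw (\<lambda>b. Suc (inv_into {..<length v} (box_at v) b)) (diagram \<beta>) {1..length v}"
  proof -
    have "bij_betw Suc {..<length v} {1..length v}"
      by (rule bij_betw_imageI) (auto simp: image_Suc_lessThan)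
    from bij_betw_trans[OF bij_betw_inv_into[OF bij_betw_box_at[OF v]] this] show ?thesis
      by (simp add: comp_def)
  qed
  then have "bij_betw (filling \<beta> v) (diagram \<beta>) {1..length v}"
    by (rule bij_betw_cong[THEN iffD1, rotated]) (simp add: filling_def)
  then show ?thesis using v by (simp add: standard_fillings_def filling_def row_words_def)
qed

text \<open>The dictionary between tableaux and words: inequalities between entries become
  inequalities on prefix contents.\<close>

lemma filling_le_iff:
  assumes v: "v \<in> row_words \<beta>" and b: "(c, r) \<in> diagram \<beta>"
  shows "filling \<beta> v (c, r) \<le> k \<longleftrightarrow> c \<le> count_list (take k v) (r - 1)"
proof -
  obtain m where m: "m < length v" "(c, r) = box_at v m" "filling \<beta> v (c, r) = Suc m"
    using filling_cases[OF v b] by blast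
  have c: "c = count_list (take (Suc m) v) (r - 1)" "c = Suc (count_list (take m v) (r - 1))"
    using m word_col_eq[OF m(1)] by (auto simp: box_at_def word_col_def)
  show ?thesis
  proof (cases "Suc m \<le> k")
    case True
    then show ?thesis using count_list_take_mono[OF True, of v "r - 1"] m(3) c(1) by simp
  next
    case False
    then have "k \<le> m" by simp
    then show ?thesis using count_list_take_mono[of k m v "r - 1"] m(3) c(2) by simp
  qed
qed

lemma filling_row_fillings:
  assumes v: "v \<in> row_words \<beta>"
  shows "filling \<beta> v \<in> row_fillings \<beta>"
  unfolding row_fillings_def
proof (intro CollectI conjI allI impI filling_standard[OF v])
  fix c c' r assume A: "(c, r) \<in> diagram \<beta> \<and> (c', r) \<in> diagram \<beta> \<and> c < c'"
  then have "filling \<beta> v (c, r) \<le> filling \<beta> v (c', r)"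
    using filling_le_iff[OF v, of c r] filling_le_iff[OF v, of c' r] by (meson le_refl less_imp_le order_trans)
  moreover have "filling \<beta> v (c, r) \<noteq> filling \<beta> v (c', r)"
  proof
    assume "filling \<beta> v (c, r) = filling \<beta> v (c', r)"
    then have "(c, r) = (c', r)"
      using filling_standard[OF v] A by (auto simp: standard_fillings_def bij_betw_def dest: inj_onD)
    then show False using A by simp
  qed
  ultimately show "filling \<beta> v (c, r) < filling \<beta> v (c', r)" by simp
qed

lemma filling_surj:
  assumes T: "T \<in> row_fillings \<beta>"
  shows "\<exists>v\<in>row_words \<beta>. filling \<beta> v = T"
proof -
  let ?D = "diagram \<beta>"
  define n where "n = sum_list \<beta>"
  have bij: "bij_betw T ?D {1..n}" and ext: "T \<in> extensional ?D"
    and inc: "\<And>c c' r. (c, r) \<in> ?D \<Longrightarrow> (c', r) \<in> ?D \<Longrightarrow> c < c' \<Longrightarrow> T (c, r) < T (c', r)"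
    using T unfolding row_fillings_def standard_fillings_def n_def by auto
  define g where "g k = inv_into ?D T (Suc k)" for k
  have g: "g k \<in> ?D" "T (g k) = Suc k" if "k < n" for k
    using bij that unfolding g_def bij_betw_def
    by (auto intro!: inv_into_into f_inv_into_f)
  have gT: "g (T b - 1) = b" "T b - 1 < n" "0 < T b" if "b \<in> ?D" for b
  proof -
    have "T b \<in> {1..n}" using bij that by (auto simp: bij_betw_def)
    then show "T b - 1 < n" "0 < T b" by auto
    then show "g (T b - 1) = b" using bij that unfolding g_def by (simp add: bij_betw_def)
  qed
  \<comment> \<open>The word lists the rows of the boxes in the order of their entries.\<close>
  define v where "v = map (\<lambda>k. snd (g k) - 1) [0..<n]"
  have len: "length v = n" by (simp add: v_def)
  have cnt: "count_list (take m v) r = card {c. (c, Suc r) \<in> ?D \<and> T (c, Suc r) \<le> m}" if "m \<le> n" for m r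
  proof -
    have "count_list (take m v) r = card {i. i < m \<and> v ! i = r}"
      using count_list_take_card[of m v r] that len by simp
    also have "{i. i < m \<and> v ! i = r} = (\<lambda>c. T (c, Suc r) - 1) ` {c. (c, Suc r) \<in> ?D \<and> T (c, Suc r) \<le> m}"
    proof (intro equalityI subsetI)
      fix i assume i: "i \<in> {i. i < m \<and> v ! i = r}"
      then have "i < n" using that by simp
      moreover have "snd (g i) = Suc r"
        using i \<open>i < n\<close> g(1)[of i] by (cases "g i") (auto simp: v_def diagram_iff)
      ultimately have "(fst (g i), Suc r) \<in> ?D" "T (fst (g i), Suc r) = Suc i"
        using g[of i] by (metis prod.collapse)+
      then show "i \<in> (\<lambda>c. T (c, Suc r) - 1) ` {c. (c, Suc r) \<in> ?D \<and> T (c, Suc r) \<le> m}"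
        using i by (intro image_eqI[of _ _ "fst (g i)"]) auto
    next
      fix i assume "i \<in> (\<lambda>c. T (c, Suc r) - 1) ` {c. (c, Suc r) \<in> ?D \<and> T (c, Suc r) \<le> m}"
      then obtain c where c: "(c, Suc r) \<in> ?D" "T (c, Suc r) \<le> m" "i = T (c, Suc r) - 1" by auto
      then show "i \<in> {i. i < m \<and> v ! i = r}" using gT[OF c(1)] that by (auto simp: v_def)
    qed
    also have "card \<dots> = card {c. (c, Suc r) \<in> ?D \<and> T (c, Suc r) \<le> m}"
    proof (rule card_image, rule inj_onI)
      fix c c' assume A: "c \<in> {c. (c, Suc r) \<in> ?D \<and> T (c, Suc r) \<le> m}"
        "c' \<in> {c. (c, Suc r) \<in> ?D \<and> T (c, Suc r) \<le> m}" "T (c, Suc r) - 1 = T (c', Suc r) - 1"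
      then show "c = c'" using gT(1)[of "(c, Suc r)"] gT(1)[of "(c', Suc r)"] by auto
    qed
    finally show ?thesis .
  qed
  have "count_list v r = nth_default 0 \<beta> r" for r
  proof -
    have "{c. (c, Suc r) \<in> ?D \<and> T (c, Suc r) \<le> n} = {1..nth_default 0 \<beta> r}"
    proof (intro equalityI subsetI)
      fix c assume "c \<in> {1..nth_default 0 \<beta> r}"
      then have "(c, Suc r) \<in> ?D" by (simp add: diagram_iff)
      then show "c \<in> {c. (c, Suc r) \<in> ?D \<and> T (c, Suc r) \<le> n}" using gT(2,3)[of "(c, Suc r)"] by simp
    qed (auto simp: diagram_iff)
    then show ?thesis using cnt[of n r] len by simp
  qed
  then have vw: "v \<in> row_words \<beta>" using len by (auto simp: row_words_def n_def)
  have box: "box_at v k = g k" if k: "k < n" for k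
  proof -
    obtain c r where cr: "g k = (c, r)" by force
    have D: "(c, r) \<in> ?D" "T (c, r) = Suc k" using g[OF k] cr by auto
    have r: "1 \<le> r" "v ! k = r - 1" using D cr k by (auto simp: v_def diagram_iff)
    have "{c'. (c', r) \<in> ?D \<and> T (c', r) \<le> Suc k} = {1..c}"
    proof (intro equalityI subsetI)
      fix c' assume "c' \<in> {c'. (c', r) \<in> ?D \<and> T (c', r) \<le> Suc k}"
      then show "c' \<in> {1..c}" using inc[OF D(1), of c'] D(2) by (auto simp: diagram_iff) (meson D(1) diagram_iff linorder_not_less)
    next
      fix c' assume c': "c' \<in> {1..c}"
      then have "(c', r) \<in> ?D" using D(1) by (auto simp: diagram_iff)
      then show "c' \<in> {c'. (c', r) \<in> ?D \<and> T (c', r) \<le> Suc k}"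
        using inc[of c' r c] D c' by (cases "c' = c") auto
    qed
    then have "word_col v k = c" using cnt[of "Suc k" "r - 1"] k r by (simp add: word_col_def)
    then show ?thesis using cr r by (simp add: box_at_def)
  qed
  have "filling \<beta> v = T"
  proof (rule extensionalityI[of _ ?D])
    show "filling \<beta> v \<in> extensional ?D" by (simp add: filling_def)
    show "T \<in> extensional ?D" by (rule ext)
    fix b assume b: "b \<in> ?D"
    have "b = box_at v (T b - 1)" using box[OF gT(2)[OF b]] gT(1)[OF b] by simp
    then show "filling \<beta> v b = T b" using filling_box_at(2)[OF vw, of "T b - 1"] gT[OF b] len by simp
  qed
  then show ?thesis using vw by blast
qed

lemma filling_inj: "inj_on (filling \<beta>) (row_words \<beta>)"
proof (rule inj_onI)
  fix v w assume A: "v \<in> row_words \<beta>" "w \<in> row_words \<beta>" "filling \<beta> v = filling \<beta> w"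
  have len: "length v = length w" using A by (simp add: row_words_def)
  show "v = w"
  proof (rule nth_equalityI[OF len])
    fix k assume k: "k < length v"
    obtain m where m: "m < length w" "box_at v k = box_at w m" "filling \<beta> w (box_at v k) = Suc m"
      using filling_cases[OF A(2) filling_box_at(1)[OF A(1) k]] by blast
    then have "m = k" using filling_box_at(2)[OF A(1) k] A(3) by simp
    then show "v ! k = w ! k" using m by (simp add: box_at_def)
  qed
qed

lemma column_of_filling:
  assumes "v \<in> row_words \<beta>" "k < length v"
  shows "column_of \<beta> (filling \<beta> v) (Suc k) = word_col v k"
proof -
  have "inv_into (diagram \<beta>) (filling \<beta> v) (filling \<beta> v (box_at v k)) = box_at v k"
    using filling_standard[OF assms(1)] filling_box_at(1)[OF assms]
    by (intro inv_into_f_f) (auto simp: standard_fillings_def bij_betw_def)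
  then show ?thesis using filling_box_at(2)[OF assms] by (simp add: column_of_def box_at_def)
qed

text \<open>One zero value guarantees that a composition can be formed: under
  \<open>peak_fun\<close> every row above an empty row is empty.\<close>

lemma is_peak_diagram_iff:
  assumes fin: "\<exists>l. f l = 0"
  shows "is_peak_diagram {(c, r). 1 \<le> r \<and> 1 \<le> c \<and> c \<le> f (r - 1)} \<longleftrightarrow> peak_fun f"
proof
  assume "is_peak_diagram {(c, r). 1 \<le> r \<and> 1 \<le> c \<and> c \<le> f (r - 1)}"
  then obtain m \<gamma> where g: "\<gamma> \<in> peak_compositions m" "{(c, r). 1 \<le> r \<and> 1 \<le> c \<and> c \<le> f (r - 1)} = diagram \<gamma>"
    unfolding is_peak_diagram_def by blast
  have "f r = nth_default 0 \<gamma> r" for r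
  proof -
    have "1 \<le> c \<and> c \<le> f r \<longleftrightarrow> 1 \<le> c \<and> c \<le> nth_default 0 \<gamma> r" for c
      using eqset_imp_iff[OF g(2), of "(c, Suc r)"] by (simp add: diagram_iff)
    from this[of "f r"] this[of "nth_default 0 \<gamma> r"] show ?thesis by (cases "f r"; cases "nth_default 0 \<gamma> r") auto
  qed
  then show "peak_fun f" using g(1) unfolding peak_fun_def by (auto simp: nth_default_def peak_compositions_def)
next
  assume P: "peak_fun f"
  define l where "l = (LEAST l. f l = 0)"
  have l: "f l = 0" unfolding l_def by (rule LeastI_ex[OF fin])
  have below: "0 < f r" if "r < l" for r using not_less_Least[of r "\<lambda>l. f l = 0"] that l_def by auto
  have above: "f (l + d) = 0" for d
  proof (induction d)
    case (Suc d) then show ?case using P unfolding peak_fun_def by (metis add_Suc_right less_nat_zero_code not_gr_zero)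
  qed (simp add: l)
  define \<gamma> where "\<gamma> = map f [0..<l]"
  have f: "nth_default 0 \<gamma> r = f r" for r
    using above[of "r - l"] by (auto simp: nth_default_def \<gamma>_def)
  have "\<gamma> \<in> peak_compositions (sum_list \<gamma>)"
    using P below unfolding peak_fun_def peak_compositions_def compositions_def
    by (auto simp: \<gamma>_def Suc_le_eq)
  moreover have "{(c, r). 1 \<le> r \<and> 1 \<le> c \<and> c \<le> f (r - 1)} = diagram \<gamma>"
    by (auto simp: diagram_iff f)
  ultimately show "is_peak_diagram {(c, r). 1 \<le> r \<and> 1 \<le> c \<and> c \<le> f (r - 1)}"
    unfolding is_peak_diagram_def by metis
qed

lemma filling_sublevel:
  assumes v: "v \<in> row_words \<beta>"
  shows "{b \<in> diagram \<beta>. filling \<beta> v b \<le> k} = {(c, r). 1 \<le> r \<and> 1 \<le> c \<and> c \<le> count_list (take k v) (r - 1)}"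
proof -
  have "(c, r) \<in> diagram \<beta>" if "1 \<le> r" "1 \<le> c" "c \<le> count_list (take k v) (r - 1)" for c r
    using that count_list_take_le[of k v "r - 1"] v by (auto simp: diagram_iff row_words_def)
  then show ?thesis using filling_le_iff[OF v] by (auto simp: diagram_iff)
qed

lemma filling_peak_iff:
  assumes v: "v \<in> row_words \<beta>"
  shows "(\<forall>k\<le>sum_list \<beta>. is_peak_diagram {b \<in> diagram \<beta>. filling \<beta> v b \<le> k}) \<longleftrightarrow> peak_word v"
proof -
  have "\<exists>l. count_list (take k v) l = 0" for k
  proof (rule exI)
    have "count_list v (length \<beta>) = 0" using v by (simp add: row_words_def nth_default_def)
    then show "count_list (take k v) (length \<beta>) = 0"
      using count_list_take_le[of k v "length \<beta>"] by simp
  qed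
  then show ?thesis
    unfolding filling_sublevel[OF v] peak_word_def using v is_peak_diagram_iff
    by (simp add: row_words_def)
qed

section \<open>Standard peak Young composition tableaux\<close>

lemma peak_fun_antimono: "peak_fun f \<Longrightarrow> r < r' \<Longrightarrow> 0 < f r' \<Longrightarrow> 1 < f r"
proof (induction r')
  case (Suc r')
  then have "1 < f r'" by (auto simp: peak_fun_def)
  then show ?case using Suc by (cases "r = r'") auto
qed simp

text \<open>When row \<open>r'\<close> receives its first box the prefix content is peak, so every
  lower row already has two boxes. This yields the first-column condition for the standard tableaux
  and, later, for the marked ones.\<close>

lemma filling_first_column:
  assumes v: "v \<in> row_words \<beta>" "peak_word v" and D: "(1, r') \<in> diagram \<beta>" and r: "1 \<le> r" "r < r'"
  shows "(2, r) \<in> diagram \<beta> \<and> filling \<beta> v (1, r) < filling \<beta> v (1, r') \<and> filling \<beta> v (2, r) < filling \<beta> v (1, r')"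
proof -
  let ?k = "filling \<beta> v (1, r')"
  have F: "bij_betw (filling \<beta> v) (diagram \<beta>) {1..sum_list \<beta>}"
    using filling_standard[OF v(1)] by (auto simp: standard_fillings_def)
  have k: "?k \<le> length v" using F D v(1) by (auto simp: bij_betw_def row_words_def)
  have "1 \<le> count_list (take ?k v) (r' - 1)" using filling_le_iff[OF v(1) D, of ?k] by simp
  then have c: "1 < count_list (take ?k v) (r - 1)"
    using v(2) k r by (intro peak_fun_antimono[of _ _ "r' - 1"]) (auto simp: peak_word_def)
  then have "1 < count_list v (r - 1)" using count_list_take_le[of ?k v "r - 1"] by simp
  then have D2: "(1, r) \<in> diagram \<beta>" "(2, r) \<in> diagram \<beta>" using v(1) r by (auto simp: diagram_iff row_words_def)
  then have "filling \<beta> v (1, r) \<le> ?k" "filling \<beta> v (2, r) \<le> ?k"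
    using filling_le_iff[OF v(1), of _ r ?k] c by auto
  moreover have "filling \<beta> v b \<noteq> ?k" if "b \<in> diagram \<beta>" "b \<noteq> (1, r')" for b
    using F that D by (auto simp: bij_betw_def dest: inj_onD)
  ultimately show ?thesis using D2 r by (metis less_imp_neq order_le_neq_trans prod.inject)
qed

text \<open>Read at the entry \<open>k + 1\<close> in column \<open>c + 1\<close>: a higher row with
  at least \<open>c\<close> boxes so far must have at least \<open>c + 1\<close>, that is, not
  exactly \<open>c\<close>.\<close>

lemma filling_young_iff:
  assumes v: "v \<in> row_words \<beta>"
  shows "(\<forall>c r r'. r' < r \<and> (c, r) \<in> diagram \<beta> \<and> (c + 1, r') \<in> diagram \<beta> \<and>
        filling \<beta> v (c, r) < filling \<beta> v (c + 1, r') \<longrightarrow>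
          (c + 1, r) \<in> diagram \<beta> \<and> filling \<beta> v (c + 1, r) < filling \<beta> v (c + 1, r')) \<longleftrightarrow> young_word v"
    (is "?L \<longleftrightarrow> _")
proof
  assume L: ?L
  show "young_word v" unfolding young_word_def
  proof (intro allI impI notI)
    fix k r assume k: "k < length v" "v ! k < r" "0 < count_list (take k v) r"
      and eq: "count_list (take k v) r = count_list (take k v) (v ! k)"
    define c where "c = count_list (take k v) r"
    have b: "box_at v k = (c + 1, Suc (v ! k))" using word_col_eq[OF k(1)] eq by (simp add: box_at_def c_def)
    note F = filling_box_at[OF v k(1), unfolded b]
    have D: "(c, Suc r) \<in> diagram \<beta>"
      using k(3) count_list_take_le[of k v r] v by (auto simp: diagram_iff row_words_def c_def)
    then have "filling \<beta> v (c, Suc r) \<le> k" using filling_le_iff[OF v D] by (simp add: c_def)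
    then have "(c + 1, Suc r) \<in> diagram \<beta> \<and> filling \<beta> v (c + 1, Suc r) < Suc k"
      using L[rule_format, of "Suc (v ! k)" "Suc r" c] D F k(2) by simp
    then show False using filling_le_iff[OF v, of "c + 1" "Suc r" k] by (simp add: c_def)
  qed
next
  assume Y: "young_word v"
  show ?L
  proof (intro allI impI)
    fix c r r'
    assume A: "r' < r \<and> (c, r) \<in> diagram \<beta> \<and> (c + 1, r') \<in> diagram \<beta> \<and> filling \<beta> v (c, r) < filling \<beta> v (c + 1, r')"
    obtain k where k: "k < length v" "(c + 1, r') = box_at v k" "filling \<beta> v (c + 1, r') = Suc k"
      using filling_cases[OF v, of "(c + 1, r')"] A by blast
    have c: "count_list (take k v) (v ! k) = c" "r' = Suc (v ! k)"
      using k word_col_eq[OF k(1)] by (auto simp: box_at_def)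
    have "c \<le> count_list (take k v) (r - 1)" "1 \<le> c" using filling_le_iff[OF v, of c r k] A k by (auto simp: diagram_iff)
    moreover have "v ! k < r - 1" using A c(2) by linarith
    then have "count_list (take k v) (r - 1) \<noteq> c"
      using Y[unfolded young_word_def, rule_format, of k "r - 1"] k(1) c(1) calculation by auto
    ultimately have c1: "c + 1 \<le> count_list (take k v) (r - 1)" by simp
    then have "(c + 1, r) \<in> diagram \<beta>"
      using A count_list_take_le[of k v "r - 1"] v by (auto simp: diagram_iff row_words_def)
    then show "(c + 1, r) \<in> diagram \<beta> \<and> filling \<beta> v (c + 1, r) < filling \<beta> v (c + 1, r')"
      using filling_le_iff[OF v, of "c + 1" r k] c1 k(3) by auto
  qed
qed

lemma SPYCT_filling_iff:
  assumes v: "v \<in> row_words \<beta>"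
  shows "filling \<beta> v \<in> SPYCT \<beta> \<longleftrightarrow> peak_word v \<and> young_word v"
proof -
  have "filling \<beta> v (1, r) < filling \<beta> v (1, r')"
    if "peak_word v" "(1, r) \<in> diagram \<beta> \<and> (1, r') \<in> diagram \<beta> \<and> r < r'" for r r'
    using filling_first_column[OF v that(1), of r' r] that(2) by (auto simp: diagram_iff)
  then show ?thesis
    unfolding SPYCT_def mem_Collect_eq filling_peak_iff[OF v] filling_young_iff[OF v]
    using filling_row_fillings[OF v] unfolding row_fillings_def by blast
qed

lemma bij_betw_SPYCT:
  "bij_betw (filling \<beta>) {v \<in> row_words \<beta>. peak_word v \<and> young_word v} (SPYCT \<beta>)"
proof -
  have sub: "SPYCT \<beta> \<subseteq> row_fillings \<beta>" by (auto simp: SPYCT_def row_fillings_def)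
  show ?thesis
  proof (intro bij_betw_imageI equalityI subsetI)
    show "inj_on (filling \<beta>) {v \<in> row_words \<beta>. peak_word v \<and> young_word v}"
      by (rule inj_on_subset[OF filling_inj]) blast
  next
    fix T assume "T \<in> filling \<beta> ` {v \<in> row_words \<beta>. peak_word v \<and> young_word v}"
    then show "T \<in> SPYCT \<beta>" using SPYCT_filling_iff by blast
  next
    fix T assume T: "T \<in> SPYCT \<beta>"
    then obtain v where "v \<in> row_words \<beta>" "filling \<beta> v = T"
      using sub filling_surj by blast
    then show "T \<in> filling \<beta> ` {v \<in> row_words \<beta>. peak_word v \<and> young_word v}"
      using SPYCT_filling_iff T by blast
  qed
qed

definition col_descents :: "nat list \<Rightarrow> nat set" where
  "col_descents v = {i. 1 \<le> i \<and> i < length v \<and> word_col v i \<le> word_col v (i - 1)}"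

definition row_descents :: "nat list \<Rightarrow> nat set" where
  "row_descents v = {i. 1 \<le> i \<and> i < length v \<and> v ! (i - 1) < v ! i}"

lemma Des_left_filling: "v \<in> row_words \<beta> \<Longrightarrow> Des_left \<beta> (filling \<beta> v) = col_descents v"
proof -
  assume v: "v \<in> row_words \<beta>"
  have "column_of \<beta> (filling \<beta> v) (i + 1) \<le> column_of \<beta> (filling \<beta> v) i \<longleftrightarrow> word_col v i \<le> word_col v (i - 1)"
    if "1 \<le> i" "i < length v" for i
    using column_of_filling[OF v, of i] column_of_filling[OF v, of "i - 1"] that by simp
  then show ?thesis using v unfolding Des_left_def col_descents_def row_words_def by auto
qed

lemma insert_word_descents: "peak_word v \<Longrightarrow> col_descents (fst (insert_word v)) = row_descents v"
proof -
  assume p: "peak_word v"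
  have "word_col (fst (insert_word v)) i \<le> word_col (fst (insert_word v)) (i - 1) \<longleftrightarrow> v ! (i - 1) < v ! i"
    if "1 \<le> i" "i < length v" for i
    using insert_word_descent[OF p, of "i - 1"] that by simp
  then show ?thesis unfolding col_descents_def row_descents_def length_insert_word by blast
qed

lemma peak_compositions_iff:
  "\<alpha> \<in> peak_compositions n \<longleftrightarrow> 0 \<notin> set \<alpha> \<and> sum_list \<alpha> = n \<and> peak_fun (nth_default 0 \<alpha>)"
proof -
  have "0 \<notin> set \<alpha> \<longleftrightarrow> (\<forall>a\<in>set \<alpha>. 1 \<le> a)" by (metis One_nat_def Suc_leI not_gr_zero not_one_le_zero)
  moreover have "(\<forall>i. Suc i < length \<alpha> \<longrightarrow> 1 < \<alpha> ! i) \<longleftrightarrow> peak_fun (nth_default 0 \<alpha>)" if "0 \<notin> set \<alpha>"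
    using nth_default_pos_iff[OF that] unfolding peak_fun_def by (auto simp: nth_default_def)
  ultimately show ?thesis unfolding peak_compositions_def compositions_def by auto
qed

lemma sum_list_grow: "sum_list (grow i \<alpha>) = Suc (sum_list \<alpha>)"
  by (induction i \<alpha> rule: grow.induct) auto

lemma sum_list_shape: "sum_list (shape v) = length v"
  by (induction v rule: rev_induct) (auto simp: sum_list_grow)

lemma shape_peak_compositions: "peak_word v \<Longrightarrow> shape v \<in> peak_compositions (length v)"
  using count_list_shape[of v] unfolding peak_compositions_iff peak_word_def
  by (auto simp: shape_positive sum_list_shape)

lemma peak_word_row_words:
  assumes "0 \<notin> set \<beta>"
  shows "v \<in> row_words \<beta> \<and> peak_word v \<longleftrightarrow> peak_word v \<and> shape v = \<beta>"
proof (intro iffI conjI; elim conjE)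
  assume v: "v \<in> row_words \<beta>" and p: "peak_word v"
  then have "nth_default 0 (shape v) = nth_default 0 \<beta>"
    by (simp add: row_words_def flip: count_list_shape)
  then show "shape v = \<beta>" by (rule nth_default_inj[OF shape_positive assms])
next
  assume "peak_word v" "shape v = \<beta>"
  then show "v \<in> row_words \<beta>"
    using count_list_shape[of v] sum_list_shape[of v] by (simp add: row_words_def)
qed

lemma finite_shape_words: "finite {v. peak_word v \<and> shape v = \<alpha>}"
proof (rule finite_subset)
  show "{v. peak_word v \<and> shape v = \<alpha>} \<subseteq> {v. set v \<subseteq> {..<length \<alpha>} \<and> length v = sum_list \<alpha>}"
  proof
    fix v assume v: "v \<in> {v. peak_word v \<and> shape v = \<alpha>}"
    have "r < length \<alpha>" if "r \<in> set v" for r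
    proof -
      have "0 < count_list v r" using that by (meson count_list_0_iff not_gr_zero)
      then show ?thesis using v count_list_shape[of v] nth_default_pos_iff[OF shape_positive, of v r] by simp
    qed
    then show "v \<in> {v. set v \<subseteq> {..<length \<alpha>} \<and> length v = sum_list \<alpha>}" using v sum_list_shape[of v] by auto
  qed
qed (simp add: finite_lists_length_eq)

text \<open>Insertion maps the words of content \<open>\<alpha>\<close> onto the disjoint union,
  over the common final shape \<open>\<beta>\<close>, of tableau words times chains. Row descents
  become column descents, so any property \<open>P\<close> of the descent set is transported; it is
  later instantiated by compatibility of the peaks with a fixed composition.\<close>

lemma card_words_by_descents:
  assumes a: "\<alpha> \<in> peak_compositions n"
  shows "card {v. peak_word v \<and> shape v = \<alpha> \<and> P (row_descents v)} =
    (\<Sum>\<beta>\<in>peak_compositions n. card {T \<in> SPYCT \<beta>. P (Des_left \<beta> T)} *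
       card {ys. strips 0 \<alpha> ys \<and> top_state ys = nth_default 0 \<beta>})"
proof -
  let ?A = "{v. peak_word v \<and> shape v = \<alpha> \<and> P (row_descents v)}"
  let ?Y = "\<lambda>\<beta>. {t. peak_word t \<and> young_word t \<and> shape t = \<beta> \<and> P (col_descents t)}"
  let ?C = "\<lambda>\<beta>. {ys. strips 0 \<alpha> ys \<and> top_state ys = nth_default 0 \<beta>}"
  have len: "length v = n" if "shape v = \<alpha>" for v
    using a that sum_list_shape[of v] by (auto simp: peak_compositions_iff)
  have inj: "inj_on insert_word ?A" by (rule inj_onI) (auto intro: insert_word_inj)
  have "insert_word ` ?A = (\<Union>\<beta>\<in>peak_compositions n. ?Y \<beta> \<times> ?C \<beta>)"
  proof (intro equalityI subsetI)
    fix x assume "x \<in> insert_word ` ?A"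
    then obtain v where v: "peak_word v" "shape v = \<alpha>" "P (row_descents v)" "x = insert_word v" by blast
    obtain t ys where x: "x = (t, ys)" by force
    have R: "peak_word t" "young_word t" "strips 0 \<alpha> ys" "top_state ys = count_list t"
      using insert_word_recording[OF v(1)] v x by (auto simp: recording_pairs_def)
    have "length t = n" using length_insert_word[of v] len[OF v(2)] v x by (metis fst_conv)
    then have "shape t \<in> peak_compositions n" using shape_peak_compositions[OF R(1)] by simp
    moreover have "P (col_descents t)" using insert_word_descents[OF v(1)] v x by (metis fst_conv)
    ultimately show "x \<in> (\<Union>\<beta>\<in>peak_compositions n. ?Y \<beta> \<times> ?C \<beta>)"
      using R x count_list_shape[OF R(1)] by auto
  next
    fix x assume "x \<in> (\<Union>\<beta>\<in>peak_compositions n. ?Y \<beta> \<times> ?C \<beta>)"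
    then obtain t ys where x: "x = (t, ys)" "peak_word t" "young_word t" "P (col_descents t)" "strips 0 \<alpha> ys"
      "top_state ys = nth_default 0 (shape t)" by auto
    then have "(t, ys) \<in> recording_pairs \<alpha>" by (simp add: recording_pairs_def count_list_shape)
    then obtain v where "peak_word v" "shape v = \<alpha>" "insert_word v = (t, ys)" using insert_word_surj by blast
    then show "x \<in> insert_word ` ?A" using x insert_word_descents[of v] by (intro image_eqI[of _ _ v]) auto
  qed
  then have "card ?A = card (\<Union>\<beta>\<in>peak_compositions n. ?Y \<beta> \<times> ?C \<beta>)"
    using card_image[OF inj] by simp
  have finA: "finite ?A" by (rule finite_subset[OF _ finite_shape_words[of \<alpha>]]) blast
  have finU: "finite (\<Union>\<beta>\<in>peak_compositions n. ?Y \<beta> \<times> ?C \<beta>)"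
    using finA \<open>insert_word ` ?A = _\<close> by (metis (no_types, lifting) finite_imageI)
  have "card (\<Union>\<beta>\<in>peak_compositions n. ?Y \<beta> \<times> ?C \<beta>) = (\<Sum>\<beta>\<in>peak_compositions n. card (?Y \<beta> \<times> ?C \<beta>))"
  proof (rule card_UN_disjoint[OF finite_peak_compositions])
    show "\<forall>\<beta>\<in>peak_compositions n. finite (?Y \<beta> \<times> ?C \<beta>)"
      using finU by (meson UN_upper finite_subset)
  qed auto
  also have "\<dots> = (\<Sum>\<beta>\<in>peak_compositions n. card {T \<in> SPYCT \<beta>. P (Des_left \<beta> T)} * card (?C \<beta>))"
  proof (rule sum.cong[OF refl])
    fix \<beta> assume b: "\<beta> \<in> peak_compositions n"
    then have p: "0 \<notin> set \<beta>" by (simp add: peak_compositions_iff)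
    have e: "?Y \<beta> = {v \<in> {v \<in> row_words \<beta>. peak_word v \<and> young_word v}. P (col_descents v)}"
      using peak_word_row_words[OF p] by auto
    have "bij_betw (filling \<beta>) (?Y \<beta>) {T \<in> SPYCT \<beta>. P (Des_left \<beta> T)}"
      unfolding e by (rule bij_betw_Collect[OF bij_betw_SPYCT]) (simp add: Des_left_filling)
    then show "card (?Y \<beta> \<times> ?C \<beta>) = card {T \<in> SPYCT \<beta>. P (Des_left \<beta> T)} * card (?C \<beta>)"
      by (simp add: card_cartesian_product bij_betw_same_card)
  qed
  finally show ?thesis using \<open>card ?A = _\<close> by simp
qed

section \<open>Coefficients of the quasisymmetric functions\<close>

lemma compositions_pos: "\<gamma> \<in> compositions n \<longleftrightarrow> 0 \<notin> set \<gamma> \<and> sum_list \<gamma> = n"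
proof -
  have "0 \<notin> set \<gamma> \<longleftrightarrow> (\<forall>a\<in>set \<gamma>. 1 \<le> a)" by (metis One_nat_def Suc_leI not_gr_zero not_one_le_zero)
  then show ?thesis unfolding compositions_def by simp
qed

lemma sum_list_concat: "sum_list (concat xs) = sum_list (map sum_list xs)"
  by (induction xs) auto

lemma sum_list_take_less:
  assumes "0 \<notin> set \<gamma>" "i < j" "j \<le> length \<gamma>"
  shows "sum_list (take i \<gamma>) < sum_list (take j (\<gamma> :: nat list))"
proof -
  have "take j \<gamma> = take i \<gamma> @ take (j - i) (drop i \<gamma>)" using assms by (metis le_add_diff_inverse less_imp_le take_add)
  moreover have "take (j - i) (drop i \<gamma>) \<noteq> []" using assms by simp
  moreover have "set (take (j - i) (drop i \<gamma>)) \<subseteq> set \<gamma>" by (meson order_trans set_drop_subset set_take_subset)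
  ultimately show ?thesis using assms(1)
    by (cases "take (j - i) (drop i \<gamma>)") (auto, metis gr0I subsetD)
qed

lemma sum_list_take_less_iff:
  assumes "0 \<notin> set \<gamma>" "i \<le> length \<gamma>" "j \<le> length \<gamma>"
  shows "sum_list (take i \<gamma>) < sum_list (take j (\<gamma> :: nat list)) \<longleftrightarrow> i < j"
  using sum_list_take_less[OF assms(1), of i j] sum_list_take_less[OF assms(1), of j i] assms(2,3)
  by (cases i j rule: linorder_cases) auto

lemma comp_set_image: "comp_set \<gamma> = (\<lambda>i. sum_list (take i \<gamma>)) ` {1..<length \<gamma>}"
  by (auto simp: comp_set_def)

lemma inj_on_sum_take: "0 \<notin> set \<gamma> \<Longrightarrow> inj_on (\<lambda>i. sum_list (take i (\<gamma> :: nat list))) {..length \<gamma>}"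
  by (rule inj_onI) (metis atMost_iff less_irrefl linorder_neqE_nat sum_list_take_less_iff)

lemma card_comp_set: "0 \<notin> set \<gamma> \<Longrightarrow> card (comp_set \<gamma>) = length \<gamma> - 1"
  unfolding comp_set_image
  by (subst card_image) (auto intro: inj_on_subset[OF inj_on_sum_take])

lemma finite_comp_set: "finite (comp_set \<gamma>)"
  unfolding comp_set_image by simp

lemma comp_set_subset:
  assumes "\<gamma> \<in> compositions n"
  shows "comp_set \<gamma> \<subseteq> {1..<n}"
proof
  fix g assume "g \<in> comp_set \<gamma>"
  then obtain i where i: "1 \<le> i" "i < length \<gamma>" "g = sum_list (take i \<gamma>)" by (auto simp: comp_set_def)
  have p: "0 \<notin> set \<gamma>" "sum_list \<gamma> = n" using assms by (auto simp: compositions_pos)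
  show "g \<in> {1..<n}"
    using sum_list_take_less[OF p(1), of 0 i] sum_list_take_less[OF p(1), of i "length \<gamma>"] i p by auto
qed

lemma comp_of_set_comp_set:
  assumes "1 \<le> n" "\<gamma> \<in> compositions n"
  shows "comp_of_set n (comp_set \<gamma>) = \<gamma>"
proof -
  have p: "0 \<notin> set \<gamma>" "sum_list \<gamma> = n" using assms by (auto simp: compositions_pos)
  then have ne: "1 \<le> length \<gamma>" using assms by (cases \<gamma>) auto
  define xs where "xs = map (\<lambda>i. sum_list (take i \<gamma>)) [1..<length \<gamma>]"
  have "sorted_wrt (<) xs"
    unfolding sorted_wrt_iff_nth_less xs_def by (auto intro: sum_list_take_less[OF p(1)])
  moreover have "set xs = comp_set \<gamma>" by (simp add: xs_def comp_set_image)
  ultimately have xs: "sorted_list_of_set (comp_set \<gamma>) = xs"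
    using finite_comp_set by (metis sorted_list_of_set.idem_if_sorted_distinct strict_sorted_iff)
  have "map2 (-) (xs @ [n]) (0 # xs) = \<gamma>"
  proof (rule nth_equalityI)
    show "length (map2 (-) (xs @ [n]) (0 # xs)) = length \<gamma>" using ne by (simp add: xs_def)
    fix i assume "i < length (map2 (-) (xs @ [n]) (0 # xs))"
    then have i: "i < length \<gamma>" using ne by (simp add: xs_def)
    have "(xs @ [n]) ! i = sum_list (take (Suc i) \<gamma>)"
      using i ne p by (cases "Suc i = length \<gamma>") (auto simp: xs_def nth_append)
    moreover have "(0 # xs) ! i = sum_list (take i \<gamma>)" using i by (cases i) (auto simp: xs_def)
    ultimately show "map2 (-) (xs @ [n]) (0 # xs) ! i = \<gamma> ! i"
      using i ne by (simp add: xs_def take_Suc_conv_app_nth)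
  qed
  then show ?thesis by (simp add: comp_of_set_def xs)
qed

lemma comp_of_set:
  assumes "1 \<le> n" "X \<subseteq> {1..<n}"
  shows "comp_of_set n X \<in> compositions n" "comp_set (comp_of_set n X) = X"
proof -
  define xs where "xs = sorted_list_of_set X"
  define \<gamma> where "\<gamma> = map2 (-) (xs @ [n]) (0 # xs)"
  have fin: "finite X" using assms finite_subset by blast
  have s: "sorted_wrt (<) (0 # xs @ [n])" "set xs = X"
    using assms fin by (auto simp: xs_def sorted_wrt_append)
  have len: "length \<gamma> = Suc (length xs)" by (simp add: \<gamma>_def)
  have nth: "\<gamma> ! i = (0 # xs @ [n]) ! Suc i - (0 # xs @ [n]) ! i" if "i < length \<gamma>" for i
  proof -
    have "(0 # xs) ! i = (0 # xs @ [n]) ! i" using that len by (cases i) (auto simp: nth_append)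
    then show ?thesis using that by (simp add: \<gamma>_def)
  qed
  have step: "(0 # xs @ [n]) ! i < (0 # xs @ [n]) ! Suc i" if "i < length \<gamma>" for i
    using s(1)[unfolded sorted_wrt_iff_nth_less, rule_format, of i "Suc i"] that len by simp
  have sum: "sum_list (take i \<gamma>) = (0 # xs @ [n]) ! i" if "i \<le> length \<gamma>" for i
    using that
  proof (induction i)
    case (Suc i)
    then show ?case using nth[of i] step[of i] by (simp add: take_Suc_conv_app_nth del: nth_Cons_Suc)
  qed simp
  have "0 \<notin> set \<gamma>" using nth step by (force simp: in_set_conv_nth)
  moreover have "sum_list \<gamma> = n" using sum[of "length \<gamma>"] len by simp
  ultimately have "\<gamma> \<in> compositions n" by (simp add: compositions_pos)
  then show "comp_of_set n X \<in> compositions n" by (simp add: comp_of_set_def \<gamma>_def xs_def Let_def)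
  have "comp_set \<gamma> = (\<lambda>i. (0 # xs @ [n]) ! i) ` {1..<length \<gamma>}"
    unfolding comp_set_image using sum by (intro image_cong) auto
  also have "\<dots> = (\<lambda>i. xs ! i) ` {..<length xs}"
  proof -
    have "{1..<length \<gamma>} = Suc ` {..<length xs}" using len by (simp add: image_Suc_lessThan atLeastLessThanSuc_atLeastAtMost)
    then show ?thesis by (simp add: image_image nth_append)
  qed
  also have "\<dots> = X" using s(2) by (auto simp: set_conv_nth)
  finally show "comp_set (comp_of_set n X) = X" by (simp add: comp_of_set_def \<gamma>_def xs_def Let_def)
qed

text \<open>The blocks that are summed up to a partial sum of the coarser composition form a prefix
  of the finer one.\<close>

lemma refines_imp_comp_set_subset:
  assumes "refines \<gamma> \<delta>"
  shows "comp_set \<delta> \<subseteq> comp_set \<gamma>"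
proof
  obtain bs where bs: "[] \<notin> set bs" "concat bs = \<gamma>" "map sum_list bs = \<delta>"
    using assms by (auto simp: refines_def)
  fix s assume "s \<in> comp_set \<delta>"
  then obtain i where i: "1 \<le> i" "i < length \<delta>" "s = sum_list (take i \<delta>)" by (auto simp: comp_set_def)
  define j where "j = length (concat (take i bs))"
  have g: "\<gamma> = concat (take i bs) @ concat (drop i bs)" using bs(2) by (metis append_take_drop_id concat_append)
  then have "take j \<gamma> = concat (take i bs)" by (simp add: j_def)
  moreover have "s = sum_list (concat (take i bs))"
    unfolding i(3) bs(3)[symmetric] take_map by (simp add: sum_list_concat)
  moreover have "concat (take i bs) \<noteq> []" "concat (drop i bs) \<noteq> []"
  proof -
    have l: "length bs = length \<delta>" using bs(3) by auto
    have "drop i bs = bs ! i # drop (Suc i) bs" using i l by (simp add: Cons_nth_drop_Suc)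
    moreover have "bs ! 0 \<in> set (take i bs)" using nth_mem[of 0 "take i bs"] i l by simp
    moreover have "bs ! 0 \<in> set bs" "bs ! i \<in> set bs" by (rule nth_mem; use i l in linarith)+
    then have "bs ! 0 \<noteq> []" "bs ! i \<noteq> []" using bs(1) by metis+
    ultimately show "concat (take i bs) \<noteq> []" "concat (drop i bs) \<noteq> []" by (simp_all only: concat_eq_Nil_conv) auto
  qed
  then have "1 \<le> j" "j < length \<gamma>" using g by (auto simp: j_def Suc_le_eq)
  ultimately show "s \<in> comp_set \<gamma>" unfolding comp_set_def by (intro CollectI exI[of _ j]) simp
qed

text \<open>The first part \<open>d\<close> is a partial sum of the finer composition, which is cut
  there. The other partial sums are shifted by \<open>d\<close>, and the induction continues behind
  the cut.\<close>

lemma comp_set_subset_imp_refines: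
  "0 \<notin> set \<gamma> \<Longrightarrow> 0 \<notin> set \<delta> \<Longrightarrow> sum_list \<gamma> = sum_list \<delta> \<Longrightarrow> comp_set \<delta> \<subseteq> comp_set \<gamma> \<Longrightarrow> refines \<gamma> \<delta>"
proof (induction \<delta> arbitrary: \<gamma>)
  case Nil
  then have "\<gamma> = []" by (cases \<gamma>) auto
  then show ?case by (simp add: refines_def)
next
  case (Cons d \<delta>)
  show ?case
  proof (cases "\<delta> = []")
    case True
    then have "\<gamma> \<noteq> []" using Cons by auto
    then show ?thesis using Cons True unfolding refines_def by (intro exI[of _ "[\<gamma>]"]) simp
  next
    case False
    then have "d \<in> comp_set (d # \<delta>)" unfolding comp_set_def by (intro CollectI exI[of _ 1]) auto
    then obtain j where j: "1 \<le> j" "j < length \<gamma>" "d = sum_list (take j \<gamma>)"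
      using Cons.prems(4) by (auto simp: comp_set_def)
    have td: "sum_list (take j \<gamma>) + sum_list (drop j \<gamma>) = sum_list \<gamma>"
      by (metis append_take_drop_id sum_list_append)
    have "comp_set \<delta> \<subseteq> comp_set (drop j \<gamma>)"
    proof
      fix s assume "s \<in> comp_set \<delta>"
      then obtain i where i: "1 \<le> i" "i < length \<delta>" "s = sum_list (take i \<delta>)" by (auto simp: comp_set_def)
      then have "d + s \<in> comp_set (d # \<delta>)" unfolding comp_set_def by (intro CollectI exI[of _ "Suc i"]) auto
      then obtain k where k: "1 \<le> k" "k < length \<gamma>" "d + s = sum_list (take k \<gamma>)"
        using Cons.prems(4) by (auto simp: comp_set_def)
      have "0 < s" using sum_list_take_less[of \<delta> 0 i] Cons.prems(2) i by simp
      then have jk: "j < k" using sum_list_take_less_iff[of \<gamma> j k] Cons.prems(1) j k by simp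
      then have "take k \<gamma> = take j \<gamma> @ take (k - j) (drop j \<gamma>)" by (metis le_add_diff_inverse less_imp_le take_add)
      then have "s = sum_list (take (k - j) (drop j \<gamma>))" using k(3) j(3) by simp
      then show "s \<in> comp_set (drop j \<gamma>)" unfolding comp_set_def using jk k(2)
        by (intro CollectI exI[of _ "k - j"]) auto
    qed
    moreover have "0 \<notin> set (drop j \<gamma>)" using Cons.prems(1) by (meson in_set_dropD)
    ultimately have "refines (drop j \<gamma>) \<delta>"
      using Cons.IH[of "drop j \<gamma>"] Cons.prems(2,3) td j(3) by simp
    then obtain bs where "[] \<notin> set bs" "concat bs = drop j \<gamma>" "map sum_list bs = \<delta>" by (auto simp: refines_def)
    then show ?thesis unfolding refines_def using j by (intro exI[of _ "take j \<gamma> # bs"]) auto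
  qed
qed

text \<open>The nonzero exponents in the order of the variables: the only composition whose monomial
  function can contain \<open>m\<close>.\<close>

definition exponents :: "(nat \<Rightarrow>\<^sub>0 nat) \<Rightarrow> nat list" where
  "exponents m = map (Poly_Mapping.lookup m) (sorted_list_of_set (Poly_Mapping.keys m))"

lemma lookup_sum_single:
  assumes "distinct xs" "length xs = length \<gamma>"
  shows "Poly_Mapping.lookup (\<Sum>j<length \<gamma>. Poly_Mapping.single (xs ! j) (\<gamma> ! j)) x =
    (if x \<in> set xs then \<gamma> ! (THE j. j < length xs \<and> xs ! j = x) else 0)"
proof -
  have *: "Poly_Mapping.lookup (\<Sum>j<length \<gamma>. Poly_Mapping.single (xs ! j) (\<gamma> ! j)) x =
      (\<Sum>j<length \<gamma>. if xs ! j = x then \<gamma> ! j else 0)"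
    by (simp add: lookup_sum lookup_single when_def)
  show ?thesis
  proof (cases "x \<in> set xs")
    case True
    then obtain i where i: "i < length xs" "xs ! i = x" by (auto simp: in_set_conv_nth)
    have "(THE j. j < length xs \<and> xs ! j = x) = i"
      using i assms(1) by (intro the_equality) (auto simp: nth_eq_iff_index_eq)
    moreover have "(\<Sum>j<length \<gamma>. if xs ! j = x then \<gamma> ! j else 0) = (\<Sum>j<length \<gamma>. if j = i then \<gamma> ! j else 0)"
      using i assms by (intro sum.cong) (auto simp: nth_eq_iff_index_eq)
    ultimately show ?thesis using * True i assms by simp
  next
    case False
    then have "(\<Sum>j<length \<gamma>. if xs ! j = x then \<gamma> ! j else 0) = 0"
      using assms(2) by (intro sum.neutral) auto
    then show ?thesis using * False by simp
  qed
qed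

text \<open>The indices must be the variables that occur in \<open>m\<close>, in increasing order,
  so at most one summand equals \<open>m\<close>. The variable with index 0 never occurs.\<close>

lemma monomial_qsym_eq:
  assumes g: "0 \<notin> set \<gamma>"
  shows "monomial_qsym \<gamma> m = (if Poly_Mapping.lookup m 0 = 0 \<and> \<gamma> = exponents m then 1 else 0)"
proof -
  let ?S = "{xs. length xs = length \<gamma> \<and> sorted_wrt (<) xs \<and> (\<forall>i\<in>set xs. 1 \<le> i) \<and>
     m = (\<Sum>j<length \<gamma>. Poly_Mapping.single (xs ! j) (\<gamma> ! j))}"
  let ?K = "sorted_list_of_set (Poly_Mapping.keys m)"
  have A: "xs = ?K \<and> \<gamma> = exponents m \<and> Poly_Mapping.lookup m 0 = 0" if "xs \<in> ?S" for xs
  proof -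
    have x: "length xs = length \<gamma>" "sorted_wrt (<) xs" "\<forall>i\<in>set xs. 1 \<le> i"
      "m = (\<Sum>j<length \<gamma>. Poly_Mapping.single (xs ! j) (\<gamma> ! j))" using that by auto
    have d: "distinct xs" using x(2) strict_sorted_iff by blast
    have l: "Poly_Mapping.lookup m (xs ! j) = \<gamma> ! j" if "j < length xs" for j
    proof -
      have "(THE i. i < length xs \<and> xs ! i = xs ! j) = j"
        using that d by (intro the_equality) (auto simp: nth_eq_iff_index_eq)
      then show ?thesis unfolding x(4) using lookup_sum_single[OF d x(1), of "xs ! j"] that by simp
    qed
    have l0: "Poly_Mapping.lookup m i = 0" if "i \<notin> set xs" for i
      unfolding x(4) using lookup_sum_single[OF d x(1), of i] that by simp
    have "Poly_Mapping.keys m = set xs"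
    proof (intro equalityI subsetI)
      fix i assume "i \<in> Poly_Mapping.keys m" then show "i \<in> set xs" using l0[of i] by (auto simp: in_keys_iff)
    next
      fix i assume "i \<in> set xs"
      then obtain j where "j < length xs" "i = xs ! j" by (auto simp: in_set_conv_nth)
      then show "i \<in> Poly_Mapping.keys m" using l[of j] g x(1) by (auto simp: in_keys_iff in_set_conv_nth)
    qed
    then have k: "?K = xs" using x(2) d by (simp add: sorted_list_of_set.idem_if_sorted_distinct strict_sorted_iff)
    moreover have "\<gamma> = exponents m" unfolding exponents_def k
      using x(1) l by (intro nth_equalityI) auto
    moreover have "Poly_Mapping.lookup m 0 = 0" using l0[of 0] x(3) by auto
    ultimately show ?thesis by simp
  qed
  have B: "?K \<in> ?S" if "Poly_Mapping.lookup m 0 = 0" "\<gamma> = exponents m"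
  proof -
    have len: "length ?K = length \<gamma>" using that by (simp add: exponents_def)
    have "\<forall>i\<in>set ?K. 1 \<le> i" using that(1) by (auto simp: in_keys_iff Suc_le_eq) (metis not_gr_zero)
    moreover have "m = (\<Sum>j<length \<gamma>. Poly_Mapping.single (?K ! j) (\<gamma> ! j))"
    proof (rule poly_mapping_eqI)
      fix x
      show "Poly_Mapping.lookup m x = Poly_Mapping.lookup (\<Sum>j<length \<gamma>. Poly_Mapping.single (?K ! j) (\<gamma> ! j)) x"
      proof (cases "x \<in> Poly_Mapping.keys m")
        case True
        then obtain i where i: "i < length ?K" "?K ! i = x"
          by (metis finite_keys in_set_conv_nth set_sorted_list_of_set)
        have "(THE j. j < length ?K \<and> ?K ! j = x) = i"
          using i by (intro the_equality) (auto simp: nth_eq_iff_index_eq[OF distinct_sorted_list_of_set])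
        then have "Poly_Mapping.lookup (\<Sum>j<length \<gamma>. Poly_Mapping.single (?K ! j) (\<gamma> ! j)) x = \<gamma> ! i"
          using lookup_sum_single[OF distinct_sorted_list_of_set len, of x] True by simp
        then show ?thesis using that(2) i by (simp add: exponents_def)
      next
        case False
        then show ?thesis using lookup_sum_single[OF distinct_sorted_list_of_set len, of x] by (simp add: in_keys_iff)
      qed
    qed
    ultimately show ?thesis using len by simp
  qed
  have "?S = (if Poly_Mapping.lookup m 0 = 0 \<and> \<gamma> = exponents m then {?K} else {})"
    using A B by (auto split: if_splits)
  then show ?thesis unfolding monomial_qsym_def by simp
qed

text \<open>Each \<open>p\<close> in \<open>P\<close> halves the number of subsets, because toggling
  an element of \<open>{p - 1, p}\<close> that lies in \<open>G\<close> exchanges the sets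
  satisfying its condition with those that do not. Elements of \<open>P\<close> are not adjacent, so
  the pairs are disjoint and no other condition is affected. Multiplying by
  \<open>2 ^ card P\<close> avoids a division.\<close>

lemma card_xor_subsets:
  fixes P G :: "nat set"
  assumes "finite P" "finite G" "\<forall>p\<in>P. 1 \<le> p \<and> Suc p \<notin> P"
  shows "2 ^ card P * card {X. X \<subseteq> G \<and> (\<forall>p\<in>P. (p \<in> X) \<noteq> (p - 1 \<in> X))} =
    (if \<forall>p\<in>P. p \<in> G \<or> p - 1 \<in> G then 2 ^ card G else 0)"
  using assms(1,3)
proof (induction P)
  case empty
  have "{X. X \<subseteq> G} = Pow G" by auto
  then show ?case using assms(2) by (simp add: card_Pow)
next
  case (insert q P)
  let ?F = "{X. X \<subseteq> G \<and> (\<forall>p\<in>P. (p \<in> X) \<noteq> (p - 1 \<in> X))}"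
  let ?A = "{X \<in> ?F. (q \<in> X) \<noteq> (q - 1 \<in> X)}" and ?B = "{X \<in> ?F. (q \<in> X) = (q - 1 \<in> X)}"
  have fin: "finite ?F" by (rule finite_subset[of _ "Pow G"]) (use assms(2) in auto)
  have A: "{X. X \<subseteq> G \<and> (\<forall>p\<in>insert q P. (p \<in> X) \<noteq> (p - 1 \<in> X))} = ?A" by blast
  have IH: "2 ^ card P * card ?F = (if \<forall>p\<in>P. p \<in> G \<or> p - 1 \<in> G then 2 ^ card G else 0)"
    using insert by auto
  have q: "1 \<le> q" "Suc q \<notin> P" "q \<notin> P" "q - 1 \<notin> P" 
  proof -
    show "1 \<le> q" "Suc q \<notin> P" "q \<notin> P" using insert(2,4) by auto
    show "q - 1 \<notin> P"
    proof
      assume "q - 1 \<in> P"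
      then have "Suc (q - 1) \<notin> insert q P" using insert(4) by blast
      then show False using \<open>1 \<le> q\<close> by simp
    qed
  qed
  show ?case
  proof (cases "q \<in> G \<or> q - 1 \<in> G")
    case True
    \<comment> \<open>An element of the pair that is available for toggling. If there is none,
      neither \<open>q\<close> nor \<open>q - 1\<close> belongs to a subset of \<open>G\<close>, and
      the condition at \<open>q\<close> fails for all of them.\<close>
    define t where "t = (if q \<in> G then q else q - 1)"
    have t: "t \<in> G" "t = q \<or> t = q - 1" using True by (auto simp: t_def)
    define g where "g X = (if t \<in> X then X - {t} else insert t X)" for X
    have gg: "g (g X) = X" for X by (auto simp: g_def)
    have gmem: "p \<in> g X \<longleftrightarrow> (if p = t then t \<notin> X else p \<in> X)" for p X by (auto simp: g_def)
    have gF: "g X \<in> ?F" if "X \<in> ?F" for X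
    proof -
      have "(p \<in> g X) \<noteq> (p - 1 \<in> g X)" if "p \<in> P" for p
      proof -
        have "p \<noteq> t" using \<open>p \<in> P\<close> t q by auto
        moreover have "p - 1 \<noteq> t"
        proof
          assume "p - 1 = t"
          moreover have "1 \<le> p" using \<open>p \<in> P\<close> insert(4) by auto
          ultimately have "p = Suc t" by simp
          then show False using \<open>p \<in> P\<close> t q by auto
        qed
        ultimately show ?thesis using \<open>X \<in> ?F\<close> \<open>p \<in> P\<close> gmem by auto
      qed
      moreover have "g X \<subseteq> G" using that t by (auto simp: g_def)
      ultimately show ?thesis by blast
    qed
    have gq: "((q \<in> g X) = (q - 1 \<in> g X)) \<longleftrightarrow> ((q \<in> X) \<noteq> (q - 1 \<in> X))" for X
      using t q(1) gmem by auto
    have "bij_betw g ?A ?B"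
    proof (rule bij_betw_byWitness[where f' = g])
      show "g ` ?A \<subseteq> ?B"
      proof (rule image_subsetI)
        fix X assume "X \<in> ?A" then show "g X \<in> ?B" using gF[of X] gq[of X] by blast
      qed
      show "g ` ?B \<subseteq> ?A"
      proof (rule image_subsetI)
        fix X assume "X \<in> ?B" then show "g X \<in> ?A" using gF[of X] gq[of X] by blast
      qed
    qed (use gg in auto)
    then have "card ?A = card ?B" by (rule bij_betw_same_card)
    moreover have "card ?F = card ?A + card ?B"
    proof -
      have f: "finite ?A" "finite ?B" by (rule finite_subset[OF _ fin]; blast)+
      have U: "?F = ?A \<union> ?B" by blast
      have c: "card (?A \<union> ?B) = card ?A + card ?B" by (rule card_Un_disjoint[OF f]) blast
      show ?thesis by (rule trans[OF arg_cong[OF U, of card] c])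
    qed
    ultimately have "2 ^ card (insert q P) * card ?A = 2 ^ card P * card ?F"
      using insert(1,2) by simp
    then show ?thesis unfolding A using IH True by simp
  next
    case False
    then have e: "?A = {}" by blast
    have "card {X. X \<subseteq> G \<and> (\<forall>p\<in>insert q P. (p \<in> X) \<noteq> (p - 1 \<in> X))} = 0" unfolding A e by simp
    then show ?thesis using False by simp
  qed
qed

text \<open>Only the summand \<open>\<beta> = exponents m\<close> contributes, and refinement is
  inclusion of partial sums.\<close>

lemma fundamental_qsym_eq:
  assumes "\<delta> \<in> compositions n"
  shows "fundamental_qsym \<delta> m = (if Poly_Mapping.lookup m 0 = 0 \<and> exponents m \<in> compositions n \<and>
    comp_set \<delta> \<subseteq> comp_set (exponents m) then 1 else 0)"
proof -
  let ?R = "{\<beta>. \<beta> \<in> compositions (sum_list \<delta>) \<and> refines \<beta> \<delta>}"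
  have n: "sum_list \<delta> = n" using assms by (simp add: compositions_pos)
  have fin: "finite ?R" using finite_compositions by simp
  have "fundamental_qsym \<delta> m =
      (\<Sum>\<beta>\<in>?R. if \<beta> = exponents m then (if Poly_Mapping.lookup m 0 = 0 then 1 else 0) else 0)"
    unfolding fundamental_qsym_def
    by (intro sum.cong) (auto simp: monomial_qsym_eq compositions_pos)
  also have "\<dots> = (if exponents m \<in> ?R then (if Poly_Mapping.lookup m 0 = 0 then 1 else 0) else 0)"
    using fin by (simp add: sum.delta)
  also have "exponents m \<in> ?R \<longleftrightarrow> exponents m \<in> compositions n \<and> comp_set \<delta> \<subseteq> comp_set (exponents m)"
    using comp_set_subset_imp_refines[of "exponents m" \<delta>] refines_imp_comp_set_subset[of "exponents m" \<delta>] assms n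
    by (auto simp: compositions_pos)
  finally show ?thesis by auto
qed

lemma bij_betw_comp_set:
  assumes "1 \<le> n"
  shows "bij_betw comp_set (compositions n) (Pow {1..<n})"
proof (rule bij_betw_byWitness[where f' = "comp_of_set n"])
  show "comp_set ` compositions n \<subseteq> Pow {1..<n}" using comp_set_subset by blast
qed (use comp_of_set_comp_set[OF assms] comp_of_set[OF assms] in auto)

text \<open>The coefficient counts the subsets of \<open>comp_set (exponents m)\<close> that contain
  exactly one of \<open>p - 1\<close> and \<open>p\<close> for each peak \<open>p\<close>. By
  \<open>card_xor_subsets\<close> the factor \<open>2 ^ card P\<close> is absorbed, and the
  remaining factor 2 turns the exponent \<open>card G\<close> into the number
  \<open>card G + 1\<close> of parts.\<close>

lemma peak_qsym_eq:
  assumes n: "1 \<le> n" and D: "D \<subseteq> {1..<n}"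
  shows "peak_qsym (comp_of_set n (Peak D)) m =
    (if Poly_Mapping.lookup m 0 = 0 \<and> exponents m \<in> compositions n \<and>
       (\<forall>p\<in>Peak D. p \<in> comp_set (exponents m) \<or> p - 1 \<in> comp_set (exponents m))
     then 2 ^ length (exponents m) else 0)"
proof -
  define P where "P = Peak D"
  define \<gamma> where "\<gamma> = exponents m"
  define G where "G = comp_set \<gamma>"
  have P: "P \<subseteq> {1..<n}" "\<forall>p\<in>P. 1 \<le> p \<and> Suc p \<notin> P" "\<forall>p\<in>P. 2 \<le> p"
    using D by (auto simp: P_def Peak_def)
  \<comment> \<open>Two peaks are never adjacent, so every element of a peak set is a peak of it;
    the exponent in \<open>peak_qsym\<close> is therefore \<open>card P + 1\<close>.\<close>
  have PP: "Peak P = P" using D by (auto simp: P_def Peak_def)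
  have cP: "comp_of_set n P \<in> compositions n" "comp_set (comp_of_set n P) = P"
    using comp_of_set[OF n P(1)] by auto
  let ?Q = "\<lambda>X. P \<subseteq> (X - Suc ` X) \<union> (Suc ` X - X)"
  have Q: "?Q X \<longleftrightarrow> (\<forall>p\<in>P. (p \<in> X) \<noteq> (p - 1 \<in> X))" for X
  proof -
    have "p \<in> Suc ` X \<longleftrightarrow> p - 1 \<in> X" if "p \<in> P" for p
      using P(3) that by (cases p) auto
    then show ?thesis by blast
  qed
  have "peak_qsym (comp_of_set n P) m =
      2 ^ (card P + 1) * (\<Sum>\<beta> | \<beta> \<in> compositions n \<and> ?Q (comp_set \<beta>). fundamental_qsym \<beta> m)"
    using cP unfolding peak_qsym_def by (simp add: PP compositions_pos)
  also have "(\<Sum>\<beta> | \<beta> \<in> compositions n \<and> ?Q (comp_set \<beta>). fundamental_qsym \<beta> m) =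
      (\<Sum>\<beta> | \<beta> \<in> compositions n \<and> ?Q (comp_set \<beta>). if Poly_Mapping.lookup m 0 = 0 \<and> \<gamma> \<in> compositions n \<and>
    comp_set \<beta> \<subseteq> G then 1 else 0)"
    by (intro sum.cong) (auto simp: fundamental_qsym_eq \<gamma>_def G_def)
  also have "\<dots> = (if Poly_Mapping.lookup m 0 = 0 \<and> \<gamma> \<in> compositions n
      then int (card {\<beta> \<in> compositions n. ?Q (comp_set \<beta>) \<and> comp_set \<beta> \<subseteq> G}) else 0)"
  proof (cases "Poly_Mapping.lookup m 0 = 0 \<and> \<gamma> \<in> compositions n")
    case True
    have "finite {\<beta>. \<beta> \<in> compositions n \<and> ?Q (comp_set \<beta>)}" using finite_compositions[of n] by simp
    note sum.inter_filter[OF this, of "\<lambda>_. 1 :: int" "\<lambda>\<beta>. comp_set \<beta> \<subseteq> G"]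
    moreover have "{\<beta> \<in> {\<beta>. \<beta> \<in> compositions n \<and> ?Q (comp_set \<beta>)}. comp_set \<beta> \<subseteq> G} =
       {\<beta> \<in> compositions n. ?Q (comp_set \<beta>) \<and> comp_set \<beta> \<subseteq> G}" by blast
    ultimately show ?thesis using True by simp
  next
    case False
    show ?thesis unfolding if_not_P[OF False] by (rule sum.neutral) (use False in auto)
  qed
  finally have E: "peak_qsym (comp_of_set n P) m = 2 ^ (card P + 1) * (if Poly_Mapping.lookup m 0 = 0 \<and> \<gamma> \<in> compositions n
      then int (card {\<beta> \<in> compositions n. ?Q (comp_set \<beta>) \<and> comp_set \<beta> \<subseteq> G}) else 0)" .
  show ?thesis
  proof (cases "Poly_Mapping.lookup m 0 = 0 \<and> \<gamma> \<in> compositions n")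
    case True
    have Gn: "G \<subseteq> {1..<n}" "finite G" using comp_set_subset True finite_comp_set by (auto simp: G_def)
    have "bij_betw comp_set {\<beta> \<in> compositions n. ?Q (comp_set \<beta>) \<and> comp_set \<beta> \<subseteq> G}
       {X \<in> Pow {1..<n}. ?Q X \<and> X \<subseteq> G}"
      by (rule bij_betw_Collect[OF bij_betw_comp_set[OF n]]) simp
    then have "card {\<beta> \<in> compositions n. ?Q (comp_set \<beta>) \<and> comp_set \<beta> \<subseteq> G} = card {X \<in> Pow {1..<n}. ?Q X \<and> X \<subseteq> G}"
      by (rule bij_betw_same_card)
    also have "{X \<in> Pow {1..<n}. ?Q X \<and> X \<subseteq> G} = {X. X \<subseteq> G \<and> (\<forall>p\<in>P. (p \<in> X) \<noteq> (p - 1 \<in> X))}"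
      unfolding Q using Gn by auto
    finally have "2 ^ card P * card {\<beta> \<in> compositions n. ?Q (comp_set \<beta>) \<and> comp_set \<beta> \<subseteq> G} =
        (if \<forall>p\<in>P. p \<in> G \<or> p - 1 \<in> G then 2 ^ card G else 0)"
      using card_xor_subsets[OF _ Gn(2) P(2)] finite_subset[OF P(1)] by simp
    then have K: "2 ^ card P * int (card {\<beta> \<in> compositions n. ?Q (comp_set \<beta>) \<and> comp_set \<beta> \<subseteq> G}) =
        (if \<forall>p\<in>P. p \<in> G \<or> p - 1 \<in> G then 2 ^ card G else 0)"
      by (metis (mono_tags, lifting) of_nat_0 of_nat_mult of_nat_numeral of_nat_power)
    have "peak_qsym (comp_of_set n P) m =
        2 * (2 ^ card P * int (card {\<beta> \<in> compositions n. ?Q (comp_set \<beta>) \<and> comp_set \<beta> \<subseteq> G}))"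
      unfolding E if_P[OF True] by simp
    note this[unfolded K]
    moreover have "length \<gamma> = Suc (card G)"
    proof -
      have "0 \<notin> set \<gamma>" "\<gamma> \<noteq> []" using True n by (auto simp: compositions_pos)
      then show ?thesis using card_comp_set[of \<gamma>] by (cases \<gamma>) (auto simp: G_def)
    qed
    ultimately show ?thesis using True unfolding P_def[symmetric] \<gamma>_def[symmetric] G_def[symmetric] by simp
  next
    case False
    then show ?thesis using E unfolding P_def[symmetric] \<gamma>_def[symmetric] G_def[symmetric] by auto
  qed
qed

section \<open>Standardization of marked tableaux\<close>

text \<open>Concerns two consecutive entries of a standard tableau that get the same number;
  \<open>True\<close> means unmarked, and \<open>d\<close> means that the later entry lies in a
  higher row. Marked letters precede unmarked ones, equal marked letters move strictly up, and equal
  unmarked ones do not move up. Where the marking changes, \<open>d\<close> is free.\<close>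

definition unmark_ok :: "bool \<Rightarrow> bool \<Rightarrow> bool \<Rightarrow> bool" where
  "unmark_ok d a b \<longleftrightarrow> (a \<longrightarrow> b) \<and> (a = b \<longrightarrow> (d \<longleftrightarrow> \<not> a))"

text \<open>Bit \<open>i - 1\<close> belongs to entry \<open>i\<close>. For \<open>i \<in> G\<close>
  a new number begins with entry \<open>i + 1\<close>, so nothing relates the two bits.\<close>

definition unmarkings :: "nat set \<Rightarrow> nat set \<Rightarrow> nat \<Rightarrow> bool list set" where
  "unmarkings D G n = {B. length B = n \<and>
     (\<forall>i. 1 \<le> i \<and> i < n \<and> i \<notin> G \<longrightarrow> unmark_ok (i \<in> D) (B ! (i - 1)) (B ! i))}"

lemma finite_unmarkings: "finite (unmarkings D G n)"
  by (rule finite_subset[OF _ finite_lists_length_eq[of "UNIV :: bool set" n]]) (auto simp: unmarkings_def)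

lemma unmarkings_snoc:
  assumes "1 \<le> n"
  shows "B @ [b] \<in> unmarkings D G (Suc n) \<longleftrightarrow> B \<in> unmarkings D G n \<and> (n \<notin> G \<longrightarrow> unmark_ok (n \<in> D) (last B) b)"
proof -
  have "(B @ [b]) ! i = B ! i" if "i < length B" for i using that by (simp add: nth_append)
  moreover have "B ! (n - 1) = last B" if "length B = n" using that assms by (subst last_conv_nth) auto
  ultimately show ?thesis
    using assms unfolding unmarkings_def by (auto simp: less_Suc_eq)
qed

text \<open>Recursion on the last bit. A non-descent inside a block forces the last entry to be
  unmarked; after a descent or a block boundary both values of the last bit are equally frequent. A
  descent that follows a non-descent within one block leaves no marking at all, and this is a peak
  interior to the block.\<close>

lemma card_unmarkings_aux:
  assumes "1 \<le> n"
  shows "card {B \<in> unmarkings D G n. last B = b} =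
    (if \<forall>p\<in>Peak D. p < n \<longrightarrow> p \<in> G \<or> p - 1 \<in> G then
       if 2 \<le> n \<and> n - 1 \<notin> G \<and> n - 1 \<notin> D then (if b then 2 ^ Suc (card (G \<inter> {1..<n})) else 0)
       else 2 ^ card (G \<inter> {1..<n})
     else 0)"
  using assms
proof (induction n arbitrary: b rule: dec_induct)
  case base
  have "{B \<in> unmarkings D G 1. last B = b} = {[b]}"
    by (auto simp: unmarkings_def length_Suc_conv)
  then show ?case by (auto simp: Peak_def)
next
  case (step n)
  let ?N = "\<lambda>b. card {B \<in> unmarkings D G n. last B = b}"
  have img: "{B \<in> unmarkings D G (Suc n). last B = b} =
     (\<lambda>B. B @ [b]) ` {B \<in> unmarkings D G n. n \<notin> G \<longrightarrow> unmark_ok (n \<in> D) (last B) b}"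
  proof (intro equalityI subsetI)
    fix B assume B: "B \<in> {B \<in> unmarkings D G (Suc n). last B = b}"
    then have "length B = Suc n" by (auto simp: unmarkings_def)
    then obtain B' where "B = B' @ [b]" using B by (cases B rule: rev_cases) auto
    then show "B \<in> (\<lambda>B. B @ [b]) ` {B \<in> unmarkings D G n. n \<notin> G \<longrightarrow> unmark_ok (n \<in> D) (last B) b}"
      using B unmarkings_snoc[OF step(1), of B' b] by auto
  qed (use unmarkings_snoc[OF step(1)] in auto)
  have "card {B \<in> unmarkings D G (Suc n). last B = b} =
      card {B \<in> unmarkings D G n. n \<notin> G \<longrightarrow> unmark_ok (n \<in> D) (last B) b}"
    unfolding img by (rule card_image) (simp add: inj_on_def)
  also have "{B \<in> unmarkings D G n. n \<notin> G \<longrightarrow> unmark_ok (n \<in> D) (last B) b} =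
     {B \<in> unmarkings D G n. last B = False \<and> (n \<notin> G \<longrightarrow> unmark_ok (n \<in> D) False b)} \<union>
     {B \<in> unmarkings D G n. last B = True \<and> (n \<notin> G \<longrightarrow> unmark_ok (n \<in> D) True b)}"
    (is "?U = ?V \<union> ?W")
  proof (rule set_eqI)
    show "B \<in> ?U \<longleftrightarrow> B \<in> ?V \<union> ?W" for B by (cases "last B") auto
  qed
  also have "card \<dots> = card {B \<in> unmarkings D G n. last B = False \<and> (n \<notin> G \<longrightarrow> unmark_ok (n \<in> D) False b)} +
     card {B \<in> unmarkings D G n. last B = True \<and> (n \<notin> G \<longrightarrow> unmark_ok (n \<in> D) True b)}"
    by (rule card_Un_disjoint) (auto intro: finite_subset[OF _ finite_unmarkings[of D G n]])
  also have "\<dots> = (if n \<notin> G \<longrightarrow> unmark_ok (n \<in> D) False b then ?N False else 0) +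
     (if n \<notin> G \<longrightarrow> unmark_ok (n \<in> D) True b then ?N True else 0)" by auto
  finally have E: "card {B \<in> unmarkings D G (Suc n). last B = b} = \<dots>" .
  have n1: "1 \<le> n" by (rule step(1))
  have ok: "(\<forall>p\<in>Peak D. p < Suc n \<longrightarrow> p \<in> G \<or> p - 1 \<in> G) \<longleftrightarrow>
     (\<forall>p\<in>Peak D. p < n \<longrightarrow> p \<in> G \<or> p - 1 \<in> G) \<and> (n \<in> Peak D \<longrightarrow> n \<in> G \<or> n - 1 \<in> G)"
    using less_Suc_eq by auto
  have pk: "n \<in> Peak D \<longleftrightarrow> n \<in> D \<and> n - 1 \<notin> D \<and> 2 \<le> n" using n1 by (auto simp: Peak_def)
  have G: "card (G \<inter> {1..<Suc n}) = (if n \<in> G then 1 else 0) + card (G \<inter> {1..<n})"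
  proof -
    have "G \<inter> {1..<Suc n} = (if n \<in> G then insert n (G \<inter> {1..<n}) else G \<inter> {1..<n})" using n1 by (auto simp: less_Suc_eq)
    then show ?thesis by simp
  qed
  show ?case
  proof (cases "\<forall>p\<in>Peak D. p < n \<longrightarrow> p \<in> G \<or> p - 1 \<in> G")
    case False
    have N: "?N c = 0" for c unfolding step.IH if_not_P[OF False] by (rule refl)
    have "\<not> (\<forall>p\<in>Peak D. p < Suc n \<longrightarrow> p \<in> G \<or> p - 1 \<in> G)" using False ok by blast
    then show ?thesis unfolding E N if_not_P[OF \<open>\<not> (\<forall>p\<in>Peak D. p < Suc n \<longrightarrow> p \<in> G \<or> p - 1 \<in> G)\<close>] by simp
  next
    case True
    have N: "?N c = (if 2 \<le> n \<and> n - 1 \<notin> G \<and> n - 1 \<notin> D then (if c then 2 ^ Suc (card (G \<inter> {1..<n})) else 0)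
       else 2 ^ card (G \<inter> {1..<n}))" for c
      unfolding step.IH if_P[OF True] by (rule refl)
    define asc where "asc \<longleftrightarrow> 2 \<le> n \<and> n - 1 \<notin> G \<and> n - 1 \<notin> D"
    define c where "c = card (G \<inter> {1..<n})"
    have "(\<forall>p\<in>Peak D. p < Suc n \<longrightarrow> p \<in> G \<or> p - 1 \<in> G) \<longleftrightarrow> \<not> (asc \<and> n \<in> D \<and> n \<notin> G)"
      using True ok pk by (auto simp: asc_def)
    moreover have "2 \<le> Suc n \<and> Suc n - 1 \<notin> G \<and> Suc n - 1 \<notin> D \<longleftrightarrow> n \<notin> G \<and> n \<notin> D" using n1 by simp
    ultimately show ?thesis unfolding E G N asc_def[symmetric] c_def[symmetric]
      by (cases b; cases "n \<in> G"; cases "n \<in> D"; cases asc) (simp_all add: unmark_ok_def)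
  qed
qed

text \<open>In a compatible word each block has its descents before its non-descents, and the number
  of marked entries in the block is the number of its descents or one more: two markings for each of
  the \<open>card G + 1\<close> blocks.\<close>

lemma card_unmarkings:
  assumes "1 \<le> n" "D \<subseteq> {1..<n}" "G \<subseteq> {1..<n}"
  shows "card (unmarkings D G n) = (if \<forall>p\<in>Peak D. p \<in> G \<or> p - 1 \<in> G then 2 ^ Suc (card G) else 0)"
proof -
  have "unmarkings D G n = {B \<in> unmarkings D G n. last B = False} \<union> {B \<in> unmarkings D G n. last B = True}" by auto
  then have "card (unmarkings D G n) = card {B \<in> unmarkings D G n. last B = False} + card {B \<in> unmarkings D G n. last B = True}"
    using card_Un_disjoint[of "{B \<in> unmarkings D G n. last B = False}" "{B \<in> unmarkings D G n. last B = True}"]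
      finite_unmarkings[of D G n] by (metis (mono_tags, lifting) disjoint_iff finite_Un mem_Collect_eq)
  moreover have "G \<inter> {1..<n} = G" using assms by auto
  moreover have "(\<forall>p\<in>Peak D. p < n \<longrightarrow> p \<in> G \<or> p - 1 \<in> G) \<longleftrightarrow> (\<forall>p\<in>Peak D. p \<in> G \<or> p - 1 \<in> G)"
  proof -
    have "p < n" if "p \<in> Peak D" for p using assms(2) that by (auto simp: Peak_def)
    then show ?thesis by blast
  qed
  ultimately show ?thesis unfolding card_unmarkings_aux[OF assms(1)] by simp
qed

text \<open>If \<open>G\<close> consists of the partial sums of \<open>\<gamma>\<close>, this is the
  number of the part to which entry \<open>i\<close> belongs, hence its letter up to marking. The
  inequality is strict because a partial sum closes its own block.\<close>

definition block_index :: "nat set \<Rightarrow> nat \<Rightarrow> nat" where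
  "block_index G i = Suc (card {g \<in> G. g < i})"

lemma block_index_mono: "finite G \<Longrightarrow> i \<le> j \<Longrightarrow> block_index G i \<le> block_index G j"
  unfolding block_index_def by (auto intro!: card_mono)

lemma block_index_Suc: "finite G \<Longrightarrow> block_index G (Suc i) = (if i \<in> G then Suc (block_index G i) else block_index G i)"
proof -
  assume "finite G"
  moreover have "{g \<in> G. g < Suc i} = (if i \<in> G then insert i {g \<in> G. g < i} else {g \<in> G. g < i})"
    by (auto simp: less_Suc_eq)
  ultimately show ?thesis by (simp add: block_index_def)
qed

lemma block_index_comp_set:
  assumes g: "0 \<notin> set \<gamma>" and k: "k < length \<gamma>"
    and i: "sum_list (take k \<gamma>) < i" "i \<le> sum_list (take (Suc k) \<gamma>)"
  shows "block_index (comp_set \<gamma>) i = Suc k"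
proof -
  have "{g \<in> comp_set \<gamma>. g < i} = (\<lambda>j. sum_list (take j \<gamma>)) ` {1..<Suc k}"
  proof (intro equalityI subsetI)
    fix s assume "s \<in> {g \<in> comp_set \<gamma>. g < i}"
    then obtain j where j: "1 \<le> j" "j < length \<gamma>" "s = sum_list (take j \<gamma>)" "s < i" by (auto simp: comp_set_def)
    then have "j < Suc k" using sum_list_take_less_iff[OF g, of j "Suc k"] i k by simp
    then show "s \<in> (\<lambda>j. sum_list (take j \<gamma>)) ` {1..<Suc k}" using j by auto
  next
    fix s assume "s \<in> (\<lambda>j. sum_list (take j \<gamma>)) ` {1..<Suc k}"
    then obtain j where j: "1 \<le> j" "j < Suc k" "s = sum_list (take j \<gamma>)" by auto
    moreover have "s \<le> sum_list (take k \<gamma>)"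
      using sum_list_take_less[OF g, of j k] j k by (cases "j = k") auto
    ultimately show "s \<in> {g \<in> comp_set \<gamma>. g < i}" using i k by (auto simp: comp_set_def)
  qed
  moreover have "card ((\<lambda>j. sum_list (take j \<gamma>)) ` {1..<Suc k}) = k"
    by (subst card_image) (use k in \<open>auto intro: inj_on_subset[OF inj_on_sum_take[OF g]]\<close>)
  ultimately show ?thesis by (simp add: block_index_def)
qed

lemma block_exists:
  assumes "1 \<le> i" "i \<le> sum_list (\<gamma> :: nat list)"
  obtains k where "k < length \<gamma>" "sum_list (take k \<gamma>) < i" "i \<le> sum_list (take (Suc k) \<gamma>)"
proof -
  define m where "m = (LEAST m. i \<le> sum_list (take m \<gamma>))"
  have m: "i \<le> sum_list (take m \<gamma>)" unfolding m_def by (rule LeastI[of _ "length \<gamma>"]) (use assms in simp)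
  obtain k where k: "m = Suc k" using m assms by (cases m) auto
  have lt: "sum_list (take k \<gamma>) < i"
    using not_less_Least[of k "\<lambda>m. i \<le> sum_list (take m \<gamma>)"] k m_def by simp
  have "k < length \<gamma>" using m lt k by (rule_tac ccontr) simp
  then show thesis using that m lt k by blast
qed

lemma card_block:
  assumes g: "0 \<notin> set \<gamma>"
  shows "card {i \<in> {1..sum_list \<gamma>}. block_index (comp_set \<gamma>) i = Suc k} = nth_default 0 \<gamma> k"
proof (cases "k < length \<gamma>")
  case True
  have "{i \<in> {1..sum_list \<gamma>}. block_index (comp_set \<gamma>) i = Suc k} = {sum_list (take k \<gamma>)<..sum_list (take (Suc k) \<gamma>)}"
  proof (intro equalityI subsetI)
    fix i assume i: "i \<in> {i \<in> {1..sum_list \<gamma>}. block_index (comp_set \<gamma>) i = Suc k}"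
    then obtain j where j: "j < length \<gamma>" "sum_list (take j \<gamma>) < i" "i \<le> sum_list (take (Suc j) \<gamma>)"
      using block_exists[of i \<gamma>] by auto
    then have "j = k" using block_index_comp_set[OF g j] i by simp
    then show "i \<in> {sum_list (take k \<gamma>)<..sum_list (take (Suc k) \<gamma>)}" using j by simp
  next
    fix i assume i: "i \<in> {sum_list (take k \<gamma>)<..sum_list (take (Suc k) \<gamma>)}"
    have "sum_list (take (Suc k) \<gamma>) \<le> sum_list \<gamma>"
      using sum_list_take_less[OF g, of "Suc k" "length \<gamma>"] True by (cases "Suc k = length \<gamma>") auto
    then show "i \<in> {i \<in> {1..sum_list \<gamma>}. block_index (comp_set \<gamma>) i = Suc k}"
      using i block_index_comp_set[OF g True] by auto
  qed
  then show ?thesis using True by (simp add: take_Suc_conv_app_nth nth_default_def)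
next
  case False
  have "block_index (comp_set \<gamma>) i \<noteq> Suc k" if "i \<in> {1..sum_list \<gamma>}" for i
  proof -
    obtain j where "j < length \<gamma>" "sum_list (take j \<gamma>) < i" "i \<le> sum_list (take (Suc j) \<gamma>)"
      using block_exists[of i \<gamma>] \<open>i \<in> _\<close> by auto
    from block_index_comp_set[OF g this] show ?thesis using \<open>j < length \<gamma>\<close> False by simp
  qed
  then have "{i \<in> {1..sum_list \<gamma>}. block_index (comp_set \<gamma>) i = Suc k} = {}" by blast
  then show ?thesis using False by (simp add: nth_default_def)
qed

lemma bij_betw_rank:
  fixes f :: "'a \<Rightarrow> 'b :: linorder"
  assumes fin: "finite D" and inj: "inj_on f D"
  shows "bij_betw (\<lambda>b. card {b' \<in> D. f b' \<le> f b}) D {1..card D}"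
    and "\<And>b b'. b \<in> D \<Longrightarrow> b' \<in> D \<Longrightarrow> card {x \<in> D. f x \<le> f b} < card {x \<in> D. f x \<le> f b'} \<longleftrightarrow> f b < f b'"
proof -
  let ?r = "\<lambda>b. card {b' \<in> D. f b' \<le> f b}"
  have lt: "?r b < ?r b'" if "b \<in> D" "b' \<in> D" "f b < f b'" for b b'
  proof (rule psubset_card_mono)
    have "b' \<in> {x \<in> D. f x \<le> f b'} - {x \<in> D. f x \<le> f b}" using that by auto
    moreover have "{x \<in> D. f x \<le> f b} \<subseteq> {x \<in> D. f x \<le> f b'}" using that by auto
    ultimately show "{x \<in> D. f x \<le> f b} \<subset> {x \<in> D. f x \<le> f b'}" by blast
  qed (use fin in simp)
  show iff: "?r b < ?r b' \<longleftrightarrow> f b < f b'" if "b \<in> D" "b' \<in> D" for b b'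
  proof (cases "f b" "f b'" rule: linorder_cases)
    case less then show ?thesis using lt[OF that] by simp
  next
    case equal then show ?thesis using inj_onD[OF inj _ that] by simp
  next
    case greater then show ?thesis using lt[OF that(2,1)] by simp
  qed
  have i: "inj_on ?r D"
  proof (rule inj_onI)
    fix b b' assume A: "b \<in> D" "b' \<in> D" "?r b = ?r b'"
    have "f b = f b'"
      using lt[OF A(1,2)] lt[OF A(2,1)] A(3) by (cases "f b" "f b'" rule: linorder_cases) simp_all
    then show "b = b'" by (rule inj_onD[OF inj _ A(1,2)])
  qed
  have "?r ` D \<subseteq> {1..card D}"
  proof (rule image_subsetI)
    fix b assume "b \<in> D"
    then have "{b' \<in> D. f b' \<le> f b} \<noteq> {}" by auto
    then have "0 < ?r b" using fin by (simp add: card_gt_0_iff)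
    moreover have "?r b \<le> card D" using fin by (intro card_mono) auto
    ultimately show "?r b \<in> {1..card D}" by simp
  qed
  then have "?r ` D = {1..card D}"
    by (rule card_subset_eq[rotated]) (simp_all add: card_image[OF i])
  then show "bij_betw ?r D {1..card D}" using i by (simp add: bij_betw_def)
qed

section \<open>Weights of marked tableaux\<close>

lemma card_diagram: "card (diagram \<beta>) = sum_list \<beta>"
proof -
  have "diagram \<beta> = (\<lambda>(r, c). (c, Suc r)) ` (SIGMA r:{..<length \<beta>}. {1..\<beta> ! r})"
  proof (intro equalityI subsetI)
    fix b assume "b \<in> diagram \<beta>"
    then show "b \<in> (\<lambda>(r, c). (c, Suc r)) ` (SIGMA r:{..<length \<beta>}. {1..\<beta> ! r})"
      by (intro image_eqI[of _ _ "(snd b - 1, fst b)"]) (auto simp: diagram_def)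
  qed (auto simp: diagram_def)
  then have "card (diagram \<beta>) = card (SIGMA r:{..<length \<beta>}. {1..\<beta> ! r})"
    by (simp add: card_image inj_on_def)
  also have "\<dots> = sum_list \<beta>" by (simp add: sum_list_sum_nth atLeast0LessThan)
  finally show ?thesis .
qed

lemma weight_pos_iff: "0 < weight \<alpha> T i \<longleftrightarrow> (\<exists>b\<in>diagram \<alpha>. fst (T b) = i)"
proof -
  have "finite {b \<in> diagram \<alpha>. fst (T b) = i}" using finite_diagram by simp
  then show ?thesis unfolding weight_def by (auto simp: card_gt_0_iff)
qed

lemma sum_weight:
  assumes "\<And>b. b \<in> diagram \<alpha> \<Longrightarrow> fst (T b) \<in> {1..N}"
  shows "(\<Sum>i\<in>{1..N}. weight \<alpha> T i) = sum_list \<alpha>"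
proof -
  have "(\<Sum>i\<in>{1..N}. weight \<alpha> T i) = card (\<Union>i\<in>{1..N}. {b \<in> diagram \<alpha>. fst (T b) = i})"
    unfolding weight_def by (rule card_UN_disjoint[symmetric]) (use finite_diagram in auto)
  also have "(\<Union>i\<in>{1..N}. {b \<in> diagram \<alpha>. fst (T b) = i}) = diagram \<alpha>" using assms by auto
  finally show ?thesis using card_diagram by simp
qed

lemma MPCT_letter_le:
  assumes T: "T \<in> MPCT \<alpha>" and b: "b \<in> diagram \<alpha>"
  shows "fst (T b) \<in> {1..sum_list \<alpha>}"
proof -
  have pk: "\<forall>i j. 1 \<le> i \<and> i < j \<and> weight \<alpha> T j \<noteq> 0 \<longrightarrow> weight \<alpha> T i \<noteq> 0"
    and L: "\<forall>b\<in>diagram \<alpha>. 1 \<le> fst (T b)"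
    using T by (auto simp: MPCT_def marked_peak_tableaux_def letters_def)
  have "{1..fst (T b)} \<subseteq> (\<lambda>b. fst (T b)) ` diagram \<alpha>"
  proof
    fix i assume i: "i \<in> {1..fst (T b)}"
    have "weight \<alpha> T (fst (T b)) \<noteq> 0" using b weight_pos_iff[of \<alpha> T "fst (T b)"] by auto
    then have "weight \<alpha> T i \<noteq> 0" using pk[rule_format, of i "fst (T b)"] i by (cases "i = fst (T b)") auto
    then show "i \<in> (\<lambda>b. fst (T b)) ` diagram \<alpha>" using weight_pos_iff[of \<alpha> T i] by auto
  qed
  then have "fst (T b) \<le> card (diagram \<alpha>)" using surj_card_le[OF finite_diagram] by fastforce
  then show ?thesis using L b card_diagram by simp
qed

lemma weight_comp_positive:
  assumes T: "T \<in> MPCT \<alpha>"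
  shows "weight_comp \<alpha> T \<in> compositions (sum_list \<alpha>)"
    and "nth_default 0 (weight_comp \<alpha> T) k = weight \<alpha> T (Suc k)"
proof -
  let ?w = "map (weight \<alpha> T) [1..<Suc (sum_list \<alpha>)]" and ?\<gamma> = "weight_comp \<alpha> T"
  have pk: "\<forall>i j. 1 \<le> i \<and> i < j \<and> weight \<alpha> T j \<noteq> 0 \<longrightarrow> weight \<alpha> T i \<noteq> 0"
    using T by (auto simp: MPCT_def)
  show nd: "nth_default 0 ?\<gamma> k = weight \<alpha> T (Suc k)" for k
  proof -
    have "nth_default 0 ?\<gamma> k = nth_default 0 ?w k"
      by (simp add: weight_comp_def nth_default_strip_while_dflt)
    also have "\<dots> = weight \<alpha> T (Suc k)"
    proof (cases "k < sum_list \<alpha>")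
      case False
      then have "\<not> 0 < weight \<alpha> T (Suc k)"
        unfolding weight_pos_iff using MPCT_letter_le[OF T] by force
      then show ?thesis using False by (simp add: nth_default_def)
    qed (auto simp: nth_default_def nth_append simp del: upt_Suc)
    finally show ?thesis .
  qed
  have nz: "0 \<notin> set ?\<gamma>"
  proof
    \<comment> \<open>Stripping leaves a nonzero last part, and a zero before it contradicts the
      condition on weights.\<close>
    assume "0 \<in> set ?\<gamma>"
    then obtain k where k: "k < length ?\<gamma>" "?\<gamma> ! k = 0" by (auto simp: in_set_conv_nth)
    then have w0: "weight \<alpha> T (Suc k) = 0" using nd[of k] by (simp add: nth_default_def)
    obtain m where m: "length ?\<gamma> = Suc m" using k(1) by (cases "length ?\<gamma>") auto
    have "no_trailing ((=) 0) ?\<gamma>" unfolding weight_comp_def by simp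
    then have "last ?\<gamma> \<noteq> 0" using m unfolding no_trailing_unfold by (metis list.size(3) nat.distinct(1))
    moreover have "last ?\<gamma> = nth_default 0 ?\<gamma> m"
      using m last_conv_nth_default[of ?\<gamma> 0] by (metis diff_Suc_1 list.size(3) nat.distinct(1))
    ultimately have "weight \<alpha> T (length ?\<gamma>) \<noteq> 0" unfolding nd m by simp
    then show False using pk[rule_format, of "Suc k" "length ?\<gamma>"] w0 k(1) by (cases "Suc k = length ?\<gamma>") auto
  qed
  have len: "length ?\<gamma> \<le> sum_list \<alpha>"
    using length_strip_while_le[of "(=) 0" ?w] by (simp add: weight_comp_def del: upt_Suc)
  have "sum_list ?\<gamma> = (\<Sum>k<length ?\<gamma>. nth_default 0 ?\<gamma> k)"
    by (simp add: sum_list_sum_nth atLeast0LessThan nth_default_def)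
  also have "\<dots> = (\<Sum>k<sum_list \<alpha>. nth_default 0 ?\<gamma> k)"
    by (rule sum.mono_neutral_left) (use len in \<open>auto simp: nth_default_def\<close>)
  also have "\<dots> = (\<Sum>i\<in>{1..sum_list \<alpha>}. weight \<alpha> T i)"
    unfolding nd by (rule sum.reindex_bij_witness[of _ "\<lambda>i. i - 1" Suc]) auto
  also have "\<dots> = sum_list \<alpha>" by (rule sum_weight[OF MPCT_letter_le[OF T]])
  finally show "?\<gamma> \<in> compositions (sum_list \<alpha>)" using nz by (simp add: compositions_pos)
qed

text \<open>A composition prescribed as weight leaves no gaps, so the list
  \<open>weight_comp\<close> can be traded for pointwise conditions.\<close>

lemma MPCT_weight_iff:
  assumes g: "\<gamma> \<in> compositions (sum_list \<alpha>)"
  shows "T \<in> MPCT \<alpha> \<and> weight_comp \<alpha> T = \<gamma> \<longleftrightarrow>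
    T \<in> marked_peak_tableaux \<alpha> \<and> (\<forall>k. weight \<alpha> T (Suc k) = nth_default 0 \<gamma> k)"
proof (intro iffI conjI; elim conjE)
  assume "T \<in> MPCT \<alpha>" "weight_comp \<alpha> T = \<gamma>"
  then show "\<forall>k. weight \<alpha> T (Suc k) = nth_default 0 \<gamma> k" using weight_comp_positive(2) by metis
next
  assume "T \<in> MPCT \<alpha>"
  then show "T \<in> marked_peak_tableaux \<alpha>" by (simp add: MPCT_def)
next
  assume T: "T \<in> marked_peak_tableaux \<alpha>" and w: "\<forall>k. weight \<alpha> T (Suc k) = nth_default 0 \<gamma> k"
  have p: "0 \<notin> set \<gamma>" using g by (simp add: compositions_pos)
  have pos: "0 < weight \<alpha> T (Suc k) \<longleftrightarrow> k < length \<gamma>" for k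
    using w nth_default_pos_iff[OF p] by simp
  have "weight \<alpha> T i \<noteq> 0" if "1 \<le> i" "i < j" "weight \<alpha> T j \<noteq> 0" for i j
    using pos[of "i - 1"] pos[of "j - 1"] that by simp
  then show M: "T \<in> MPCT \<alpha>" using T by (auto simp: MPCT_def)
  have "nth_default 0 (weight_comp \<alpha> T) = nth_default 0 \<gamma>" using weight_comp_positive(2)[OF M] w by auto
  then show "weight_comp \<alpha> T = \<gamma>"
    using nth_default_inj[OF _ p] weight_comp_positive(1)[OF M] by (simp add: compositions_pos)
qed

section \<open>Marked tableaux as words with markings\<close>

definition letter_at :: "nat set \<Rightarrow> bool list \<Rightarrow> nat \<Rightarrow> letter" where
  "letter_at G B i = (block_index G i, B ! (i - 1))"

definition marked_filling :: "nat list \<Rightarrow> nat set \<Rightarrow> nat list \<Rightarrow> bool list \<Rightarrow> nat \<times> nat \<Rightarrow> letter" where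
  "marked_filling \<alpha> G v B = restrict (\<lambda>b. letter_at G B (filling \<alpha> v b)) (diagram \<alpha>)"

text \<open>Standardization reads equal marked letters from bottom to top, and equal unmarked letters from
  top to bottom and then from left to right.\<close>

definition box_key :: "(nat \<times> nat \<Rightarrow> letter) \<Rightarrow> nat \<times> nat \<Rightarrow> letter \<times> int \<times> nat" where
  "box_key T b = (T b, if marked (T b) then int (snd b) else - int (snd b), fst b)"

text \<open>Comparisons of neighbours propagate: along a run of equal letters the marking is
  constant, so the row index moves in one direction only.\<close>

lemma letter_sequence:
  fixes L :: "nat \<Rightarrow> letter" and w :: "nat \<Rightarrow> nat"
  assumes step: "\<And>i. 1 \<le> i \<Longrightarrow> i < n \<Longrightarrow>
      L i < L (Suc i) \<or> (L i = L (Suc i) \<and> (w i < w (Suc i) \<longleftrightarrow> marked (L i)))"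
    and ij: "1 \<le> i" "i < j" "j \<le> n"
  shows "L i \<le> L j \<and> (L i = L j \<longrightarrow> (if marked (L i) then w i < w j else w j \<le> w i))"
proof -
  from ij(2) have "Suc i \<le> j" by simp
  then show ?thesis using ij(3)
  proof (induction j rule: dec_induct)
    case base
    then show ?case using step[of i] ij(1) by auto
  next
    case (step j)
    have IH: "L i \<le> L j" "L i = L j \<Longrightarrow> if marked (L i) then w i < w j else w j \<le> w i" using step by auto
    from assms(1)[of j] step ij(1)
    have s: "L j < L (Suc j) \<or> (L j = L (Suc j) \<and> (w j < w (Suc j) \<longleftrightarrow> marked (L j)))" by simp
    show ?case
    proof (cases "L j < L (Suc j)")
      case True then show ?thesis using IH(1) by auto
    next
      case False then show ?thesis using IH s by (auto split: if_splits)
    qed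
  qed
qed

lemma unmarkings_step:
  assumes "B \<in> unmarkings (row_descents v) G n" "length v = n" "finite G" "1 \<le> i" "i < n"
  shows "letter_at G B i < letter_at G B (Suc i) \<or> (letter_at G B i = letter_at G B (Suc i) \<and>
    (v ! (i - 1) < v ! i \<longleftrightarrow> marked (letter_at G B i)))"
proof (cases "i \<in> G")
  case True
  then have "block_index G i < block_index G (Suc i)" using block_index_Suc[OF assms(3), of i] by simp
  then show ?thesis by (simp add: letter_at_def less_prod_def)
next
  case False
  then have "unmark_ok (i \<in> row_descents v) (B ! (i - 1)) (B ! i)"
    using assms unfolding unmarkings_def by blast
  moreover have "i \<in> row_descents v \<longleftrightarrow> v ! (i - 1) < v ! i" using assms(2,4,5) by (simp add: row_descents_def)
  moreover have "block_index G (Suc i) = block_index G i" using block_index_Suc[OF assms(3), of i] False by simp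
  ultimately show ?thesis
    by (cases "B ! (i - 1)"; cases "B ! i") (simp_all add: letter_at_def unmark_ok_def marked_def)
qed

lemma standard_filling_bounds:
  assumes "v \<in> row_words \<alpha>" "b \<in> diagram \<alpha>"
  shows "1 \<le> filling \<alpha> v b" "filling \<alpha> v b \<le> length v" "v ! (filling \<alpha> v b - 1) = snd b - 1" "1 \<le> snd b"
proof -
  obtain k where "k < length v" "b = box_at v k" "filling \<alpha> v b = Suc k" using filling_cases[OF assms] by blast
  then show "1 \<le> filling \<alpha> v b" "filling \<alpha> v b \<le> length v" "v ! (filling \<alpha> v b - 1) = snd b - 1" "1 \<le> snd b"
    by (simp_all add: box_at_def)
qed

context
  fixes \<alpha> \<gamma> :: "nat list" and n :: nat
  assumes a: "\<alpha> \<in> peak_compositions n" and g: "\<gamma> \<in> compositions n"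
begin

lemma composition_facts: "0 \<notin> set \<alpha>" "sum_list \<alpha> = n" "0 \<notin> set \<gamma>" "sum_list \<gamma> = n"
  using a g by (auto simp: peak_compositions_iff compositions_pos)

lemma marked_filling_mono:
  assumes v: "v \<in> row_words \<alpha>" and B: "B \<in> unmarkings (row_descents v) (comp_set \<gamma>) n"
    and b: "b \<in> diagram \<alpha>" "b' \<in> diagram \<alpha>" "filling \<alpha> v b < filling \<alpha> v b'"
  defines "T \<equiv> marked_filling \<alpha> (comp_set \<gamma>) v B"
  shows "T b \<le> T b' \<and> (T b = T b' \<longrightarrow> (if marked (T b) then snd b < snd b' else snd b' \<le> snd b))"
proof -
  have len: "length v = n" using v composition_facts by (simp add: row_words_def)
  note S = standard_filling_bounds[OF v b(1)] standard_filling_bounds[OF v b(2)]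
  have step: "letter_at (comp_set \<gamma>) B i < letter_at (comp_set \<gamma>) B (Suc i) \<or> (letter_at (comp_set \<gamma>) B i = letter_at (comp_set \<gamma>) B (Suc i) \<and>
    (v ! (i - 1) < v ! (Suc i - 1) \<longleftrightarrow> marked (letter_at (comp_set \<gamma>) B i)))" if "1 \<le> i" "i < n" for i
    using unmarkings_step[OF B len finite_comp_set that] by simp
  have "T b = letter_at (comp_set \<gamma>) B (filling \<alpha> v b)" "T b' = letter_at (comp_set \<gamma>) B (filling \<alpha> v b')"
    using b by (auto simp: T_def marked_filling_def)
  then show ?thesis
    using letter_sequence[of n "letter_at (comp_set \<gamma>) B" "\<lambda>i. v ! (i - 1)", OF step S(1) b(3)] S len
    by auto
qed

text \<open>Hence the order of the entries is the order of the keys, which depends on the marked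
  tableau alone; this makes standardization reversible.\<close>

lemma marked_filling_key:
  assumes v: "v \<in> row_words \<alpha>" and B: "B \<in> unmarkings (row_descents v) (comp_set \<gamma>) n"
    and b: "b \<in> diagram \<alpha>" "b' \<in> diagram \<alpha>" "filling \<alpha> v b < filling \<alpha> v b'"
  shows "box_key (marked_filling \<alpha> (comp_set \<gamma>) v B) b < box_key (marked_filling \<alpha> (comp_set \<gamma>) v B) b'"
proof -
  let ?T = "marked_filling \<alpha> (comp_set \<gamma>) v B"
  have M: "?T b \<le> ?T b'" "?T b = ?T b' \<Longrightarrow> if marked (?T b) then snd b < snd b' else snd b' \<le> snd b"
    using marked_filling_mono[OF assms] by auto
  have "fst b < fst b'" if "snd b = snd b'"
  proof (rule ccontr)
    assume "\<not> fst b < fst b'"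
    moreover have "b \<noteq> b'" using b(3) by auto
    ultimately have "fst b' < fst b" using that by (auto simp: prod_eq_iff)
    moreover have "(fst b', snd b) \<in> diagram \<alpha>" "(fst b, snd b) \<in> diagram \<alpha>"
      using b(1,2) that by (metis prod.collapse)+
    ultimately have "filling \<alpha> v (fst b', snd b) < filling \<alpha> v (fst b, snd b)"
      using filling_row_fillings[OF v] unfolding row_fillings_def by blast
    then show False using b(3) that by (metis less_not_sym prod.collapse)
  qed
  then show ?thesis using M unfolding box_key_def
    by (cases "?T b = ?T b'") (auto split: if_splits simp: order_less_le)
qed

lemma marked_filling_tableau:
  assumes v: "v \<in> row_words \<alpha>" "peak_word v" and B: "B \<in> unmarkings (row_descents v) (comp_set \<gamma>) n"
  shows "marked_filling \<alpha> (comp_set \<gamma>) v B \<in> marked_peak_tableaux \<alpha>" (is "?T \<in> _")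
    and "weight \<alpha> (marked_filling \<alpha> (comp_set \<gamma>) v B) (Suc k) = nth_default 0 \<gamma> k"
proof -
  let ?D = "diagram \<alpha>" and ?S = "filling \<alpha> v" and ?G = "comp_set \<gamma>"
  have len: "length v = n" using v composition_facts by (simp add: row_words_def)
  have fT: "fst (?T b) = block_index ?G (?S b)" if "b \<in> ?D" for b
    using that by (simp add: marked_filling_def letter_at_def)
  note mono = marked_filling_mono[OF v(1) B]
  have inc: "?S (c, r) < ?S (c', r)" if "(c, r) \<in> ?D" "(c', r) \<in> ?D" "c < c'" for c c' r
    using filling_row_fillings[OF v(1)] that by (auto simp: row_fillings_def)
  note col = filling_first_column[OF v]
  have sb: "?S b \<in> {1..n}" if "b \<in> ?D" for b using standard_filling_bounds[OF v(1) that] len by simp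
  show "?T \<in> marked_peak_tableaux \<alpha>"
    unfolding marked_peak_tableaux_def
  proof (intro CollectI conjI allI impI)
    show "?T \<in> ?D \<rightarrow>\<^sub>E letters"
      by (auto simp: marked_filling_def letters_def letter_at_def block_index_def)
  next
    fix c c' r assume A: "(c, r) \<in> ?D \<and> (c', r) \<in> ?D \<and> c < c'"
    then show "?T (c, r) \<le> ?T (c', r)" using mono inc by blast
    show "?T (c, r) \<noteq> ?T (c', r)" if "marked (?T (c, r))"
      using mono[of "(c, r)" "(c', r)"] inc[of c r c'] A that by auto
  next
    fix r r' assume A: "(1, r) \<in> ?D \<and> (1, r') \<in> ?D \<and> r < r'"
    then have r: "1 \<le> r" by (auto simp: diagram_iff)
    have C: "(2, r) \<in> ?D" "?S (1, r) < ?S (1, r')" "?S (2, r) < ?S (1, r')" using col[of r' r] A r by auto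
    have M1: "?T (1, r) \<le> ?T (2, r)" "?T (2, r) \<le> ?T (1, r')"
      using mono[of "(1, r)" "(2, r)"] mono[of "(2, r)" "(1, r')"] inc[of 1 r 2] C A by auto
    \<comment> \<open>Equal letters in the first column would squeeze the letter of box
      \<open>(2, r)\<close> between them. A letter repeated in row \<open>r\<close> is unmarked, yet
      equal unmarked letters never move up.\<close>
    have "?T (1, r) \<noteq> ?T (1, r')"
    proof
      assume e: "?T (1, r) = ?T (1, r')"
      then have e2: "?T (1, r) = ?T (2, r)" using M1 by auto
      have "\<not> marked (?T (1, r))" using mono[of "(1, r)" "(2, r)"] inc[of 1 r 2] C A e2 by auto
      then show False using mono[of "(1, r)" "(1, r')"] C A e by auto
    qed
    then show "?T (1, r) < ?T (1, r')" using M1 by auto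
  next
    fix k assume "k \<le> sum_list \<alpha>"
    \<comment> \<open>The last entry whose number is at most \<open>k\<close>, so that the boxes in
      question hold the entries up to \<open>K\<close>; the inserted \<open>0\<close> covers the
      case that there is none.\<close>
    define K where "K = Max (insert 0 {i \<in> {1..n}. block_index ?G i \<le> k})"
    have K: "block_index ?G i \<le> k \<longleftrightarrow> i \<le> K" if i: "i \<in> {1..n}" for i
    proof
      assume "block_index ?G i \<le> k" then show "i \<le> K" unfolding K_def using i by (intro Max_ge) auto
    next
      assume "i \<le> K"
      moreover have "K \<in> insert 0 {i \<in> {1..n}. block_index ?G i \<le> k}" unfolding K_def by (rule Max_in) auto
      ultimately have "block_index ?G K \<le> k" "i \<le> K" using i by auto
      then show "block_index ?G i \<le> k" using block_index_mono[OF finite_comp_set, of i K \<gamma>] by simp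
    qed
    have "K \<in> insert 0 {i \<in> {1..n}. block_index ?G i \<le> k}" unfolding K_def by (rule Max_in) auto
    then have "K \<le> sum_list \<alpha>" using composition_facts by auto
    then have "is_peak_diagram {b \<in> ?D. ?S b \<le> K}" using filling_peak_iff[OF v(1)] v(2) by blast
    moreover have "{b \<in> ?D. fst (?T b) \<le> k} = {b \<in> ?D. ?S b \<le> K}" using fT K sb by auto
    ultimately show "is_peak_diagram {b \<in> ?D. fst (?T b) \<le> k}" by simp
  next
    fix r assume A: "(2, r) \<in> ?D \<and> (1, r + 1) \<in> ?D \<and> \<not> marked (?T (2, r))"
    then have r: "1 \<le> r" by (auto simp: diagram_iff)
    have C: "?S (2, r) < ?S (1, r + 1)" using col[of "r + 1" r] A r by auto
    show "fst (?T (1, r + 1)) \<noteq> fst (?T (2, r))"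
    proof
      assume e: "fst (?T (1, r + 1)) = fst (?T (2, r))"
      have "?T (2, r) \<le> ?T (1, r + 1)" using mono[of "(2, r)" "(1, r + 1)"] A C by auto
      \<comment> \<open>With equal numbers and an unmarked letter in box \<open>(2, r)\<close>, the
        order forces the same unmarked letter, which cannot move up to row
        \<open>r + 1\<close>.\<close>
      then have "?T (2, r) = ?T (1, r + 1)" using e A by (auto simp: marked_def less_eq_prod_def prod_eq_iff)
      then show False using mono[of "(2, r)" "(1, r + 1)"] A C by auto
    qed
  qed
  have "weight \<alpha> ?T (Suc k) = card {b \<in> ?D. block_index ?G (?S b) = Suc k}"
    unfolding weight_def using fT by (intro arg_cong[of _ _ card]) auto
  also have "\<dots> = card {i \<in> {1..n}. block_index ?G i = Suc k}"
  proof (rule bij_betw_same_card)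
    have "bij_betw ?S ?D {1..n}" using filling_standard[OF v(1)] composition_facts by (simp add: standard_fillings_def)
    then show "bij_betw ?S {b \<in> ?D. block_index ?G (?S b) = Suc k} {i \<in> {1..n}. block_index ?G i = Suc k}"
      by (rule bij_betw_Collect) simp
  qed
  finally show "weight \<alpha> ?T (Suc k) = nth_default 0 \<gamma> k" using card_block[OF composition_facts(3)] composition_facts(4) by simp
qed

text \<open>Both standard fillings are the ranking of the boxes by \<open>box_key\<close>, hence
  equal; the bits are then read off the letters.\<close>

lemma marked_filling_inj:
  assumes v: "v \<in> row_words \<alpha>" "B \<in> unmarkings (row_descents v) (comp_set \<gamma>) n"
    and w: "w \<in> row_words \<alpha>" "C \<in> unmarkings (row_descents w) (comp_set \<gamma>) n"
    and eq: "marked_filling \<alpha> (comp_set \<gamma>) v B = marked_filling \<alpha> (comp_set \<gamma>) w C"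
  shows "v = w \<and> B = C"
proof -
  let ?D = "diagram \<alpha>" and ?T = "marked_filling \<alpha> (comp_set \<gamma>) v B"
  have rank: "filling \<alpha> u b = card {b' \<in> ?D. box_key ?T b' \<le> box_key ?T b}"
    if u: "u \<in> row_words \<alpha>" "E \<in> unmarkings (row_descents u) (comp_set \<gamma>) n" "marked_filling \<alpha> (comp_set \<gamma>) u E = ?T"
      and b: "b \<in> ?D" for u E b
  proof -
    let ?S = "filling \<alpha> u"
    have bij: "bij_betw ?S ?D {1..n}" using filling_standard[OF u(1)] composition_facts by (simp add: standard_fillings_def)
    have key: "?S b' \<le> ?S b \<longleftrightarrow> box_key ?T b' \<le> box_key ?T b" if "b' \<in> ?D" for b'
    proof (cases "?S b'" "?S b" rule: linorder_cases)
      case less then show ?thesis using marked_filling_key[OF u(1,2) that b] u(3) by auto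
    next
      case equal
      then have "b' = b" using bij b that by (auto simp: bij_betw_def dest: inj_onD)
      then show ?thesis by simp
    next
      case greater then show ?thesis using marked_filling_key[OF u(1,2) b that] u(3) by auto
    qed
    have "?S b \<in> {1..n}" using bij b by (auto simp: bij_betw_def)
    have "?S ` {b' \<in> ?D. ?S b' \<le> ?S b} = {1..?S b}"
    proof (intro equalityI subsetI)
      fix i assume "i \<in> ?S ` {b' \<in> ?D. ?S b' \<le> ?S b}"
      then obtain b' where "b' \<in> ?D" "?S b' \<le> ?S b" "i = ?S b'" by blast
      then show "i \<in> {1..?S b}" using standard_filling_bounds(1)[OF u(1)] by simp
    next
      fix i assume i: "i \<in> {1..?S b}"
      then have "i \<in> ?S ` ?D" using bij \<open>?S b \<in> {1..n}\<close> by (simp add: bij_betw_def)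
      then obtain b' where "b' \<in> ?D" "i = ?S b'" by blast
      then show "i \<in> ?S ` {b' \<in> ?D. ?S b' \<le> ?S b}" using i by simp
    qed
    moreover have "inj_on ?S {b' \<in> ?D. ?S b' \<le> ?S b}" using bij by (auto simp: bij_betw_def intro: inj_on_subset)
    ultimately have "card {b' \<in> ?D. ?S b' \<le> ?S b} = ?S b" using card_image by fastforce
    moreover have "{b' \<in> ?D. ?S b' \<le> ?S b} = {b' \<in> ?D. box_key ?T b' \<le> box_key ?T b}" using key by auto
    ultimately show ?thesis by simp
  qed
  have "filling \<alpha> v = filling \<alpha> w"
  proof (rule extensionalityI[of _ ?D])
    show "filling \<alpha> v b = filling \<alpha> w b" if "b \<in> ?D" for b
      using rank[OF v refl that] rank[OF w eq[symmetric] that] by simp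
  qed (auto simp: filling_def)
  then have vw: "v = w" using filling_inj v(1) w(1) by (auto dest: inj_onD)
  have "B = C"
  proof (rule nth_equalityI)
    show "length B = length C" using v w by (simp add: unmarkings_def)
    fix i assume i: "i < length B"
    then have il: "i < length v" using v composition_facts by (simp add: unmarkings_def row_words_def)
    note F = filling_box_at[OF v(1) il]
    from fun_cong[OF eq, of "box_at v i"] show "B ! i = C ! i"
      using F vw by (simp add: marked_filling_def letter_at_def)
  qed
  then show ?thesis using vw by simp
qed

text \<open>The standard filling is obtained by ranking the boxes by \<open>box_key\<close>. Its
  word is peak because box \<open>(2, r)\<close> always precedes box
  \<open>(1, r + 1)\<close>.\<close>

lemma marked_filling_surj:
  assumes T: "T \<in> marked_peak_tableaux \<alpha>" and wt: "\<forall>k. weight \<alpha> T (Suc k) = nth_default 0 \<gamma> k"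
  shows "\<exists>v B. v \<in> row_words \<alpha> \<and> peak_word v \<and> B \<in> unmarkings (row_descents v) (comp_set \<gamma>) n \<and>
    marked_filling \<alpha> (comp_set \<gamma>) v B = T"
proof -
  let ?D = "diagram \<alpha>" and ?G = "comp_set \<gamma>" and ?k = "box_key T"
  have ext: "T \<in> extensional ?D" and f1: "\<And>b. b \<in> ?D \<Longrightarrow> 1 \<le> fst (T b)"
    and row: "\<And>c c' r. (c, r) \<in> ?D \<Longrightarrow> (c', r) \<in> ?D \<Longrightarrow> c < c' \<Longrightarrow> T (c, r) \<le> T (c', r)"
    and norep: "\<And>c c' r. (c, r) \<in> ?D \<Longrightarrow> (c', r) \<in> ?D \<Longrightarrow> c < c' \<Longrightarrow> marked (T (c, r)) \<Longrightarrow> T (c, r) \<noteq> T (c', r)"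
    and peak: "\<And>k. k \<le> n \<Longrightarrow> is_peak_diagram {b \<in> ?D. fst (T b) \<le> k}"
    and c4: "\<And>r. (2, r) \<in> ?D \<Longrightarrow> (1, r + 1) \<in> ?D \<Longrightarrow> \<not> marked (T (2, r)) \<Longrightarrow> fst (T (1, r + 1)) \<noteq> fst (T (2, r))"
    using T composition_facts unfolding marked_peak_tableaux_def by (auto simp: PiE_def letters_def Pi_def)
  have fl: "fst (T b) \<le> length \<gamma>" if "b \<in> ?D" for b
  proof -
    have "0 < weight \<alpha> T (fst (T b))" using weight_pos_iff that by blast
    then have "0 < nth_default 0 \<gamma> (fst (T b) - 1)" using wt f1[OF that] by (metis Suc_pred' Suc_le_eq One_nat_def)
    then show ?thesis using nth_default_pos_iff[OF composition_facts(3)] by (metis One_nat_def Suc_leI Suc_pred' f1 that Suc_le_eq)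
  qed
  have lg: "length \<gamma> \<le> n" using length_le_sum_list[of \<gamma>] g by (auto simp: compositions_def)
  have inj: "inj_on ?k ?D"
    by (rule inj_onI) (auto simp: box_key_def prod_eq_iff split: if_splits)
  define S where "S = restrict (\<lambda>b. card {b' \<in> ?D. ?k b' \<le> ?k b}) ?D"
  have bij: "bij_betw S ?D {1..n}"
  proof -
    have "bij_betw (\<lambda>b. card {b' \<in> ?D. ?k b' \<le> ?k b}) ?D {1..n}"
      using bij_betw_rank(1)[OF finite_diagram inj] unfolding card_diagram composition_facts(2) .
    then show ?thesis by (rule bij_betw_cong[THEN iffD1, rotated]) (simp add: S_def)
  qed
  have less: "S b < S b' \<longleftrightarrow> ?k b < ?k b'" if "b \<in> ?D" "b' \<in> ?D" for b b'
    using bij_betw_rank(2)[OF finite_diagram inj that] that by (simp add: S_def)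
  have rowS: "S (c, r) < S (c', r)" if "(c, r) \<in> ?D" "(c', r) \<in> ?D" "c < c'" for c c' r
    unfolding less[OF that(1,2)] using row[OF that] that(3) by (auto simp: box_key_def order_le_less)
  then have "S \<in> row_fillings \<alpha>"
    using bij composition_facts(2) by (auto simp: row_fillings_def standard_fillings_def S_def)
  then obtain v where v: "v \<in> row_words \<alpha>" "filling \<alpha> v = S" using filling_surj by blast
  have len: "length v = n" using v composition_facts by (simp add: row_words_def)
  have p2: "(2, r) \<in> ?D" if "(1, r + 1) \<in> ?D" "1 \<le> r" for r
  proof -
    have "peak_fun (nth_default 0 \<alpha>)" using a by (simp add: peak_compositions_iff)
    then have "1 < nth_default 0 \<alpha> (r - 1)"
      by (rule peak_fun_antimono[of _ _ r]) (use that in \<open>auto simp: diagram_iff\<close>)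
    then show ?thesis using that by (simp add: diagram_iff)
  qed
  \<comment> \<open>The peak diagram of the numbers up to that of \<open>(1, r + 1)\<close> contains
    \<open>(2, r)\<close>, which settles different numbers. If the numbers agree, the fourth
    condition makes the letter of \<open>(2, r)\<close> marked, and equal marked letters are read
    from bottom to top.\<close>
  have S21: "S (2, r) < S (1, r + 1)" if D1: "(1, r + 1) \<in> ?D" and r: "1 \<le> r" for r
  proof -
    note D2 = p2[OF that]
    let ?top = "fst (T (1, r + 1))"
    have "?top \<le> n" using fl[OF D1] lg by simp
    then obtain m \<delta> where d: "\<delta> \<in> peak_compositions m" "{b \<in> ?D. fst (T b) \<le> ?top} = diagram \<delta>"
      using peak unfolding is_peak_diagram_def by blast
    have "(1, r + 1) \<in> diagram \<delta>" using D1 d(2) by blast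
    moreover have "peak_fun (nth_default 0 \<delta>)" using d by (simp add: peak_compositions_iff)
    ultimately have "1 < nth_default 0 \<delta> (r - 1)"
      by (intro peak_fun_antimono[of _ _ r]) (use r in \<open>auto simp: diagram_iff\<close>)
    then have "(2, r) \<in> diagram \<delta>" using r by (simp add: diagram_iff)
    then have le: "fst (T (2, r)) \<le> ?top" using d(2) by blast
    have "?k (2, r) < ?k (1, r + 1)"
    proof (cases "fst (T (2, r)) = ?top")
      case True
      then have "marked (T (2, r))" using c4[OF D2 D1] by auto
      then show ?thesis using True
        by (cases "T (2, r)"; cases "T (1, r + 1)") (auto simp: box_key_def marked_def)
    next
      case False
      then show ?thesis using le by (cases "T (2, r)"; cases "T (1, r + 1)") (auto simp: box_key_def)
    qed
    then show ?thesis using less[OF D2 D1] by simp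
  qed
  have pw: "peak_word v"
    unfolding peak_word_def peak_fun_def
  proof (intro allI impI)
    fix k r assume k: "0 < count_list (take k v) (Suc r)"
    have "0 < count_list v (Suc r)" using k count_list_take_le[of k v "Suc r"] by simp
    then have D: "(1, (r + 1) + 1) \<in> ?D" using v(1) by (simp add: diagram_iff row_words_def)
    have "S (1, (r + 1) + 1) \<le> k" using filling_le_iff[OF v(1) D, of k] v(2) k by simp
    then have "S (2, r + 1) \<le> k" using S21[OF D] by simp
    then show "1 < count_list (take k v) r" using filling_le_iff[OF v(1) p2[OF D], of k] v(2) by simp
  qed
  have cum: "card {b \<in> ?D. fst (T b) \<le> j} = sum_list (take j \<gamma>)" if "j \<le> length \<gamma>" for j
    using that
  proof (induction j)
    case 0
    have "{b \<in> ?D. fst (T b) \<le> 0} = {}" using f1 by force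
    then show ?case by (simp only: card.empty take_0 sum_list.Nil)
  next
    case (Suc j)
    have "{b \<in> ?D. fst (T b) \<le> Suc j} = {b \<in> ?D. fst (T b) \<le> j} \<union> {b \<in> ?D. fst (T b) = Suc j}" by auto
    then have "card {b \<in> ?D. fst (T b) \<le> Suc j} = card {b \<in> ?D. fst (T b) \<le> j} + weight \<alpha> T (Suc j)"
      using finite_diagram by (simp add: card_Un_disjoint disjoint_iff weight_def)
    then show ?case using Suc wt by (simp add: take_Suc_conv_app_nth nth_default_def)
  qed
  \<comment> \<open>All boxes with a smaller number rank before \<open>b\<close> and none with a
    larger one does, so the rank lies between two consecutive partial sums.\<close>
  have blk: "block_index ?G (S b) = fst (T b)" if b: "b \<in> ?D" for b
  proof -
    obtain k where k: "fst (T b) = Suc k" "k < length \<gamma>" using f1[OF b] fl[OF b] by (cases "fst (T b)") auto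
    have Sb: "S b = card {b' \<in> ?D. ?k b' \<le> ?k b}" using b by (simp add: S_def)
    have "S b \<le> card {b' \<in> ?D. fst (T b') \<le> Suc k}" unfolding Sb
      using finite_diagram k(1) by (intro card_mono) (auto simp: box_key_def less_eq_prod_def less_prod_def)
    then have up: "S b \<le> sum_list (take (Suc k) \<gamma>)" using cum[of "Suc k"] k(2) by simp
    have "insert b {b' \<in> ?D. fst (T b') \<le> k} \<subseteq> {b' \<in> ?D. ?k b' \<le> ?k b}"
      using b k(1) by (auto simp: box_key_def less_eq_prod_def less_prod_def)
    then have "card (insert b {b' \<in> ?D. fst (T b') \<le> k}) \<le> S b" unfolding Sb
      using finite_diagram by (intro card_mono) auto
    moreover have "card (insert b {b' \<in> ?D. fst (T b') \<le> k}) = Suc (sum_list (take k \<gamma>))"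
      using finite_diagram k cum[of k] by (simp add: card_insert_disjoint)
    ultimately show ?thesis using block_index_comp_set[OF composition_facts(3) k(2), of "S b"] up k(1) by simp
  qed
  define B where "B = map (\<lambda>i. snd (T (box_at v i))) [0..<n]"
  have box: "box_at v i \<in> ?D" "S (box_at v i) = Suc i" if "i < n" for i
    using filling_box_at[OF v(1)] that len v(2) by auto
  have BS: "letter_at ?G B (S b) = T b" if b: "b \<in> ?D" for b
  proof -
    obtain i where i: "i < n" "b = box_at v i" "S b = Suc i" using filling_cases[OF v(1) b] v(2) len by metis
    have "B ! i = snd (T b)" unfolding i(2) using i(1) by (simp add: B_def)
    then show ?thesis using blk[OF b] i(3) by (cases "T b") (simp add: letter_at_def)
  qed
  have "B \<in> unmarkings (row_descents v) ?G n"
    unfolding unmarkings_def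
  proof (intro CollectI conjI allI impI)
    show "length B = n" by (simp add: B_def)
    fix i assume i: "1 \<le> i \<and> i < n \<and> i \<notin> ?G"
    let ?b = "box_at v (i - 1)" and ?c = "box_at v i"
    have b: "?b \<in> ?D" "S ?b = i" "?c \<in> ?D" "S ?c = Suc i" using box[of "i - 1"] box[of i] i by auto
    have key: "?k ?b < ?k ?c" using less[OF b(1,3)] b by simp
    \<comment> \<open>A marked letter is not repeated inside a row, so equal marked letters change
      rows, and the order of keys makes them move up.\<close>
    have "marked (T ?b) \<Longrightarrow> T ?b = T ?c \<Longrightarrow> snd ?b = snd ?c \<Longrightarrow> \<not> fst ?b < fst ?c"
      using norep[of "fst ?b" "snd ?b" "fst ?c"] b(1,3) by (metis prod.collapse)
    moreover have "fst (T ?b) = fst (T ?c)"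
      using blk[OF b(1)] blk[OF b(3)] b i block_index_Suc[OF finite_comp_set[of \<gamma>], of i] by simp
    moreover have "i \<in> row_descents v \<longleftrightarrow> snd ?b < snd ?c" using i len by (auto simp: row_descents_def box_at_def)
    moreover have "B ! (i - 1) = snd (T ?b)" "B ! i = snd (T ?c)" using i by (auto simp: B_def)
    ultimately show "unmark_ok (i \<in> row_descents v) (B ! (i - 1)) (B ! i)"
      using key by (cases "T ?b"; cases "T ?c") (auto simp: unmark_ok_def box_key_def marked_def split: if_splits)
  qed
  moreover have "marked_filling \<alpha> ?G v B = T"
  proof (rule extensionalityI[of _ ?D])
    show "marked_filling \<alpha> ?G v B b = T b" if "b \<in> ?D" for b
      using BS[OF that] that v(2) by (simp add: marked_filling_def)
  qed (use ext in \<open>auto simp: marked_filling_def\<close>)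
  ultimately show ?thesis using v(1) pw by blast
qed

end

text \<open>The number of markings depends on the word only through its compatibility with
  \<open>\<gamma>\<close>, so the sum over words is a multiple of a cardinality.\<close>

lemma card_MPCT_weight:
  assumes n: "1 \<le> n" and a: "\<alpha> \<in> peak_compositions n" and g: "\<gamma> \<in> compositions n"
  shows "card {T \<in> MPCT \<alpha>. weight_comp \<alpha> T = \<gamma>} = 2 ^ length \<gamma> *
    card {v. peak_word v \<and> shape v = \<alpha> \<and> (\<forall>p\<in>Peak (row_descents v). p \<in> comp_set \<gamma> \<or> p - 1 \<in> comp_set \<gamma>)}"
proof -
  let ?W = "{v. peak_word v \<and> shape v = \<alpha>}" and ?G = "comp_set \<gamma>"
  let ?ok = "\<lambda>v. \<forall>p\<in>Peak (row_descents v). p \<in> ?G \<or> p - 1 \<in> ?G"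
  let ?M = "SIGMA v:?W. unmarkings (row_descents v) ?G n"
  have p: "0 \<notin> set \<alpha>" "sum_list \<alpha> = n" "0 \<notin> set \<gamma>" "sum_list \<gamma> = n"
    using a g by (auto simp: peak_compositions_iff compositions_pos)
  have W: "v \<in> ?W \<longleftrightarrow> v \<in> row_words \<alpha> \<and> peak_word v" for v using peak_word_row_words[OF p(1)] by blast
  have "bij_betw (\<lambda>(v, B). marked_filling \<alpha> ?G v B) ?M {T \<in> MPCT \<alpha>. weight_comp \<alpha> T = \<gamma>}"
  proof (intro bij_betw_imageI equalityI subsetI)
    show "inj_on (\<lambda>(v, B). marked_filling \<alpha> ?G v B) ?M"
      using marked_filling_inj[OF a g] W by (auto simp: inj_on_def)
  next
    fix T assume "T \<in> (\<lambda>(v, B). marked_filling \<alpha> ?G v B) ` ?M"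
    then obtain v B where vB: "v \<in> ?W" "B \<in> unmarkings (row_descents v) ?G n" "T = marked_filling \<alpha> ?G v B" by auto
    then show "T \<in> {T \<in> MPCT \<alpha>. weight_comp \<alpha> T = \<gamma>}"
      using marked_filling_tableau[OF a g _ _ vB(2)] W[of v] MPCT_weight_iff[of \<gamma> \<alpha> T] g p(2) by auto
  next
    fix T assume "T \<in> {T \<in> MPCT \<alpha>. weight_comp \<alpha> T = \<gamma>}"
    then have "T \<in> marked_peak_tableaux \<alpha>" "\<forall>k. weight \<alpha> T (Suc k) = nth_default 0 \<gamma> k"
      using MPCT_weight_iff[of \<gamma> \<alpha> T] g p(2) by auto
    from marked_filling_surj[OF a g this] obtain v B where
      "v \<in> ?W" "B \<in> unmarkings (row_descents v) ?G n" "marked_filling \<alpha> ?G v B = T" using W by blast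
    then show "T \<in> (\<lambda>(v, B). marked_filling \<alpha> ?G v B) ` ?M" by (intro image_eqI[of _ _ "(v, B)"]) auto
  qed
  then have "card {T \<in> MPCT \<alpha>. weight_comp \<alpha> T = \<gamma>} = card ?M" by (simp add: bij_betw_same_card)
  also have "\<dots> = (\<Sum>v\<in>?W. card (unmarkings (row_descents v) ?G n))"
    by (rule card_SigmaI) (auto simp: finite_shape_words finite_unmarkings)
  also have "\<dots> = (\<Sum>v\<in>?W. if ?ok v then 2 ^ length \<gamma> else 0)"
  proof (rule sum.cong[OF refl])
    fix v assume v: "v \<in> ?W"
    then have "length v = n" using sum_list_shape[of v] p by simp
    then have "row_descents v \<subseteq> {1..<n}" by (auto simp: row_descents_def)
    moreover have "Suc (card ?G) = length \<gamma>" using card_comp_set[OF p(3)] p n by (cases \<gamma>) auto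
    ultimately show "card (unmarkings (row_descents v) ?G n) = (if ?ok v then 2 ^ length \<gamma> else 0)"
      using card_unmarkings[OF n _ comp_set_subset[OF g]] by simp
  qed
  also have "\<dots> = 2 ^ length \<gamma> * card {v \<in> ?W. ?ok v}"
    by (subst sum.inter_filter[symmetric, OF finite_shape_words]) simp
  also have "{v \<in> ?W. ?ok v} = {v. peak_word v \<and> shape v = \<alpha> \<and> ?ok v}" by auto
  finally show ?thesis .
qed

section \<open>Dual immaculate recording tableaux\<close>

text \<open>Two conditions on recording tableaux at the moment a box is added: no lower row has the
  length that row \<open>j\<close> is about to reach, and the first column fills from top to
  bottom.\<close>

definition block_step :: "nat \<Rightarrow> (nat \<Rightarrow> nat) \<Rightarrow> nat \<Rightarrow> bool" where
  "block_step l y j \<longleftrightarrow> j < l \<and> (\<forall>r<j. y r \<noteq> Suc (y j)) \<and> (y j = 0 \<longrightarrow> (\<forall>r. j < r \<and> r < l \<longrightarrow> 0 < y r))"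

definition add_word :: "(nat \<Rightarrow> nat) \<Rightarrow> nat list \<Rightarrow> nat \<Rightarrow> nat" where
  "add_word x b r = x r + count_list b r"

text \<open>A strip in the order in which its boxes are added: the first in column 1, each later one
  strictly to the right. Columns are compared through the row lengths before each addition, which
  are one less than the columns.\<close>

definition block_word :: "nat \<Rightarrow> (nat \<Rightarrow> nat) \<Rightarrow> nat list \<Rightarrow> bool" where
  "block_word l x b \<longleftrightarrow> (\<forall>k<length b. block_step l (add_word x (take k b)) (b ! k) \<and>
     (if k = 0 then x (b ! 0) = 0
      else add_word x (take (k - 1) b) (b ! (k - 1)) < add_word x (take k b) (b ! k)))"

lemma add_word_snoc: "add_word x (b @ [j]) = add_box (add_word x b) j"
  by (auto simp: add_word_def add_box_def)

lemma add_word_Nil [simp]: "add_word x [] = x"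
  by (auto simp: add_word_def)

lemma block_word_singleton: "block_word l x [j] \<longleftrightarrow> block_step l x j \<and> x j = 0"
  by (simp add: block_word_def)

lemma block_word_snoc:
  assumes "b \<noteq> []"
  shows "block_word l x (b @ [j]) \<longleftrightarrow> block_word l x b \<and> block_step l (add_word x b) j \<and>
    add_word x (butlast b) (last b) < add_word x b j"
proof -
  obtain c i where b: "b = c @ [i]" using assms by (cases b rule: rev_cases) auto
  have nth: "(b @ [j]) ! k = b ! k" "take k (b @ [j]) = take k b" if "k \<le> length b" "k < length b" for k
    using that by (auto simp: nth_append)
  have tk: "take (k - 1) (b @ [j]) = take (k - 1) b" if "k \<le> length b" for k using that by simp
  have "block_word l x (b @ [j]) \<longleftrightarrow> block_word l x b \<and> (block_step l (add_word x (take (length b) (b @ [j]))) ((b @ [j]) ! length b) \<and>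
     (add_word x (take (length b - 1) (b @ [j])) ((b @ [j]) ! (length b - 1)) < add_word x (take (length b) (b @ [j])) ((b @ [j]) ! length b)))"
    unfolding block_word_def length_append_singleton All_less_Suc using assms
    by (auto simp: nth_append)
  then show ?thesis by (simp add: b nth_append)
qed

text \<open>Rows longer than row \<open>j\<close> are still unchanged, so the only possible conflict
  is a tie with a lower row of length \<open>z j + 1\<close>.\<close>

lemma strip_add_max:
  assumes V: "strip p l x z" and max: "\<And>r. x r < z r \<Longrightarrow> z r \<le> z j" and pos: "0 < z j"
    and ne: "\<forall>r<j. z r \<noteq> Suc (z j)"
  shows "strip p l x (add_box z j)"
proof -
  have le: "x r \<le> z r" for r using V unfolding strip_def by blast
  have v: "z b = x b \<or> z b < x a \<or> z a \<le> x b" if "a < b" for a b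
    using V that unfolding strip_def by blast
  have eq: "x r = z r" if "z j < z r" for r using max[of r] le[of r] that by (cases "x r < z r") auto
  have cmp: "add_box z j b = x b \<or> add_box z j b < x a \<or> add_box z j a \<le> x b" if ab: "a < b" for a b
  proof -
    consider "b = j" | "a = j" | "a \<noteq> j" "b \<noteq> j" by blast
    then show ?thesis
    proof cases
      case 1
      show ?thesis
      proof (cases "z j < z a")
        case True
        then have "Suc (z j) < z a" using ne ab 1 by (metis Suc_lessI)
        then show ?thesis using eq[OF True] 1 ab by (simp add: add_box_def)
      next
        case False
        then have "z a \<le> x j" using v[OF ab] 1 le[of a] by auto
        then show ?thesis using 1 ab by (simp add: add_box_def)
      qed
    next
      case 2
      have "z b = x b \<or> z b < x j \<or> Suc (z j) \<le> x b"
      proof (cases "x b < z b")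
        case True
        then have "z b \<le> z j" by (rule max)
        then show ?thesis using v[OF ab] 2 True by auto
      next
        case False then show ?thesis using le[of b] by simp
      qed
      then show ?thesis using 2 ab by (simp add: add_box_def)
    next
      case 3 then show ?thesis using v[OF ab] by (simp add: add_box_def)
    qed
  qed
  have "x r \<le> add_box z j r" for r using le[of r] by (auto simp: add_box_def)
  moreover have "0 < add_box z j r \<longleftrightarrow> 0 < z r" for r using pos by (simp add: add_box_def)
  ultimately show ?thesis using V cmp unfolding strip_def by simp
qed

lemma strip_remove_max:
  assumes V: "strip p l x (add_box z j)" and xj: "x j \<le> z j" and max: "\<And>r. x r < add_box z j r \<Longrightarrow> add_box z j r \<le> Suc (z j)"
    and pos: "0 < z j"
  shows "strip p l x z" "\<forall>r<j. z r \<noteq> Suc (z j)" "\<And>r. x r < z r \<Longrightarrow> z r \<le> z j"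
proof -
  let ?y = "add_box z j"
  have le: "x r \<le> ?y r" for r using V unfolding strip_def by blast
  have v: "?y b = x b \<or> ?y b < x a \<or> ?y a \<le> x b" if "a < b" for a b
    using V that unfolding strip_def by blast
  have yj: "?y j = Suc (z j)" and yr: "\<And>r. r \<noteq> j \<Longrightarrow> ?y r = z r" by (auto simp: add_box_def)
  show "\<forall>r<j. z r \<noteq> Suc (z j)"
  proof (intro allI impI)
    fix r assume r: "r < j"
    then show "z r \<noteq> Suc (z j)" using v[OF r] yj yr[of r] xj le[of r] by auto
  qed
  show "z r \<le> z j" if "x r < z r" for r
  proof (cases "r = j")
    case False
    then have "z r \<le> Suc (z j)" using max[of r] yr that by simp
    moreover have "z r \<noteq> Suc (z j)"
      using strip_distinct_columns[OF V, of r "Suc (z j)" j] that yr[OF False] yj xj False by auto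
    ultimately show ?thesis by simp
  qed simp
  have "z b = x b \<or> z b < x a \<or> z a \<le> x b" if ab: "a < b" for a b
    using v[OF ab] yj yr[of a] yr[of b] xj ab by (cases "a = j"; cases "b = j") auto
  moreover have "x r \<le> z r" for r using le[of r] yr[of r] xj by (cases "r = j") auto
  moreover have "0 < ?y r \<longleftrightarrow> 0 < z r" for r using pos by (simp add: add_box_def)
  ultimately show "strip p l x z" using V unfolding strip_def by simp
qed

lemma strip_first_box:
  assumes "p < l" "\<forall>r. 0 < x r \<longleftrightarrow> Suc p \<le> r \<and> r < l"
  shows "strip p l x (add_box x p)"
proof -
  have x0: "x r = 0" if "r \<le> p" for r using assms(2)[rule_format, of r] that by simp
  have "0 < add_box x p r \<longleftrightarrow> p \<le> r \<and> r < l" for r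
    using assms(2)[rule_format, of r] assms(1) by (cases "r = p") (auto simp: add_box_def)
  moreover have "x r \<le> add_box x p r" for r by (simp add: add_box_def)
  moreover have "add_box x p b = x b \<or> add_box x p b < x a \<or> add_box x p a \<le> x b" if "a < b" for a b
    using x0[of a] that by (cases "b = p") (simp_all add: add_box_def)
  ultimately show ?thesis using assms(2) unfolding strip_def by blast
qed

text \<open>A strip begins in the topmost empty row below \<open>l\<close>, which is row
  \<open>p\<close>.\<close>

lemma block_first:
  assumes "p < l" "\<forall>r. 0 < x r \<longleftrightarrow> Suc p \<le> r \<and> r < l"
  shows "block_step l x j \<and> x j = 0 \<longleftrightarrow> j = p"
proof -
  have x: "x r = 0 \<longleftrightarrow> \<not> (Suc p \<le> r \<and> r < l)" for r using assms(2) by (metis not_gr_zero)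
  show ?thesis
  proof
    assume A: "block_step l x j \<and> x j = 0"
    then have "j < l" "j \<le> p" using x[of j] by (auto simp: block_step_def)
    moreover have "\<not> j < p" using A x[of p] assms(1) by (auto simp: block_step_def)
    ultimately show "j = p" by simp
  next
    assume "j = p"
    moreover have "x r = 0" if "r < p" for r using x[of r] that by simp
    ultimately show "block_step l x j \<and> x j = 0" using assms x[of p] by (auto simp: block_step_def)
  qed
qed

text \<open>Invariant: among all rows changed by the strip, the row of the last box ends furthest
  right.\<close>

lemma block_word_strip:
  assumes p: "p < l" and x: "\<forall>r. 0 < x r \<longleftrightarrow> Suc p \<le> r \<and> r < l"
    and b: "block_word l x b" "b \<noteq> []"
  shows "strip p l x (add_word x b) \<and> x (last b) < add_word x b (last b) \<and>
    (\<forall>r. x r < add_word x b r \<longrightarrow> add_word x b r \<le> add_word x b (last b)) \<and>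
    add_word x b (last b) = Suc (add_word x (butlast b) (last b))"
  using b
proof (induction b rule: rev_induct)
  case (snoc j b)
  show ?case
  proof (cases "b = []")
    case True
    then have "j = p" using snoc block_first[OF p x] by (simp add: block_word_singleton)
    have "add_word x [p] = add_box x p" using add_word_snoc[of x "[]" p] by simp
    moreover have "add_box x p r \<le> add_box x p p" if "x r < add_box x p r" for r
      using that by (simp add: add_box_def split: if_splits)
    moreover have "add_box x p p = Suc (x p)" by (simp add: add_box_def)
    ultimately show ?thesis using True \<open>j = p\<close> strip_first_box[OF p x] by simp
  next
    case False
    let ?z = "add_word x b"
    have B: "block_word l x b" "block_step l ?z j" "add_word x (butlast b) (last b) < ?z j"
      using snoc(2) block_word_snoc[OF False] by auto
    have IH: "strip p l x ?z" "\<And>r. x r < ?z r \<Longrightarrow> ?z r \<le> ?z (last b)" "?z (last b) = Suc (add_word x (butlast b) (last b))"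
      using snoc(1)[OF B(1) False] by auto
    have max: "?z r \<le> ?z j" if "x r < ?z r" for r using IH(2)[OF that] IH(3) B(3) by simp
    have V: "strip p l x (add_box ?z j)"
      by (rule strip_add_max[OF IH(1) max]) (use B in \<open>auto simp: block_step_def\<close>)
    have "x j \<le> ?z j" by (simp add: add_word_def)
    moreover have "add_box ?z j r \<le> Suc (?z j)" if "x r < add_box ?z j r" for r
      using max[of r] that by (auto simp: add_box_def split: if_splits)
    ultimately show ?thesis using V by (simp add: add_word_snoc) (simp add: add_box_def)
  qed
qed simp

text \<open>The last box lies in the changed row that ends furthest right, and this row is unique
  because the columns of a strip are distinct.\<close>

lemma block_word_unique:
  assumes p: "p < l" and x: "\<forall>r. 0 < x r \<longleftrightarrow> Suc p \<le> r \<and> r < l"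
  shows "block_word l x b \<Longrightarrow> block_word l x c \<Longrightarrow> b \<noteq> [] \<Longrightarrow> c \<noteq> [] \<Longrightarrow>
    add_word x b = add_word x c \<Longrightarrow> b = c"
proof (induction b arbitrary: c rule: rev_induct)
  case (snoc j b)
  obtain d i where c: "c = d @ [i]" using snoc by (cases c rule: rev_cases) auto
  have P: "strip p l x (add_word x (b @ [j]))" "x j < add_word x (b @ [j]) j"
    "\<And>r. x r < add_word x (b @ [j]) r \<Longrightarrow> add_word x (b @ [j]) r \<le> add_word x (b @ [j]) j"
    using block_word_strip[OF p x snoc(2,4)] by auto
  have Q: "x i < add_word x (b @ [j]) i"
    "\<And>r. x r < add_word x (b @ [j]) r \<Longrightarrow> add_word x (b @ [j]) r \<le> add_word x (b @ [j]) i"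
    using block_word_strip[OF p x snoc(3,5)] snoc(6) c by auto
  have "add_word x (b @ [j]) i = add_word x (b @ [j]) j" using P(2,3) Q by (meson le_antisym)
  then have ij: "i = j" using strip_distinct_columns[OF P(1), of i "add_word x (b @ [j]) j" j] P(2) Q(1) by simp
  have eq: "add_word x b = add_word x d"
    using snoc(6) c ij by (auto simp: add_word_snoc dest: add_box_inj)
  have one: "w = []" if w: "block_word l x (w @ [j])" "\<forall>r. count_list w r = 0" for w
    using w(2) by (cases w) (auto split: if_splits)
  show ?case
  proof (cases "b = [] \<or> d = []")
    case True
    then have "\<forall>r. count_list b r = count_list d r" using fun_cong[OF eq] by (simp add: add_word_def)
    then have "b = []" "d = []" using True one[of b] one[of d] snoc(2,3) c ij by auto
    then show ?thesis using c ij by simp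
  next
    case False
    then show ?thesis using snoc(1)[of d] snoc(2,3) eq c ij block_word_snoc[of b] block_word_snoc[of d] by auto
  qed
qed simp

lemma strip_eq_first:
  assumes V: "strip p l x y" and p: "p < l" and le: "\<And>r. x r < y r \<Longrightarrow> y r \<le> 1"
  shows "y = add_box x p"
proof
  fix r
  have sx: "0 < x r \<longleftrightarrow> Suc p \<le> r \<and> r < l" and sy: "0 < y r \<longleftrightarrow> p \<le> r \<and> r < l" and xy: "x r \<le> y r"
    using V unfolding strip_def by blast+
  show "y r = add_box x p r"
    using sx sy xy le[of r] p by (cases "r = p"; cases "x r < y r") (auto simp: add_box_def)
qed

text \<open>Boxes are removed from the changed row that ends furthest right, until only the first
  box of row \<open>p\<close> remains.\<close>

lemma block_word_exists:
  assumes p: "p < l" and V: "strip p l x y"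
  shows "\<exists>b. block_word l x b \<and> b \<noteq> [] \<and> add_word x b = y"
  using V
proof (induction "\<Sum>r<l. y r" arbitrary: y rule: less_induct)
  case less
  have x: "\<forall>r. 0 < x r \<longleftrightarrow> Suc p \<le> r \<and> r < l" using less(2) unfolding strip_def by blast
  have sy: "0 < y r \<longleftrightarrow> p \<le> r \<and> r < l" and xy: "x r \<le> y r" for r using less(2) unfolding strip_def by blast+
  show ?case
  proof (cases "\<forall>r. x r < y r \<longrightarrow> y r \<le> 1")
    case True
    then have "y = add_box x p" using strip_eq_first[OF less(2) p] by blast
    then show ?thesis using block_first[OF p x, of p] add_word_snoc[of x "[]" p]
      by (intro exI[of _ "[p]"]) (simp add: block_word_singleton)
  next
    case False
    define H where "H = {r. x r < y r}"
    have H: "finite H" "H \<noteq> {}" using False sy xy unfolding H_def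
      by (auto intro!: finite_subset[of _ "{..<l}"]) (metis le_zero_eq lessThan_iff not_gr_zero not_less_zero sy)+
    have "Max (y ` H) \<in> y ` H" using H by (intro Max_in) auto
    then obtain j where j1: "j \<in> H" "y j = Max (y ` H)" by auto
    then have j: "j \<in> H" "\<And>r. r \<in> H \<Longrightarrow> y r \<le> y j" using H by simp_all
    have j2: "2 \<le> y j" using False j(2) unfolding H_def by force
    define z where "z = y(j := y j - 1)"
    have y: "y = add_box z j" using j2 by (auto simp: z_def add_box_def)
    have zj: "y j = Suc (z j)" "0 < z j" using j2 by (auto simp: z_def)
    have R: "strip p l x z" "\<forall>r<j. z r \<noteq> Suc (z j)" "\<And>r. x r < z r \<Longrightarrow> z r \<le> z j"
      using strip_remove_max[of p l x z j] less(2) j zj y unfolding H_def by (auto simp: less_Suc_eq_le)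
    have jl: "p \<le> j" "j < l" using sy[of j] j2 by auto
    have "(\<Sum>r<l. z r) < (\<Sum>r<l. y r)"
      by (rule sum_strict_mono_ex1) (use jl j2 in \<open>auto simp: z_def intro!: bexI[of _ j]\<close>)
    then obtain b where b: "block_word l x b" "b \<noteq> []" "add_word x b = z" using less(1) R(1) by blast
    have BS: "x (last b) < z (last b)" "z (last b) = Suc (add_word x (butlast b) (last b))"
      using block_word_strip[OF p x b(1,2)] b(3) by auto
    have "block_step l z j" using jl R(2) zj by (simp add: block_step_def)
    moreover have "add_word x (butlast b) (last b) < z j" using R(3)[OF BS(1)] BS(2) by simp
    ultimately have "block_word l x (b @ [j])" using block_word_snoc[OF b(2)] b by simp
    then show ?thesis using b y by (intro exI[of _ "b @ [j]"]) (simp add: add_word_snoc)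
  qed
qed

text \<open>The recording conditions on a word: at the partial sums of \<open>\<gamma>\<close>,
  including \<open>0\<close> and excluding the total, a strip starts in column 1; elsewhere the
  columns increase. Positions count from \<open>0\<close>, so these sums are exactly the first
  positions of the strips.\<close>

definition strip_word :: "nat \<Rightarrow> nat list \<Rightarrow> nat list \<Rightarrow> bool" where
  "strip_word l \<gamma> v \<longleftrightarrow> length v = sum_list \<gamma> \<and>
     (\<forall>k<length v. block_step l (count_list (take k v)) (v ! k) \<and>
        (if \<exists>i<length \<gamma>. k = sum_list (take i \<gamma>) then count_list (take k v) (v ! k) = 0
         else word_col v (k - 1) < word_col v k))"

lemma strip_word_Nil: "strip_word l [] v \<longleftrightarrow> v = []"
  by (auto simp: strip_word_def)

lemma all_less_add_iff: "(\<forall>k<m + n. A k) \<longleftrightarrow> (\<forall>k<m. A k) \<and> (\<forall>k<n. A (m + k))" for m n :: nat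
proof (intro iffI conjI allI impI; (elim conjE)?)
  fix k assume A: "\<forall>k<m. A k" "\<forall>k<n. A (m + k)" "k < m + n"
  show "A k"
  proof (cases "k < m")
    case False
    then show ?thesis using A(2)[rule_format, of "k - m"] A(3) by simp
  qed (use A(1) in blast)
qed simp_all

text \<open>The starts for \<open>\<gamma> @ [a]\<close> are those for \<open>\<gamma>\<close>
  together with \<open>sum_list \<gamma>\<close>, so the last strip splits off as a word over the
  state reached before it.\<close>

lemma strip_word_append:
  assumes g: "0 \<notin> set \<gamma>" "0 < a"
  shows "strip_word l (\<gamma> @ [a]) (w @ b) \<and> length w = sum_list \<gamma> \<longleftrightarrow>
    strip_word l \<gamma> w \<and> length b = a \<and> block_word l (count_list w) b"
proof (cases "length w = sum_list \<gamma> \<and> length b = a")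
  case True
  let ?N = "length w"
  define P where "P \<gamma> v k \<longleftrightarrow> block_step l (count_list (take k v)) (v ! k) \<and>
        (if \<exists>i<length \<gamma>. k = sum_list (take i \<gamma>) then count_list (take k v) (v ! k) = 0
         else word_col v (k - 1) < word_col v k)" for \<gamma> v k
  have st: "(\<exists>i<length (\<gamma> @ [a]). k = sum_list (take i (\<gamma> @ [a]))) \<longleftrightarrow>
      (\<exists>i<length \<gamma>. k = sum_list (take i \<gamma>)) \<or> k = ?N" for k
    using True by (auto simp: less_Suc_eq)
  have lt: "sum_list (take i \<gamma>) < ?N" if "i < length \<gamma>" for i
    using sum_list_take_less[OF g(1) that] True by simp
  have 1: "P (\<gamma> @ [a]) (w @ b) k \<longleftrightarrow> P \<gamma> w k" if k: "k < ?N" for k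
  proof -
    have wc: "word_col (w @ b) i = word_col w i" if "i < ?N" for i using that by (simp add: nth_append word_col_def)
    have "word_col (w @ b) k = word_col w k" "word_col (w @ b) (k - 1) = word_col w (k - 1)"
      by (rule wc; use k in simp)+
    then show ?thesis unfolding P_def st using k by (auto simp: nth_append)
  qed
  have tk: "count_list (take (?N + k) (w @ b)) = add_word (count_list w) (take k b)" for k
    by (auto simp: add_word_def)
  have 2: "P (\<gamma> @ [a]) (w @ b) (?N + k) \<longleftrightarrow> block_step l (add_word (count_list w) (take k b)) (b ! k) \<and>
     (if k = 0 then count_list w (b ! 0) = 0
      else add_word (count_list w) (take (k - 1) b) (b ! (k - 1)) < add_word (count_list w) (take k b) (b ! k))"
    if k: "k < a" for k
  proof -
    have c: "(\<exists>i<length (\<gamma> @ [a]). ?N + k = sum_list (take i (\<gamma> @ [a]))) \<longleftrightarrow> k = 0"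
    proof -
      have "?N + k \<noteq> sum_list (take i \<gamma>)" if "i < length \<gamma>" for i using lt[OF that] by simp
      then show ?thesis unfolding st by auto
    qed
    moreover have "(w @ b) ! (?N + k) = b ! k" by (simp add: nth_append)
    moreover have "word_col (w @ b) (?N + k) = Suc (add_word (count_list w) (take k b) (b ! k))" 
      using word_col_eq[of "?N + k" "w @ b"] k True unfolding tk by (simp add: nth_append)
    moreover have "word_col (w @ b) (?N + k - 1) = Suc (add_word (count_list w) (take (k - 1) b) (b ! (k - 1)))" if "k \<noteq> 0"
      using word_col_eq[of "?N + (k - 1)" "w @ b"] k True that unfolding tk by (simp add: nth_append)
    ultimately show ?thesis unfolding P_def tk c by (cases "k = 0") simp_all
  qed
  have "(\<forall>k<?N + a. P (\<gamma> @ [a]) (w @ b) k) \<longleftrightarrow> (\<forall>k<?N. P \<gamma> w k) \<and> (\<forall>k<a. P (\<gamma> @ [a]) (w @ b) (?N + k))"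
  proof -
    note all_less_add_iff[of ?N a "P (\<gamma> @ [a]) (w @ b)"]
    then show ?thesis using 1 by blast
  qed
  then show ?thesis using True 2 unfolding strip_word_def block_word_def P_def[symmetric] by simp
qed (auto simp: strip_word_def)

text \<open>The word follows \<open>rev \<alpha>\<close>, so its last strip belongs to the first
  part of \<open>\<alpha>\<close>; the states are listed from the outermost inwards, as in
  \<open>strips\<close>.\<close>

fun strip_states :: "nat list \<Rightarrow> nat list \<Rightarrow> (nat \<Rightarrow> nat) list" where
  "strip_states [] v = []"
| "strip_states (a # \<alpha>) v = count_list v # strip_states \<alpha> (take (sum_list \<alpha>) v)"

lemma strip_word_Cons_iff:
  assumes "0 \<notin> set (a # \<alpha>)"
  shows "strip_word l (rev (a # \<alpha>)) v \<longleftrightarrow> (\<exists>w b. v = w @ b \<and> length w = sum_list \<alpha> \<and> strip_word l (rev \<alpha>) w \<and>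
    length b = a \<and> block_word l (count_list w) b)"
proof -
  have g: "0 \<notin> set (rev \<alpha>)" "0 < a" using assms by auto
  have s: "sum_list (rev \<alpha>) = sum_list \<alpha>" by (simp add: sum_list_rev)
  show ?thesis
  proof
    assume v: "strip_word l (rev (a # \<alpha>)) v"
    then have "length v = sum_list \<alpha> + a" by (simp add: strip_word_def s)
    then show "\<exists>w b. v = w @ b \<and> length w = sum_list \<alpha> \<and> strip_word l (rev \<alpha>) w \<and>
      length b = a \<and> block_word l (count_list w) b"
      using strip_word_append[OF g, of l "take (sum_list \<alpha>) v" "drop (sum_list \<alpha>) v"] v s
      by (intro exI[of _ "take (sum_list \<alpha>) v"] exI[of _ "drop (sum_list \<alpha>) v"]) simp
  next
    assume "\<exists>w b. v = w @ b \<and> length w = sum_list \<alpha> \<and> strip_word l (rev \<alpha>) w \<and>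
      length b = a \<and> block_word l (count_list w) b"
    then show "strip_word l (rev (a # \<alpha>)) v" using strip_word_append[OF g, of l] by auto
  qed
qed

lemma sum_add_word:
  assumes "\<And>r. r \<in> set b \<Longrightarrow> r < l"
  shows "(\<Sum>r<l. add_word x b r) = (\<Sum>r<l. x r) + length b"
proof -
  have "(\<Sum>r<l. count_list b r) = length b"
    by (rule sum_count_set) (use assms in auto)
  then show ?thesis by (simp add: add_word_def sum.distrib)
qed

lemma block_word_less: "block_word l x b \<Longrightarrow> r \<in> set b \<Longrightarrow> r < l"
  by (auto simp: block_word_def block_step_def in_set_conv_nth)

text \<open>Each strip opens one row and the first column fills from the top, so the strips
  performed so far occupy the top \<open>length \<alpha>\<close> of the \<open>l\<close>
  rows.\<close>

lemma strip_states_strips: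
  assumes "0 \<notin> set \<alpha>" "strip_word l (rev \<alpha>) v"
  shows "length \<alpha> \<le> l \<and> strips (l - length \<alpha>) \<alpha> (strip_states \<alpha> v) \<and> top_state (strip_states \<alpha> v) = count_list v"
  using assms
proof (induction \<alpha> arbitrary: v)
  case Nil then show ?case by (simp add: strip_word_Nil fun_eq_iff)
next
  case (Cons a \<alpha>)
  obtain w b where v: "v = w @ b" "length w = sum_list \<alpha>" "strip_word l (rev \<alpha>) w" "length b = a"
    "block_word l (count_list w) b" using Cons(3) strip_word_Cons_iff[OF Cons(2)] by blast
  have tw: "take (sum_list \<alpha>) v = w" using v by simp
  have IH: "length \<alpha> \<le> l" "strips (l - length \<alpha>) \<alpha> (strip_states \<alpha> w)" "top_state (strip_states \<alpha> w) = count_list w"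
    using Cons(1)[OF _ v(3)] Cons(2) by auto
  have b: "b \<noteq> []" using v Cons(2) by auto
  have sup: "0 < count_list w r \<longleftrightarrow> l - length \<alpha> \<le> r \<and> r < l" for r
    using strips_support[OF IH(2), of r] IH(1,3) by simp
  \<comment> \<open>If all rows were in use, the next strip could not start in the first
    column.\<close>
  have lt: "length \<alpha> < l"
  proof (rule ccontr)
    assume "\<not> length \<alpha> < l"
    then have "length \<alpha> = l" using IH by simp
    moreover have "b ! 0 < l" using block_word_less[OF v(5)] b by simp
    moreover have "count_list w (b ! 0) = 0" using v(5) b by (auto simp: block_word_def)
    ultimately show False using sup[of "b ! 0"] by simp
  qed
  define p where "p = l - length (a # \<alpha>)"
  have p: "l - length \<alpha> = Suc p" "p < l" "Suc p + length \<alpha> = l" using lt by (auto simp: p_def)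
  have "strip p l (count_list w) (add_word (count_list w) b)"
    using block_word_strip[OF p(2) _ v(5) b] sup p(1) by auto
  moreover have av: "add_word (count_list w) b = count_list v" by (auto simp: add_word_def v)
  moreover have "(\<Sum>r<l. count_list v r) = (\<Sum>r<l. count_list w r) + a"
    using sum_add_word[of b l "count_list w"] block_word_less[OF v(5)] v(4) av by simp
  ultimately show ?case using IH lt p tw unfolding p_def[symmetric] by simp
qed

lemma strip_states_inj:
  assumes "0 \<notin> set \<alpha>" "strip_word l (rev \<alpha>) v" "strip_word l (rev \<alpha>) v'" "strip_states \<alpha> v = strip_states \<alpha> v'"
  shows "v = v'"
  using assms
proof (induction \<alpha> arbitrary: v v')
  case Nil then show ?case by (simp add: strip_word_Nil)
next
  case (Cons a \<alpha>)
  obtain w b where v: "v = w @ b" "length w = sum_list \<alpha>" "strip_word l (rev \<alpha>) w" "length b = a"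
    "block_word l (count_list w) b" using Cons(3) strip_word_Cons_iff[OF Cons(2)] by blast
  obtain w' b' where v': "v' = w' @ b'" "length w' = sum_list \<alpha>" "strip_word l (rev \<alpha>) w'" "length b' = a"
    "block_word l (count_list w') b'" using Cons(4) strip_word_Cons_iff[OF Cons(2)] by blast
  have w: "w = w'" using Cons(1)[OF _ v(3) v'(3)] Cons(2,5) v(1,2) v'(1,2) by simp
  have S: "length \<alpha> \<le> l" "strips (l - length \<alpha>) \<alpha> (strip_states \<alpha> w)" "top_state (strip_states \<alpha> w) = count_list w"
    using strip_states_strips[OF _ v(3)] Cons(2) by auto
  have L: "length (a # \<alpha>) \<le> l" using strip_states_strips[OF Cons(2,3)] by blast
  define p where "p = l - length (a # \<alpha>)"
  have p: "l - length \<alpha> = Suc p" "p < l" using L by (auto simp: p_def)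
  have sup: "\<forall>r. 0 < count_list w r \<longleftrightarrow> Suc p \<le> r \<and> r < l"
  proof -
    have e: "l - length \<alpha> + length \<alpha> = l" using S(1) by simp
    show ?thesis using strips_support[OF S(2), unfolded e S(3)] unfolding p(1) by blast
  qed
  have "add_word (count_list w) b = add_word (count_list w) b'"
    using Cons(5) v(1) v'(1) w by (auto simp: add_word_def fun_eq_iff)
  then have "b = b'"
  proof -
    have ne: "b \<noteq> []" "b' \<noteq> []" using v(4) v'(4) Cons(2) by auto
    show ?thesis by (rule block_word_unique[OF p(2) sup v(5) _ ne]) (use v'(5) w \<open>add_word (count_list w) b = _\<close> in simp_all)
  qed
  then show ?case using v v' w by simp
qed

lemma strip_states_surj:
  assumes "0 \<notin> set \<alpha>" "strips p \<alpha> ys" "p + length \<alpha> = l"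
  shows "\<exists>v. strip_word l (rev \<alpha>) v \<and> strip_states \<alpha> v = ys"
  using assms
proof (induction \<alpha> arbitrary: p ys)
  case Nil then show ?case by (auto simp: strip_word_Nil)
next
  case (Cons a \<alpha>)
  obtain y zs where ys: "ys = y # zs" using Cons(3) by (cases ys) auto
  have S: "strips (Suc p) \<alpha> zs" "strip p l (top_state zs) y" "(\<Sum>r<l. y r) = (\<Sum>r<l. top_state zs r) + a"
    using Cons(3,4) ys by auto
  obtain w where w: "strip_word l (rev \<alpha>) w" "strip_states \<alpha> w = zs" using Cons(1)[OF _ S(1)] Cons(2,4) by auto
  have top: "top_state zs = count_list w" using strip_states_strips[OF _ w(1)] Cons(2) w(2) by simp
  have "p < l" using Cons(4) by simp
  then obtain b where b: "block_word l (count_list w) b" "b \<noteq> []" "add_word (count_list w) b = y"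
    using block_word_exists S(2) top by metis
  have "length b = a" using sum_add_word[of b l "count_list w"] block_word_less[OF b(1)] b(3) S(3) top by simp
  moreover have lw: "length w = sum_list \<alpha>" using w(1) by (simp add: strip_word_def sum_list_rev)
  ultimately have "strip_word l (rev (a # \<alpha>)) (w @ b)" using strip_word_Cons_iff[OF Cons(2)] w(1) b(1) by blast
  moreover have "strip_states (a # \<alpha>) (w @ b) = ys"
    using lw w(2) b(3) ys by (auto simp: add_word_def)
  ultimately show ?case by blast
qed

text \<open>Between two consecutive states the boxes of a strip can be added in only one order, so
  the states determine the word.\<close>

lemma card_strip_words:
  assumes a: "0 \<notin> set \<alpha>" and b: "0 \<notin> set \<beta>"
  shows "card {v. strip_word (length \<beta>) (rev \<alpha>) v \<and> count_list v = nth_default 0 \<beta>} =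
    card {ys. strips 0 \<alpha> ys \<and> top_state ys = nth_default 0 \<beta>}"
proof (rule bij_betw_same_card[of "strip_states \<alpha>"], intro bij_betw_imageI equalityI subsetI)
  let ?l = "length \<beta>"
  have len: "length \<alpha> = ?l" if "strips p \<alpha> ys" "p + length \<alpha> = ?l" "top_state ys = nth_default 0 \<beta>" for p ys
    using strips_support[OF that(1), of 0] nth_default_pos_iff[OF b, of 0] that(2,3) by (cases \<beta>) auto
  show "inj_on (strip_states \<alpha>) {v. strip_word ?l (rev \<alpha>) v \<and> count_list v = nth_default 0 \<beta>}"
    using strip_states_inj[OF a] by (auto simp: inj_on_def)
  fix ys assume "ys \<in> strip_states \<alpha> ` {v. strip_word ?l (rev \<alpha>) v \<and> count_list v = nth_default 0 \<beta>}"
  then obtain v where v: "strip_word ?l (rev \<alpha>) v" "count_list v = nth_default 0 \<beta>" "ys = strip_states \<alpha> v" by blast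
  then show "ys \<in> {ys. strips 0 \<alpha> ys \<and> top_state ys = nth_default 0 \<beta>}"
    using strip_states_strips[OF a v(1)] len[of "?l - length \<alpha>" ys] by auto
next
  let ?l = "length \<beta>"
  fix ys assume ys: "ys \<in> {ys. strips 0 \<alpha> ys \<and> top_state ys = nth_default 0 \<beta>}"
  then have "r < length \<alpha> \<longleftrightarrow> r < ?l" for r
    using strips_support[of 0 \<alpha> ys r] nth_default_pos_iff[OF b, of r] by auto
  then have "length \<alpha> = ?l" by (metis linorder_neqE_nat order_less_irrefl)
  then obtain v where v: "strip_word ?l (rev \<alpha>) v" "strip_states \<alpha> v = ys" using strip_states_surj[OF a, of 0 ys ?l] ys by auto
  then show "ys \<in> strip_states \<alpha> ` {v. strip_word ?l (rev \<alpha>) v \<and> count_list v = nth_default 0 \<beta>}"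
    using strip_states_strips[OF a v(1)] ys by auto
qed

text \<open>Turns sequences into intervals, so that maximality can be tested at the two
  ends.\<close>

lemma strip_sequence_upt_iff:
  "strip_sequence \<beta> Q as \<longleftrightarrow> (\<exists>h m. as = [h..<m] \<and> 1 \<le> h \<and> h < m \<and> m \<le> Suc (sum_list \<beta>) \<and>
     (\<forall>k. h \<le> k \<and> Suc k < m \<longrightarrow> column_of \<beta> Q k < column_of \<beta> Q (Suc k)))"
proof
  assume S: "strip_sequence \<beta> Q as"
  define h where "h = as ! 0"
  define m where "m = h + length as"
  have ne: "as \<noteq> []" and sub: "set as \<subseteq> {1..sum_list \<beta>}"
    and step: "\<And>i. Suc i < length as \<Longrightarrow> as ! Suc i = as ! i + 1 \<and> column_of \<beta> Q (as ! i) < column_of \<beta> Q (as ! Suc i)"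
    using S unfolding strip_sequence_def by auto
  have nth: "as ! i = h + i" if "i < length as" for i
    using that by (induction i) (use step in \<open>auto simp: h_def\<close>)
  have "as = [h..<m]" by (rule nth_equalityI) (auto simp: m_def nth)
  moreover have hm: "h < m" using ne by (simp add: m_def)
  moreover have "set as = {h..<m}" using calculation(1) by (metis set_upt)
  then have "h \<in> set as" "m - 1 \<in> set as" using hm by auto
  then have "1 \<le> h" "m \<le> Suc (sum_list \<beta>)" using sub hm by fastforce+
  moreover note this
  moreover have "column_of \<beta> Q k < column_of \<beta> Q (Suc k)" if "h \<le> k \<and> Suc k < m" for k
  proof -
    have i: "Suc (k - h) < length as" "h + (k - h) = k" using that by (auto simp: m_def)
    then show ?thesis using step[OF i(1)] nth[of "k - h"] nth[OF i(1)] by simp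
  qed
  ultimately show "\<exists>h m. as = [h..<m] \<and> 1 \<le> h \<and> h < m \<and> m \<le> Suc (sum_list \<beta>) \<and>
     (\<forall>k. h \<le> k \<and> Suc k < m \<longrightarrow> column_of \<beta> Q k < column_of \<beta> Q (Suc k))"
    by (intro exI[of _ h] exI[of _ m]) auto
next
  assume "\<exists>h m. as = [h..<m] \<and> 1 \<le> h \<and> h < m \<and> m \<le> Suc (sum_list \<beta>) \<and>
     (\<forall>k. h \<le> k \<and> Suc k < m \<longrightarrow> column_of \<beta> Q k < column_of \<beta> Q (Suc k))"
  then show "strip_sequence \<beta> Q as" unfolding strip_sequence_def by auto
qed

text \<open>From right to left: all columns are positive, so no increase leads into column 1 and the
  blocks of \<open>\<gamma>\<close> are maximal; a strip that starts inside a block could be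
  prolonged to the left.\<close>

lemma row_strips_iff:
  assumes g: "0 \<notin> set \<gamma>" "sum_list \<gamma> = sum_list \<beta>"
    and pos: "\<And>k. 1 \<le> k \<Longrightarrow> k \<le> sum_list \<beta> \<Longrightarrow> 1 \<le> column_of \<beta> Q k"
  shows "(\<forall>as. row_strip \<beta> Q as \<longrightarrow> column_of \<beta> Q (hd as) = 1) \<and>
      (\<forall>i<length \<gamma>. \<exists>as. row_strip \<beta> Q as \<and> hd as = sum_list (take i \<gamma>) + 1 \<and> length as = \<gamma> ! i) \<longleftrightarrow>
    (\<forall>k. k < sum_list \<beta> \<longrightarrow> (if \<exists>i<length \<gamma>. k = sum_list (take i \<gamma>) then column_of \<beta> Q (Suc k) = 1
         else column_of \<beta> Q k < column_of \<beta> Q (Suc k)))"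
    (is "?L1 \<and> ?L2 \<longleftrightarrow> ?R")
proof
  let ?c = "column_of \<beta> Q" and ?s = "\<lambda>i. sum_list (take i \<gamma>)" and ?n = "sum_list \<beta>"
  assume L: "?L1 \<and> ?L2"
  have blk: "?c (Suc (?s i)) = 1" "\<And>k. ?s i < k \<Longrightarrow> Suc k \<le> ?s (Suc i) \<Longrightarrow> ?c k < ?c (Suc k)" if i: "i < length \<gamma>" for i
  proof -
    obtain as where as: "row_strip \<beta> Q as" "hd as = ?s i + 1" "length as = \<gamma> ! i" using L i by blast
    then show "?c (Suc (?s i)) = 1" using L by (metis Suc_eq_plus1)
    obtain h m where hm: "as = [h..<m]" "h < m" "\<forall>k. h \<le> k \<and> Suc k < m \<longrightarrow> ?c k < ?c (Suc k)"
      using as(1) unfolding row_strip_def strip_sequence_upt_iff by blast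
    then have "h = Suc (?s i)" "m = Suc (?s (Suc i))"
      using as(2,3) i by (auto simp: take_Suc_conv_app_nth)
    then show "?c k < ?c (Suc k)" if "?s i < k" "Suc k \<le> ?s (Suc i)" for k using hm(3) that by simp
  qed
  show ?R
  proof (intro allI impI)
    fix k assume k: "k < ?n"
    show "if \<exists>i<length \<gamma>. k = ?s i then ?c (Suc k) = 1 else ?c k < ?c (Suc k)"
    proof (cases "\<exists>i<length \<gamma>. k = ?s i")
      case True then show ?thesis using blk(1) by auto
    next
      case False
      obtain i where i: "i < length \<gamma>" "?s i < Suc k" "Suc k \<le> ?s (Suc i)"
        using block_exists[of "Suc k" \<gamma>] k g(2) by auto
      then have "?s i < k" using False by (metis less_SucE)
      then show ?thesis unfolding if_not_P[OF False] by (rule blk(2)[OF i(1) _ i(3)])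
    qed
  qed
next
  let ?c = "column_of \<beta> Q" and ?s = "\<lambda>i. sum_list (take i \<gamma>)" and ?n = "sum_list \<beta>"
  assume R: ?R
  have start: "?c (Suc (?s i)) = 1" if "i < length \<gamma>" for i
  proof -
    have E: "\<exists>j<length \<gamma>. ?s i = ?s j" using that by blast
    have "?s i < ?n" using sum_list_take_less[OF g(1) that] g(2) by simp
    from R[rule_format, OF this] show ?thesis unfolding if_P[OF E] .
  qed
  have step: "?c k < ?c (Suc k)" if "i < length \<gamma>" "?s i < k" "k < ?s (Suc i)" for i k
  proof -
    have "k \<noteq> ?s j" if "j < length \<gamma>" for j
    proof
      assume "k = ?s j"
      then have "i < j" "j < Suc i"
        using sum_list_take_less_iff[OF g(1), of i j] sum_list_take_less_iff[OF g(1), of j "Suc i"] that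
          \<open>i < length \<gamma>\<close> \<open>?s i < k\<close> \<open>k < ?s (Suc i)\<close> by auto
      then show False by simp
    qed
    moreover have "?s (Suc i) \<le> ?n"
      using sum_list_take_less[OF g(1), of "Suc i" "length \<gamma>"] that g(2) by (cases "Suc i = length \<gamma>") auto
    ultimately show ?thesis using R[rule_format, of k] that(3) by auto
  qed
  have end_le: "?s (Suc i) \<le> ?n" if "i < length \<gamma>" for i
    using sum_list_take_less[OF g(1), of "Suc i" "length \<gamma>"] that g(2) by (cases "Suc i = length \<gamma>") auto
  have strip: "row_strip \<beta> Q [Suc (?s i)..<Suc (?s (Suc i))]" if i: "i < length \<gamma>" for i
    unfolding row_strip_def
  proof (intro conjI allI impI)
    have lt: "?s i < ?s (Suc i)" using sum_list_take_less[OF g(1)] i by simp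
    show "strip_sequence \<beta> Q [Suc (?s i)..<Suc (?s (Suc i))]"
      unfolding strip_sequence_upt_iff
      by (intro exI[of _ "Suc (?s i)"] exI[of _ "Suc (?s (Suc i))"]) (use lt end_le[OF i] step[OF i] in auto)
    fix bs assume bs: "strip_sequence \<beta> Q bs \<and> set [Suc (?s i)..<Suc (?s (Suc i))] \<subseteq> set bs"
    then obtain h m where hm: "bs = [h..<m]" "1 \<le> h" "h < m" "m \<le> Suc ?n"
      "\<forall>k. h \<le> k \<and> Suc k < m \<longrightarrow> ?c k < ?c (Suc k)"
      unfolding strip_sequence_upt_iff by blast
    have "Suc (?s i) \<in> set bs" "?s (Suc i) \<in> set bs" using bs lt by (auto simp del: upt_Suc)
    then have m: "h \<le> Suc (?s i)" "?s (Suc i) < m" using hm(1) by auto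
    have "h = Suc (?s i)"
    proof (rule ccontr)
      assume "h \<noteq> Suc (?s i)"
      then have "h \<le> ?s i" "Suc (?s i) < m \<or> Suc (?s i) = m" using m lt by auto
      moreover have "Suc (?s i) < m" using m lt by linarith
      ultimately have "?c (?s i) < ?c (Suc (?s i))" using hm(5) by blast
      moreover have "1 \<le> ?c (?s i)" using pos[of "?s i"] \<open>h \<le> ?s i\<close> hm(2) lt end_le[OF i] by simp
      ultimately show False using start[OF i] by simp
    qed
    moreover have "m = Suc (?s (Suc i))"
    proof (rule ccontr)
      assume "m \<noteq> Suc (?s (Suc i))"
      then have lm: "Suc (?s (Suc i)) < m" using m by simp
      then have si: "Suc i < length \<gamma>" using hm(4) g(2) i by (cases "Suc i = length \<gamma>") auto
      have "?c (?s (Suc i)) < ?c (Suc (?s (Suc i)))" using hm(5) lm m(1) lt by simp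
      moreover have "1 \<le> ?c (?s (Suc i))" using pos[of "?s (Suc i)"] lt end_le[OF i] by simp
      ultimately show False using start[OF si] by simp
    qed
    ultimately show "bs = [Suc (?s i)..<Suc (?s (Suc i))]" using hm(1) by simp
  qed
  have ?L2
  proof (intro allI impI)
    fix i assume i: "i < length \<gamma>"
    have "?s i < ?s (Suc i)" using sum_list_take_less[OF g(1)] i by simp
    then show "\<exists>as. row_strip \<beta> Q as \<and> hd as = ?s i + 1 \<and> length as = \<gamma> ! i"
      using strip[OF i] i by (intro exI[of _ "[Suc (?s i)..<Suc (?s (Suc i))]"])
        (auto simp: take_Suc_conv_app_nth simp del: upt_Suc)
  qed
  moreover have ?L1
  proof (intro allI impI)
    fix as assume as: "row_strip \<beta> Q as"
    then obtain h m where hm: "as = [h..<m]" "1 \<le> h" "h < m" "m \<le> Suc ?n"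
      "\<forall>k. h \<le> k \<and> Suc k < m \<longrightarrow> ?c k < ?c (Suc k)"
      unfolding row_strip_def strip_sequence_upt_iff by blast
    obtain i where i: "i < length \<gamma>" "?s i < h" "h \<le> ?s (Suc i)"
      using block_exists[of h \<gamma>] hm g(2) by auto
    have "h = Suc (?s i)"
    proof (rule ccontr)
      assume "h \<noteq> Suc (?s i)"
      then have h: "?s i < h - 1" "h - 1 < ?s (Suc i)" "1 \<le> h - 1" "Suc (h - 1) = h" using i by auto
      then have "?c (h - 1) < ?c h" using step[OF i(1)] by metis
      then have "?c k < ?c (Suc k)" if "h - 1 \<le> k" "Suc k < m" for k
        using hm(5) that h by (cases "k = h - 1") auto
      then have "strip_sequence \<beta> Q [h - 1..<m]"
        unfolding strip_sequence_upt_iff using h hm by (intro exI[of _ "h - 1"] exI[of _ m]) auto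
      moreover have "set as \<subseteq> set [h - 1..<m]" using hm(1) by auto
      ultimately have "[h - 1..<m] = as" using as unfolding row_strip_def by blast
      then have "length [h - 1..<m] = length [h..<m]" using hm(1) by simp
      then show False using h hm(3) by simp
    qed
    then show "?c (hd as) = 1" using start[OF i(1)] hm(1,3) by simp
  qed
  ultimately show "?L1 \<and> ?L2" by blast
qed

section \<open>Recording conditions in terms of prefix contents\<close>

lemma filling_less_iff:
  assumes "v \<in> row_words \<beta>" "k < length v" "(c, r) \<in> diagram \<beta>"
  shows "filling \<beta> v (c, r) < filling \<beta> v (box_at v k) \<longleftrightarrow> c \<le> count_list (take k v) (r - 1)"
  using filling_le_iff[OF assms(1,3), of k] filling_box_at(2)[OF assms(1,2)] by (simp add: less_Suc_eq_le)

text \<open>When a row opens, all higher rows must already be open.\<close>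

lemma filling_first_column_decreasing_iff:
  assumes b: "0 \<notin> set \<beta>" and v: "v \<in> row_words \<beta>"
  shows "(\<forall>r r'. (1, r) \<in> diagram \<beta> \<and> (1, r') \<in> diagram \<beta> \<and> r < r' \<longrightarrow> filling \<beta> v (1, r') < filling \<beta> v (1, r)) \<longleftrightarrow>
    (\<forall>k<length v. count_list (take k v) (v ! k) = 0 \<longrightarrow> (\<forall>r. v ! k < r \<and> r < length \<beta> \<longrightarrow> 0 < count_list (take k v) r))"
    (is "?L \<longleftrightarrow> ?R")
proof -
  have D: "(1, Suc r) \<in> diagram \<beta> \<longleftrightarrow> r < length \<beta>" for r
    using nth_default_pos_iff[OF b, of r] by (simp add: diagram_iff Suc_le_eq)
  show ?thesis
  proof
    assume L: ?L
    show ?R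
    proof (intro allI impI)
      fix k r assume k: "k < length v" "count_list (take k v) (v ! k) = 0" "v ! k < r \<and> r < length \<beta>"
      have box: "box_at v k = (1, Suc (v ! k))" using word_col_eq[OF k(1)] k(2) by (simp add: box_at_def)
      have "filling \<beta> v (1, Suc r) < filling \<beta> v (1, Suc (v ! k))" using L D k(3) by simp
      then show "0 < count_list (take k v) r"
        using filling_less_iff[OF v k(1), of 1 "Suc r"] D[of r] k(3) box by simp
    qed
  next
    assume R: ?R
    show ?L
    proof (intro allI impI)
      fix r r' assume A: "(1, r) \<in> diagram \<beta> \<and> (1, r') \<in> diagram \<beta> \<and> r < r'"
      then have "1 \<le> r" "1 \<le> r'" by (auto simp: diagram_iff)
      obtain k where k: "k < length v" "(1, r) = box_at v k" using filling_cases[OF v, of "(1, r)"] A by blast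
      then have "v ! k = r - 1" "count_list (take k v) (v ! k) = 0" using word_col_eq[OF k(1)] by (auto simp: box_at_def)
      moreover have "r' - 1 < length \<beta>" using D[of "r' - 1"] A \<open>1 \<le> r'\<close> by simp
      ultimately have "0 < count_list (take k v) (r' - 1)" using R k(1) A \<open>1 \<le> r\<close> by auto
      then show "filling \<beta> v (1, r') < filling \<beta> v (1, r)"
        using filling_less_iff[OF v k(1), of 1 r'] A k(2) by simp
    qed
  qed
qed

text \<open>At the entry in box \<open>(c, r)\<close>, a lower row with at least \<open>c\<close>
  boxes must already have at least \<open>c + 1\<close>; so its length differs from the length
  \<open>c\<close> that row \<open>r\<close> reaches.\<close>

lemma filling_recording_iff:
  assumes v: "v \<in> row_words \<beta>"
  shows "(\<forall>c r r'. r' < r \<and> (c, r) \<in> diagram \<beta> \<and> (c, r') \<in> diagram \<beta> \<and> filling \<beta> v (c, r') < filling \<beta> v (c, r) \<longrightarrow>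
        (c + 1, r') \<in> diagram \<beta> \<and> filling \<beta> v (c + 1, r') < filling \<beta> v (c, r)) \<longleftrightarrow>
    (\<forall>k<length v. \<forall>r<v ! k. count_list (take k v) r \<noteq> Suc (count_list (take k v) (v ! k)))"
    (is "?L \<longleftrightarrow> ?R")
proof -
  have D: "(c, Suc r) \<in> diagram \<beta>" if "1 \<le> c" "c \<le> count_list (take k v) r" for c r k
    using that count_list_take_le[of k v r] v by (simp add: diagram_iff row_words_def)
  show ?thesis
  proof
    assume L: ?L
    show ?R
    proof (intro allI impI notI)
      fix k r assume k: "k < length v" "r < v ! k"
        and eq: "count_list (take k v) r = Suc (count_list (take k v) (v ! k))"
      define c where "c = count_list (take k v) r"
      have box: "box_at v k = (c, Suc (v ! k))" using word_col_eq[OF k(1)] eq by (simp add: box_at_def c_def)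
      have dk: "(c, Suc (v ! k)) \<in> diagram \<beta>" using filling_box_at(1)[OF v k(1)] box by simp
      have dr: "(c, Suc r) \<in> diagram \<beta>" using D[of c k r] eq by (simp add: c_def)
      have "filling \<beta> v (c, Suc r) < filling \<beta> v (c, Suc (v ! k))"
        using filling_less_iff[OF v k(1) dr] box by (simp add: c_def)
      then have "(c + 1, Suc r) \<in> diagram \<beta> \<and> filling \<beta> v (c + 1, Suc r) < filling \<beta> v (c, Suc (v ! k))"
        using L[rule_format, of "Suc r" "Suc (v ! k)" c] k(2) dk dr by simp
      then show False using filling_less_iff[OF v k(1), of "c + 1" "Suc r"] box by (simp add: c_def)
    qed
  next
    assume R: ?R
    show ?L
    proof (intro allI impI)
      fix c r r'
      assume A: "r' < r \<and> (c, r) \<in> diagram \<beta> \<and> (c, r') \<in> diagram \<beta> \<and> filling \<beta> v (c, r') < filling \<beta> v (c, r)"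
      then have r: "1 \<le> r'" "1 \<le> c" by (auto simp: diagram_iff)
      obtain k where k: "k < length v" "(c, r) = box_at v k" using filling_cases[OF v, of "(c, r)"] A by blast
      then have c: "v ! k = r - 1" "c = Suc (count_list (take k v) (v ! k))" using word_col_eq[OF k(1)] by (auto simp: box_at_def)
      have "c \<le> count_list (take k v) (r' - 1)" using filling_less_iff[OF v k(1), of c r'] A k(2) by simp
      moreover have "r' - 1 < v ! k" using A c(1) r(1) by linarith
      then have "count_list (take k v) (r' - 1) \<noteq> c" using R k(1) c(2) by simp
      ultimately have le: "c + 1 \<le> count_list (take k v) (r' - 1)" by simp
      then have "(c + 1, r') \<in> diagram \<beta>" using D[of "c + 1" k "r' - 1"] r(1) by simp
      then show "(c + 1, r') \<in> diagram \<beta> \<and> filling \<beta> v (c + 1, r') < filling \<beta> v (c, r)"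
        using filling_less_iff[OF v k(1), of "c + 1" r'] le k(2) by simp
    qed
  qed
qed

lemma DIRT_filling_iff:
  assumes b: "0 \<notin> set \<beta>" and g: "\<gamma> \<in> compositions (sum_list \<beta>)" and v: "v \<in> row_words \<beta>"
  shows "filling \<beta> v \<in> DIRT \<beta> \<and> has_row_strip_shape \<beta> (filling \<beta> v) \<gamma> \<longleftrightarrow> strip_word (length \<beta>) \<gamma> v"
proof -
  let ?Q = "filling \<beta> v" and ?x = "\<lambda>k. count_list (take k v)"
  have len: "length v = sum_list \<beta>" using v by (simp add: row_words_def)
  have p: "0 \<notin> set \<gamma>" "sum_list \<gamma> = sum_list \<beta>" using g by (auto simp: compositions_pos)
  have col: "column_of \<beta> ?Q (Suc k) = Suc (?x k (v ! k))" "column_of \<beta> ?Q (Suc k) = word_col v k" if "k < sum_list \<beta>" for k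
    using column_of_filling[OF v, of k] word_col_eq[of k v] that len by auto
  have pos: "1 \<le> column_of \<beta> ?Q k" if "1 \<le> k" "k \<le> sum_list \<beta>" for k
    using col(1)[of "k - 1"] that by simp
  have rows: "v ! k < length \<beta>" if "k < length v" for k
    using filling_box_at(1)[OF v that] nth_default_pos_iff[OF b, of "v ! k"] by (auto simp: box_at_def diagram_def)
  have C: "(\<forall>k. k < sum_list \<beta> \<longrightarrow> (if \<exists>i<length \<gamma>. k = sum_list (take i \<gamma>) then column_of \<beta> ?Q (Suc k) = 1
         else column_of \<beta> ?Q k < column_of \<beta> ?Q (Suc k))) \<longleftrightarrow>
     (\<forall>k<length v. if \<exists>i<length \<gamma>. k = sum_list (take i \<gamma>) then ?x k (v ! k) = 0
         else word_col v (k - 1) < word_col v k)"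
  proof -
    have "column_of \<beta> ?Q k = word_col v (k - 1)"
      if "k < sum_list \<beta>" "\<not> (\<exists>i<length \<gamma>. k = sum_list (take i \<gamma>))" for k
    proof -
      \<comment> \<open>Position \<open>0\<close> is always a start of a strip, so elsewhere
        \<open>k - 1\<close> is a true predecessor.\<close>
      have "0 < length \<gamma>" using that(1) p(2)[symmetric] by (cases \<gamma>) simp_all
      then have "k \<noteq> 0" using that(2) by (metis sum_list.Nil take_0)
      then show ?thesis using col(2)[of "k - 1"] that(1) by simp
    qed
    then show ?thesis using col len by (auto simp: split: if_splits)
  qed
  define S where "S \<longleftrightarrow> (\<forall>k<length v. if \<exists>i<length \<gamma>. k = sum_list (take i \<gamma>) then ?x k (v ! k) = 0
         else word_col v (k - 1) < word_col v k)"
  have I: "(\<forall>as. row_strip \<beta> ?Q as \<longrightarrow> column_of \<beta> ?Q (hd as) = 1) \<and>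
      (\<forall>i<length \<gamma>. \<exists>as. row_strip \<beta> ?Q as \<and> hd as = sum_list (take i \<gamma>) + 1 \<and> length as = \<gamma> ! i) \<longleftrightarrow> S"
    using row_strips_iff[OF p pos] C unfolding S_def by blast
  define R where "R \<longleftrightarrow> (\<forall>as. row_strip \<beta> ?Q as \<longrightarrow> column_of \<beta> ?Q (hd as) = 1) \<and>
      (\<forall>i<length \<gamma>. \<exists>as. row_strip \<beta> ?Q as \<and> hd as = sum_list (take i \<gamma>) + 1 \<and> length as = \<gamma> ! i)"
  have RF: "?Q \<in> standard_fillings \<beta>" "\<forall>c c' r. (c, r) \<in> diagram \<beta> \<and> (c', r) \<in> diagram \<beta> \<and> c < c' \<longrightarrow> ?Q (c, r) < ?Q (c', r)"
    using filling_row_fillings[OF v] unfolding row_fillings_def by blast+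
  have "?Q \<in> DIRT \<beta> \<and> has_row_strip_shape \<beta> ?Q \<gamma> \<longleftrightarrow>
    R \<and>
    (\<forall>r r'. (1, r) \<in> diagram \<beta> \<and> (1, r') \<in> diagram \<beta> \<and> r < r' \<longrightarrow> ?Q (1, r') < ?Q (1, r)) \<and>
    (\<forall>c r r'. r' < r \<and> (c, r) \<in> diagram \<beta> \<and> (c, r') \<in> diagram \<beta> \<and> ?Q (c, r') < ?Q (c, r) \<longrightarrow>
        (c + 1, r') \<in> diagram \<beta> \<and> ?Q (c + 1, r') < ?Q (c, r))"
    using RF g unfolding DIRT_def has_row_strip_shape_def R_def by blast
  also have "\<dots> \<longleftrightarrow> strip_word (length \<beta>) \<gamma> v"
  proof -
    have "strip_word (length \<beta>) \<gamma> v \<longleftrightarrow> (\<forall>k<length v. block_step (length \<beta>) (?x k) (v ! k)) \<and> S"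
      unfolding strip_word_def S_def using len p(2) by auto
    then show ?thesis
      unfolding I[folded R_def] filling_first_column_decreasing_iff[OF b v] filling_recording_iff[OF v]
        block_step_def using rows by blast
  qed
  finally show ?thesis .
qed

lemma dirt_coeff_strips:
  assumes a: "\<alpha> \<in> compositions n" and b: "\<beta> \<in> compositions n"
  shows "dirt_coeff \<alpha> \<beta> = card {ys. strips 0 \<alpha> ys \<and> top_state ys = nth_default 0 \<beta>}"
proof -
  have p: "0 \<notin> set \<alpha>" "sum_list \<alpha> = n" "0 \<notin> set \<beta>" "sum_list \<beta> = n" using a b by (auto simp: compositions_pos)
  have g: "rev \<alpha> \<in> compositions (sum_list \<beta>)" using p by (simp add: compositions_pos sum_list_rev)
  let ?V = "{v \<in> row_words \<beta>. strip_word (length \<beta>) (rev \<alpha>) v}"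
  have "bij_betw (filling \<beta>) ?V {Q \<in> DIRT \<beta>. has_row_strip_shape \<beta> Q (rev \<alpha>)}"
  proof (intro bij_betw_imageI equalityI subsetI)
    show "inj_on (filling \<beta>) ?V" by (rule inj_on_subset[OF filling_inj]) blast
  next
    fix Q assume "Q \<in> filling \<beta> ` ?V"
    then show "Q \<in> {Q \<in> DIRT \<beta>. has_row_strip_shape \<beta> Q (rev \<alpha>)}" using DIRT_filling_iff[OF p(3) g] by blast
  next
    fix Q assume Q: "Q \<in> {Q \<in> DIRT \<beta>. has_row_strip_shape \<beta> Q (rev \<alpha>)}"
    then have "Q \<in> row_fillings \<beta>" by (auto simp: DIRT_def row_fillings_def)
    then obtain v where "v \<in> row_words \<beta>" "filling \<beta> v = Q" using filling_surj by blast
    then show "Q \<in> filling \<beta> ` ?V" using DIRT_filling_iff[OF p(3) g, of v] Q by blast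
  qed
  then have "dirt_coeff \<alpha> \<beta> = card ?V" unfolding dirt_coeff_def by (simp add: bij_betw_same_card)
  also have "?V = {v. strip_word (length \<beta>) (rev \<alpha>) v \<and> count_list v = nth_default 0 \<beta>}"
    using p by (auto simp: row_words_def strip_word_def sum_list_rev)
  finally show ?thesis using card_strip_words[OF p(1,3)] by simp
qed

theorem theorem4p16:
  fixes n :: nat and \<alpha> :: "nat list"
  assumes "1 \<le> n" and "\<alpha> \<in> peak_compositions n"
  shows "schur_Q \<alpha> =
    (\<lambda>m. \<Sum>\<beta>\<in>peak_compositions n. int (dirt_coeff \<alpha> \<beta>) * peak_young_schur \<beta> m)"
proof
  fix m
  \<comment> \<open>Both sides are compared at one monomial, where only the composition of its
    exponents contributes.\<close>
  let ?\<gamma> = "exponents m"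
  let ?ok = "\<lambda>D. \<forall>p\<in>Peak D. p \<in> comp_set ?\<gamma> \<or> p - 1 \<in> comp_set ?\<gamma>"
  let ?c = "Poly_Mapping.lookup m 0 = 0 \<and> ?\<gamma> \<in> compositions n"
  have n: "sum_list \<alpha> = n" and \<alpha>: "\<alpha> \<in> compositions n"
    using assms(2) by (auto simp: peak_compositions_def compositions_def)
  have L: "schur_Q \<alpha> m = (if ?c then int (card {T \<in> MPCT \<alpha>. weight_comp \<alpha> T = ?\<gamma>}) else 0)"
  proof -
    have "monomial_qsym (weight_comp \<alpha> T) m =
        (if weight_comp \<alpha> T = ?\<gamma> then if ?c then 1 else 0 else 0)" if "T \<in> MPCT \<alpha>" for T
      using weight_comp_positive(1)[OF that] n by (auto simp: monomial_qsym_eq compositions_pos)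
    then have "schur_Q \<alpha> m = (\<Sum>T\<in>MPCT \<alpha>. if weight_comp \<alpha> T = ?\<gamma> then if ?c then 1 else 0 else 0)"
      unfolding schur_Q_def by (rule sum.cong[OF refl])
    also have "\<dots> = (\<Sum>T\<in>{T \<in> MPCT \<alpha>. weight_comp \<alpha> T = ?\<gamma>}. if ?c then 1 else 0)"
      by (rule sum.inter_filter[OF finite_MPCT, symmetric])
    finally show ?thesis by simp
  qed
  have R: "peak_young_schur \<beta> m =
      (if ?c then 2 ^ length ?\<gamma> * int (card {T \<in> SPYCT \<beta>. ?ok (Des_left \<beta> T)}) else 0)"
    if \<beta>: "\<beta> \<in> peak_compositions n" for \<beta>
  proof -
    have s: "sum_list \<beta> = n" using \<beta> by (simp add: peak_compositions_iff)
    have "peak_qsym (comp_of_set n (Peak (Des_left \<beta> T))) m =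
        (if ?ok (Des_left \<beta> T) then if ?c then 2 ^ length ?\<gamma> else 0 else 0)" for T
    proof -
      have D: "Des_left \<beta> T \<subseteq> {1..<n}" by (auto simp: Des_left_def s)
      show ?thesis unfolding peak_qsym_eq[OF assms(1) D] by auto
    qed
    then have "peak_young_schur \<beta> m =
        (\<Sum>T\<in>SPYCT \<beta>. if ?ok (Des_left \<beta> T) then if ?c then 2 ^ length ?\<gamma> else 0 else 0)"
      unfolding peak_young_schur_def s by simp
    also have "\<dots> = (\<Sum>T\<in>{T \<in> SPYCT \<beta>. ?ok (Des_left \<beta> T)}. if ?c then 2 ^ length ?\<gamma> else 0)"
      by (rule sum.inter_filter[OF finite_SPYCT, symmetric])
    finally show ?thesis by simp
  qed
  show "schur_Q \<alpha> m = (\<Sum>\<beta>\<in>peak_compositions n. int (dirt_coeff \<alpha> \<beta>) * peak_young_schur \<beta> m)"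
  proof (cases ?c)
    case False
    have "(\<Sum>\<beta>\<in>peak_compositions n. int (dirt_coeff \<alpha> \<beta>) * peak_young_schur \<beta> m) = 0"
    proof (rule sum.neutral, rule ballI)
      fix \<beta> assume "\<beta> \<in> peak_compositions n"
      from R[OF this] show "int (dirt_coeff \<alpha> \<beta>) * peak_young_schur \<beta> m = 0"
        unfolding if_not_P[OF False] by simp
    qed
    then show ?thesis unfolding L if_not_P[OF False] by simp
  next
    case True
    have d: "dirt_coeff \<alpha> \<beta> = card {ys. strips 0 \<alpha> ys \<and> top_state ys = nth_default 0 \<beta>}"
      if "\<beta> \<in> peak_compositions n" for \<beta>
      using dirt_coeff_strips[OF \<alpha>] that by (simp add: peak_compositions_def)
    have "schur_Q \<alpha> m = int (2 ^ length ?\<gamma> * card {v. peak_word v \<and> shape v = \<alpha> \<and> ?ok (row_descents v)})"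
      unfolding L if_P[OF True] using card_MPCT_weight[OF assms] True by simp
    \<comment> \<open>Words are traded for pairs of a tableau and a chain, and by \<open>d\<close>
      the chains are counted by \<open>dirt_coeff\<close>.\<close>
    also have "\<dots> = (\<Sum>\<beta>\<in>peak_compositions n. int (dirt_coeff \<alpha> \<beta>) * (2 ^ length ?\<gamma> * int (card {T \<in> SPYCT \<beta>. ?ok (Des_left \<beta> T)})))"
      unfolding card_words_by_descents[OF assms(2), of ?ok]
      by (simp add: d sum_distrib_left mult_ac cong: sum.cong)
    also have "\<dots> = (\<Sum>\<beta>\<in>peak_compositions n. int (dirt_coeff \<alpha> \<beta>) * peak_young_schur \<beta> m)"
      by (rule sum.cong[OF refl]) (simp only: R if_P[OF True])
    finally show ?thesis .
  qed
qed

end
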